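(* Let $L=\partial_x^2+\partial_{y_1}^2-\partial_{y_2}^2$ on $\mathbb R\times\mathbb T^2$. There exist constants $0<c\le C<\infty$ such that for every dyadic $N\ge 2$, $$c\,N^{1/5}\le \left\|e^{itL}P_{\le N}\right\|_{L^2(\mathbb R\times\mathbb T^2)\to L^{10/3}([0,1]\times\mathbb R\times\mathbb T^2)}\le C\,N^{1/5}.$$ The constants $c,C$ are independent of $N$ (they may depend on the fixed cutoff $\chi$).
   Context: $\mathbb T=\mathbb R/(2\pi\mathbb Z)$ with Lebesgue measure on $[0,2\pi)$. Points of $\mathbb R\times\mathbb T^2$ are written $(x,y)=(x,y_1,y_2)$. The Fourier transform is $$\widehat f(\xi,k)=(2\pi)^{-3/2}\int_{\mathbb R}\int_{\mathbb T^2}f(x,y)e^{-i(x\xi+y\cdot k)}\,dy\,dx,\qquad (\xi,k)\in\mathbb R\times\mathbb Z^2.$$ The propagator $e^{itL}$ is the Fourier multiplier operator with symbol $e^{-it(\xi^2+k_1^2-k_2^2)}$. Fix an even function $\chi\in C_c^\infty(\mathbb R)$ with values in $[0,1]$, equal to $1$ on $[-1,1]$ and supported in $[-2,2]$. For dyadic $N\ge2$ (a power of two), the frequency cutoff $P_{\le N}$ is defined by $\widehat{P_{\le N}f}(\xi,k)=\chi\bigl(N^{-1}\sqrt{\xi^2+|k|^2}\bigr)\widehat f(\xi,k)$. The operator norm is that of the map $f\mapsto \bigl((t,x,y)\mapsto (e^{itL}P_{\le N}f)(x,y)\bigr)$. *)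

theory Defs
  imports "HOL-Analysis.Analysis"
begin

section \<open>Lebesgue norms\<close>

text \<open>The \<open>L\<^sup>p\<close> norm (\<open>0 < p < \<infinity>\<close>) as an extended nonnegative real; the case distinction only
  supplies the convention \<open>\<infinity> powr (1/p) = \<infinity>\<close>, there being no real power on \<^typ>\<open>ennreal\<close>.\<close>

definition Lp_norm :: "real \<Rightarrow> 'a measure \<Rightarrow> ('a \<Rightarrow> complex) \<Rightarrow> ennreal" where
  "Lp_norm p M f =
     (let I = (\<integral>\<^sup>+ z. ennreal (norm (f z) powr p) \<partial>M)
      in if I = \<infinity> then \<infinity> else ennreal (enn2real I powr (1 / p)))"

definition in_Lp :: "real \<Rightarrow> 'a measure \<Rightarrow> ('a \<Rightarrow> complex) \<Rightarrow> bool" where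
  "in_Lp p M f \<longleftrightarrow> f \<in> borel_measurable M \<and> Lp_norm p M f < \<infinity>"

section \<open>Physical and frequency space\<close>

text \<open>The torus \<open>\<real>/(2\<pi>\<int>)\<close> is identified with its fundamental domain \<open>[0,2\<pi>)\<close>; a function on the
  torus is a function on \<open>[0,2\<pi>)\<close>, and its values elsewhere never matter.\<close>

definition torus :: "real measure" where
  "torus = restrict_space lborel {0..<2 * pi}"

definition phys :: "(real \<times> real \<times> real) measure" where
  "phys = lborel \<Otimes>\<^sub>M (torus \<Otimes>\<^sub>M torus)"

definition freq :: "(real \<times> int \<times> int) measure" where
  "freq = lborel \<Otimes>\<^sub>M (count_space UNIV \<Otimes>\<^sub>M count_space UNIV)"

definition spacetime :: "(real \<times> real \<times> real \<times> real) measure" where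
  "spacetime = restrict_space lborel {0..1} \<Otimes>\<^sub>M phys"

section \<open>Fourier transform\<close>

definition fourier_integral ::
    "(real \<times> real \<times> real \<Rightarrow> complex) \<Rightarrow> real \<times> int \<times> int \<Rightarrow> complex" where
  "fourier_integral f = (\<lambda>(\<xi>, k1, k2).
     complex_of_real ((2 * pi) powr (- 3 / 2)) *
     (\<integral>(x, y1, y2). f (x, y1, y2) * cis (- (x * \<xi> + (y1 * of_int k1 + y2 * of_int k2))) \<partial>phys))"

text \<open>The integral converges absolutely only on \<open>L\<^sup>1\<close>. On \<open>L\<^sup>2\<close> the Fourier transform is the
  continuous extension from the dense subspace \<open>L\<^sup>1 \<inter> L\<^sup>2\<close>. It is given here by its graph (the
  closure of the graph over \<open>L\<^sup>1 \<inter> L\<^sup>2\<close>), so that \<open>F\<close> may be any representative of its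
  almost-everywhere class.\<close>

definition has_fourier ::
    "(real \<times> real \<times> real \<Rightarrow> complex) \<Rightarrow> (real \<times> int \<times> int \<Rightarrow> complex) \<Rightarrow> bool" where
  "has_fourier f F \<longleftrightarrow> in_Lp 2 phys f \<and> in_Lp 2 freq F \<and>
     (\<exists>\<phi>. (\<forall>n::nat. integrable phys (\<phi> n) \<and> in_Lp 2 phys (\<phi> n)) \<and>
          (\<lambda>n. Lp_norm 2 phys (\<lambda>z. \<phi> n z - f z)) \<longlonglongrightarrow> 0 \<and>
          (\<lambda>n. Lp_norm 2 freq (\<lambda>\<zeta>. fourier_integral (\<phi> n) \<zeta> - F \<zeta>)) \<longlonglongrightarrow> 0)"

text \<open>\<open>g\<close> represents the image of \<open>f \<in> L\<^sup>2\<close> under the Fourier multiplier operator with symbol \<open>m\<close>.\<close>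

definition is_multiplier_image ::
    "(real \<times> int \<times> int \<Rightarrow> complex) \<Rightarrow>
     (real \<times> real \<times> real \<Rightarrow> complex) \<Rightarrow> (real \<times> real \<times> real \<Rightarrow> complex) \<Rightarrow> bool" where
  "is_multiplier_image m f g \<longleftrightarrow> (\<exists>F. has_fourier f F \<and> has_fourier g (\<lambda>\<zeta>. m \<zeta> * F \<zeta>))"

definition propagator_symbol :: "real \<Rightarrow> real \<times> int \<times> int \<Rightarrow> complex" where
  "propagator_symbol t = (\<lambda>(\<xi>, k1, k2).
     cis (- t * (\<xi>\<^sup>2 + (of_int k1)\<^sup>2 - (of_int k2)\<^sup>2)))"

definition cutoff_symbol :: "(real \<Rightarrow> real) \<Rightarrow> real \<Rightarrow> real \<times> int \<times> int \<Rightarrow> complex" where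
  "cutoff_symbol chi N = (\<lambda>(\<xi>, k1, k2).
     complex_of_real (chi (sqrt (\<xi>\<^sup>2 + ((of_int k1)\<^sup>2 + (of_int k2)\<^sup>2)) / N)))"

section \<open>The cutoff evolution and its operator norm\<close>

definition admissible_cutoff :: "(real \<Rightarrow> real) \<Rightarrow> bool" where
  "admissible_cutoff chi \<longleftrightarrow>
     (\<forall>n x. ((deriv ^^ n) chi) differentiable (at x)) \<and>
     (\<forall>x. chi (- x) = chi x) \<and>
     (\<forall>x. 0 \<le> chi x \<and> chi x \<le> 1) \<and>
     (\<forall>x\<in>{-1..1}. chi x = 1) \<and>
     (\<forall>x. x \<notin> {-2..2} \<longrightarrow> chi x = 0)"

text \<open>\<open>u\<close> represents \<open>(t, x, y) \<mapsto> (e\<^sup>i\<^sup>t\<^sup>L P\<^sub>\<le>\<^sub>N f)(x, y)\<close>. For each \<open>t\<close> the function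
  \<open>e\<^sup>i\<^sup>t\<^sup>L P\<^sub>\<le>\<^sub>N f\<close> is determined up to a null set of \<open>phys\<close>; joint measurability of \<open>u\<close> then makes it
  unique up to a null set of \<open>spacetime\<close>.\<close>

definition is_evolution ::
    "(real \<Rightarrow> real) \<Rightarrow> real \<Rightarrow>
     (real \<times> real \<times> real \<Rightarrow> complex) \<Rightarrow> (real \<times> real \<times> real \<times> real \<Rightarrow> complex) \<Rightarrow> bool" where
  "is_evolution chi N f u \<longleftrightarrow> u \<in> borel_measurable spacetime \<and>
     (\<exists>h. is_multiplier_image (cutoff_symbol chi N) f h \<and>
          (\<forall>t\<in>{0..1}. is_multiplier_image (propagator_symbol t) h (\<lambda>z. u (t, z))))"

text \<open>The norm of an operator \<open>L\<^sup>p(M) \<rightarrow> L\<^sup>q(M')\<close>, given by its graph \<open>T\<close>, as a supremum over the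
  unit ball; the value \<open>\<infinity>\<close> means that the operator is unbounded.\<close>

definition operator_norm ::
    "real \<Rightarrow> 'a measure \<Rightarrow> real \<Rightarrow> 'b measure \<Rightarrow>
     (('a \<Rightarrow> complex) \<Rightarrow> ('b \<Rightarrow> complex) \<Rightarrow> bool) \<Rightarrow> ennreal" where
  "operator_norm p M q M' T =
     Sup {Lp_norm q M' u | f u. in_Lp p M f \<and> Lp_norm p M f \<le> 1 \<and> T f u}"

end

theory Submission
  imports Defs "HOL-Probability.Levy"
begin

text \<open>Why the norm has size \<open>N\<^sup>1\<^sup>/\<^sup>5\<close>.

\<^bold>\<open>Lower bound.\<close> The form \<open>k\<^sub>1\<^sup>2 - k\<^sub>2\<^sup>2\<close> vanishes on the line \<open>k\<^sub>2 = - k\<^sub>1\<close>, so a function with spectrum on this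
line does not disperse in \<open>y\<close>. The datum with spectrum \<open>tent(\<xi>)\<close> on the \<open>K = N/2\<close> points \<open>(k, - k)\<close>,
\<open>0 \<le> k < K\<close>, normalised in \<open>L\<^sup>2\<close>, keeps modulus of order \<open>K\<^sup>1\<^sup>/\<^sup>2\<close> for all times in \<open>[0,1]\<close> on a set of
measure of order \<open>1/K\<close>, given by \<open>|x| \<le> 1/2\<close> and \<open>0 \<le> y\<^sub>1 - y\<^sub>2 \<le> 1/(2K)\<close> (lemma \<open>wave_focus_lower\<close>). Its \<open>L\<^sup>1\<^sup>0\<^sup>/\<^sup>3\<close> norm is
therefore at least of order \<open>K\<^sup>1\<^sup>/\<^sup>2 K\<^sup>-\<^sup>3\<^sup>/\<^sup>1\<^sup>0 = K\<^sup>1\<^sup>/\<^sup>5\<close>.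

\<^bold>\<open>Upper bound.\<close> The exponent \<open>10/3\<close> lies between \<open>2\<close>, where the evolution is bounded, and \<open>4\<close>, where it has
norm of order \<open>N\<^sup>1\<^sup>/\<^sup>4\<close>; interpolation (lemma \<open>interpolate_powr\<close>) gives \<open>N\<^sup>1\<^sup>/\<^sup>5\<close>. For the fourth power
(theorem \<open>L4_estimate\<close>) one writes \<open>u\<^sup>2\<close> as a superposition of products of two plane waves and applies
Schur's test to the kernel of \<open>T T\<^sup>*\<close>. With a Gaussian weight in time, the kernel is concentrated on
pairs of frequencies with the same sum and almost the same total energy. Once the sum is fixed, the
energy is \<open>2 d\<^sup>2 + a b / 2\<close> up to a constant, where \<open>d\<close> is the relative frequency in \<open>x\<close> and the integers
\<open>a\<close>, \<open>b\<close> of size \<open>O(N)\<close> are the null coordinates of the relative frequency in \<open>y\<close>. Hence the quantity to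
be bounded is
\<open>\<Sum>\<^sub>a\<^sub>,\<^sub>b |{d. |2 d\<^sup>2 + a b / 2 - \<tau>| \<le> 1}|\<close>, which is at most a constant times \<open>\<Sum>\<^sub>a\<^sub>,\<^sub>b (1 + |\<tau> - a b / 2|)\<^sup>-\<^sup>1\<^sup>/\<^sup>2\<close>. The row
\<open>a = 0\<close> contributes \<open>O(N)\<close>; in a row \<open>a \<noteq> 0\<close> the points \<open>a b / 2\<close> are \<open>|a|/2\<close> apart, so the row contributes
\<open>O(1 + (N/|a|)\<^sup>1\<^sup>/\<^sup>2)\<close>, and summation over \<open>a\<close> gives \<open>O(N)\<close> (lemma \<open>resonance_double_sum\<close>). No arithmetic of
the divisor function enters, which is why there is no loss of \<open>N\<^sup>\<epsilon>\<close>.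

\<^bold>\<open>Fourier analysis.\<close> Since the Fourier transform on \<open>L\<^sup>2\<close> is given by the closure of a graph, one
must know that \<open>e\<^sup>i\<^sup>t\<^sup>L P\<^sub>\<le>\<^sub>N f\<close> is the function given by the absolutely convergent inverse Fourier integral.
Schur's test also yields Bessel's inequality for this inverse integral, hence by duality for the
transform itself (theorem \<open>bessel_inequality\<close>), so that a function determines its transform. In the other
direction the transform determines the function (theorem \<open>has_fourier_imp_fourier_inverse\<close>) because an
integrable function is determined by its Fourier coefficients: on the line by Levy's uniqueness theorem, on
the torus by the Stone-Weierstrass theorem. The lower bound also uses Plancherel's identity, for spectra that
are continuous in \<open>\<xi>\<close> (theorem \<open>plancherel_continuous\<close>), to show that its datum has the prescribed transform.\<close>

section \<open>Square-integrable functions\<close>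

lemma borel_measurable_cnj [measurable (raw)]:
  "f \<in> borel_measurable M \<Longrightarrow> (\<lambda>x. cnj (f x)) \<in> borel_measurable M"
  by (rule borel_measurable_continuous_on[OF continuous_on_cnj[OF continuous_on_id]])

text \<open>The square of the \<open>L\<^sup>2\<close> norm: unlike the norm, it is an integral, so that limits and sums
  can be taken under it without extracting roots.\<close>

definition L2sq :: "'a measure \<Rightarrow> ('a \<Rightarrow> complex) \<Rightarrow> ennreal" where
  "L2sq M f = (\<integral>\<^sup>+ z. ennreal ((norm (f z))\<^sup>2) \<partial>M)"

lemma L2sq_eq_Lp_norm: "L2sq M f = (Lp_norm 2 M f)\<^sup>2"
proof -
  have I: "(\<integral>\<^sup>+ z. ennreal (norm (f z) powr 2) \<partial>M) = L2sq M f"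
    unfolding L2sq_def by (simp add: powr_numeral)
  show ?thesis
  proof (cases "L2sq M f = \<infinity>")
    case True
    then show ?thesis unfolding Lp_norm_def I Let_def by (simp add: power2_eq_square ennreal_top_mult)
  next
    case False
    then obtain r where r: "L2sq M f = ennreal r" "r \<ge> 0" by (cases "L2sq M f") auto
    show ?thesis unfolding Lp_norm_def I Let_def using r
      by (simp add: ennreal_power powr_half_sqrt)
  qed
qed

lemma Lp_norm_2_le_1_iff: "Lp_norm 2 M f \<le> 1 \<longleftrightarrow> L2sq M f \<le> 1"
proof -
  have "x \<le> 1 \<longleftrightarrow> x\<^sup>2 \<le> 1" for x :: ennreal
    by (metis (no_types, lifting) linorder_not_le mult_left_mono mult_right_mono nle_le one_power2
        order_trans power2_eq_square zero_le mult.right_neutral mult.left_neutral)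
  then show ?thesis by (simp add: L2sq_eq_Lp_norm)
qed

lemma in_L2_iff: "in_Lp 2 M f \<longleftrightarrow> f \<in> borel_measurable M \<and> L2sq M f < \<infinity>"
  unfolding in_Lp_def L2sq_eq_Lp_norm by (simp add: power_less_top_ennreal)

lemma Lp_norm_2_tendsto_0_iff:
  "((\<lambda>n. Lp_norm 2 M (f n)) \<longlonglongrightarrow> 0) \<longleftrightarrow> ((\<lambda>n. L2sq M (f n)) \<longlonglongrightarrow> 0)"
proof
  assume "(\<lambda>n. Lp_norm 2 M (f n)) \<longlonglongrightarrow> 0"
  then have "(\<lambda>n. Lp_norm 2 M (f n) * Lp_norm 2 M (f n)) \<longlonglongrightarrow> 0 * 0"
    by (intro tendsto_mult_ennreal) auto
  then show "(\<lambda>n. L2sq M (f n)) \<longlonglongrightarrow> 0"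
    by (simp add: L2sq_eq_Lp_norm power2_eq_square)
next
  assume *: "(\<lambda>n. L2sq M (f n)) \<longlonglongrightarrow> 0"
  show "(\<lambda>n. Lp_norm 2 M (f n)) \<longlonglongrightarrow> 0"
  proof (rule order_tendstoI)
    fix a :: ennreal assume "0 < a"
    then have "0 < a\<^sup>2" by (simp add: power2_eq_square ennreal_zero_less_mult_iff)
    with * have "\<forall>\<^sub>F n in sequentially. L2sq M (f n) < a\<^sup>2" by (auto dest: order_tendstoD)
    then show "\<forall>\<^sub>F n in sequentially. Lp_norm 2 M (f n) < a"
      by eventually_elim (metis L2sq_eq_Lp_norm linorder_not_le power_mono zero_le)
  qed auto
qed

lemma norm_add_square_le: "(norm (a + b :: complex))\<^sup>2 \<le> 2 * (norm a)\<^sup>2 + 2 * (norm b)\<^sup>2"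
proof -
  have "(norm (a + b))\<^sup>2 \<le> (norm a + norm b)\<^sup>2" by (intro power_mono norm_triangle_ineq) auto
  also have "\<dots> \<le> 2 * (norm a)\<^sup>2 + 2 * (norm b)\<^sup>2"
    using sum_squares_ge_zero[of "norm a - norm b" 0] by (simp add: power2_eq_square algebra_simps)
  finally show ?thesis .
qed

lemma L2sq_add_le:
  assumes [measurable]: "f \<in> borel_measurable M" "g \<in> borel_measurable M"
  shows "L2sq M (\<lambda>z. f z + g z) \<le> 2 * L2sq M f + 2 * L2sq M g"
proof -
  have "L2sq M (\<lambda>z. f z + g z) \<le> (\<integral>\<^sup>+ z. 2 * ennreal ((norm (f z))\<^sup>2) + 2 * ennreal ((norm (g z))\<^sup>2) \<partial>M)"
    unfolding L2sq_def
  proof (intro nn_integral_mono)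
    fix z
    have "ennreal ((norm (f z + g z))\<^sup>2) \<le> ennreal (2 * (norm (f z))\<^sup>2 + 2 * (norm (g z))\<^sup>2)"
      by (intro ennreal_leI norm_add_square_le)
    also have "\<dots> = 2 * ennreal ((norm (f z))\<^sup>2) + 2 * ennreal ((norm (g z))\<^sup>2)"
      by (simp add: ennreal_plus ennreal_mult)
    finally show "ennreal ((norm (f z + g z))\<^sup>2) \<le> 2 * ennreal ((norm (f z))\<^sup>2) + 2 * ennreal ((norm (g z))\<^sup>2)" .
  qed
  also have "\<dots> = 2 * L2sq M f + 2 * L2sq M g"
    unfolding L2sq_def by (simp add: nn_integral_add nn_integral_cmult)
  finally show ?thesis .
qed

lemma L2sq_diff_le:
  assumes [measurable]: "f \<in> borel_measurable M" "g \<in> borel_measurable M"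
  shows "L2sq M (\<lambda>z. f z - g z) \<le> 2 * L2sq M f + 2 * L2sq M g"
  using L2sq_add_le[of f M "\<lambda>z. - g z"] by (simp add: L2sq_def)

lemma L2sq_mono: "(\<And>z. z \<in> space M \<Longrightarrow> norm (f z) \<le> norm (g z)) \<Longrightarrow> L2sq M f \<le> L2sq M g"
  unfolding L2sq_def by (intro nn_integral_mono ennreal_leI power_mono) auto

lemma ennreal_norm_integral_le:
  "ennreal (norm (integral\<^sup>L M f)) \<le> (\<integral>\<^sup>+ x. ennreal (norm (f x)) \<partial>M)"
  by (cases "integrable M f") (auto simp: integral_norm_bound_ennreal not_integrable_integral_eq)

lemma integrable_square_norm:
  assumes "f \<in> borel_measurable M" "L2sq M f < \<infinity>"
  shows "integrable M (\<lambda>z. (norm (f z))\<^sup>2)"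
  using assms unfolding L2sq_def by (intro integrableI_bounded) auto

lemma L2sq_eq_integral:
  assumes "integrable M (\<lambda>z. (norm (f z))\<^sup>2)"
  shows "L2sq M f = ennreal (\<integral>z. (norm (f z))\<^sup>2 \<partial>M)"
  unfolding L2sq_def using assms by (intro nn_integral_eq_integral) auto

lemma integrable_L2_mult:
  fixes f g :: "'a \<Rightarrow> complex"
  assumes [measurable]: "f \<in> borel_measurable M" "g \<in> borel_measurable M"
    and "L2sq M f < \<infinity>" "L2sq M g < \<infinity>"
  shows "integrable M (\<lambda>z. f z * g z)"
proof (rule Bochner_Integration.integrable_bound)
  show "integrable M (\<lambda>z. (norm (f z))\<^sup>2 + (norm (g z))\<^sup>2)"
    using assms by (intro Bochner_Integration.integrable_add integrable_square_norm)
  show "AE z in M. norm (f z * g z) \<le> norm ((norm (f z))\<^sup>2 + (norm (g z))\<^sup>2)"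
  proof (intro AE_I2)
    fix z
    have "norm (f z) * norm (g z) * 2 \<le> (norm (f z))\<^sup>2 + (norm (g z))\<^sup>2"
      using sum_squares_bound[of "norm (f z)" "norm (g z)"] by simp
    moreover have "norm (f z) * norm (g z) \<ge> 0" by simp
    ultimately have "norm (f z) * norm (g z) \<le> (norm (f z))\<^sup>2 + (norm (g z))\<^sup>2"
      by linarith
    then show "norm (f z * g z) \<le> norm ((norm (f z))\<^sup>2 + (norm (g z))\<^sup>2)"
      by (simp add: norm_mult)
  qed
qed measurable

lemma square_norm_integral_mult_le:
  assumes [measurable]: "f \<in> borel_measurable M" "g \<in> borel_measurable M"
  shows "ennreal ((norm (\<integral>z. f z * g z \<partial>M))\<^sup>2) \<le> L2sq M f * L2sq M g"
proof -
  have "ennreal (norm (\<integral>z. f z * g z \<partial>M)) \<le> (\<integral>\<^sup>+z. ennreal (norm (f z)) * ennreal (norm (g z)) \<partial>M)"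
    using ennreal_norm_integral_le[of M "\<lambda>z. f z * g z"] by (simp add: norm_mult ennreal_mult)
  then have "(ennreal (norm (\<integral>z. f z * g z \<partial>M)))\<^sup>2 \<le> (\<integral>\<^sup>+z. ennreal (norm (f z)) * ennreal (norm (g z)) \<partial>M)\<^sup>2"
    by (intro power_mono) auto
  also have "\<dots> \<le> (\<integral>\<^sup>+z. (ennreal (norm (f z)))\<^sup>2 \<partial>M) * (\<integral>\<^sup>+z. (ennreal (norm (g z)))\<^sup>2 \<partial>M)"
    by (intro Cauchy_Schwarz_nn_integral) measurable
  finally show ?thesis by (simp add: L2sq_def ennreal_power)
qed

text \<open>Strong \<open>L\<^sup>2\<close> convergence implies weak convergence; all limits in the definition of the
  Fourier transform are used through pairings with a fixed function.\<close>

lemma L2_mult_integral_tendsto_0: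
  fixes f :: "nat \<Rightarrow> 'a \<Rightarrow> complex"
  assumes [measurable]: "\<And>n. f n \<in> borel_measurable M" "g \<in> borel_measurable M"
    and f: "(\<lambda>n. L2sq M (f n)) \<longlonglongrightarrow> 0" and g: "L2sq M g < \<infinity>"
  shows "(\<lambda>n. \<integral>z. f n z * g z \<partial>M) \<longlonglongrightarrow> 0"
proof -
  have b: "ennreal ((norm (\<integral>z. f n z * g z \<partial>M))\<^sup>2) \<le> L2sq M (f n) * L2sq M g" for n
    by (rule square_norm_integral_mult_le) measurable
  have "(\<lambda>n. L2sq M (f n) * L2sq M g) \<longlonglongrightarrow> 0 * L2sq M g"
    using f g by (intro tendsto_mult_ennreal tendsto_const) auto
  then have "(\<lambda>n. ennreal ((norm (\<integral>z. f n z * g z \<partial>M))\<^sup>2)) \<longlonglongrightarrow> ennreal 0"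
    unfolding ennreal_0 mult_zero_left
    by (rule tendsto_sandwich[OF always_eventually always_eventually tendsto_const, rotated 2])
       (use b in auto)
  then have "(\<lambda>n. (norm (\<integral>z. f n z * g z \<partial>M))\<^sup>2) \<longlonglongrightarrow> 0"
    by (subst (asm) tendsto_ennreal_iff) auto
  then have "(\<lambda>n. sqrt ((norm (\<integral>z. f n z * g z \<partial>M))\<^sup>2)) \<longlonglongrightarrow> sqrt 0"
    by (intro tendsto_real_sqrt)
  then show ?thesis by (simp add: tendsto_norm_zero_iff)
qed

section \<open>Schur's test for \<open>T T\<^sup>*\<close>\<close>

lemma norm_integral_mult_le:
  fixes a g :: "'b \<Rightarrow> complex"
  assumes a: "integrable M a" and g: "\<And>p. norm (g p) \<le> 1"
  shows "norm (\<integral>p. a p * g p \<partial>M) \<le> (\<integral>p. norm (a p) \<partial>M)"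
proof -
  have "norm (\<integral>p. a p * g p \<partial>M) \<le> (\<integral>p. norm (a p * g p) \<partial>M)" by simp
  also have "\<dots> \<le> (\<integral>p. norm (a p) \<partial>M)"
    by (rule integral_mono') (use a g in \<open>auto simp: norm_mult intro!: mult_left_le\<close>)
  finally show ?thesis .
qed

text \<open>For \<open>T a (z) = \<integral> a(p) e(z,p) dM(p)\<close> this is \<open>\<parallel>T a\<parallel>\<^sup>2 = \<langle>T\<^sup>* T a, a\<rangle>\<close>, obtained by expanding the square and
  exchanging integrals. The inner integral is the matrix of inner products of the functions
  \<open>z \<mapsto> e(z,p)\<close>.\<close>

lemma TTstar_identity:
  fixes a :: "'b \<Rightarrow> complex" and e :: "'a \<Rightarrow> 'b \<Rightarrow> complex"
  assumes M: "sigma_finite_measure M" and W: "finite_measure W"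
    and e[measurable]: "(\<lambda>(z, p). e z p) \<in> borel_measurable (W \<Otimes>\<^sub>M M)"
    and e1: "\<And>z p. norm (e z p) \<le> 1"
    and a: "integrable M a"
  shows "complex_of_real (\<integral>z. (norm (\<integral>p. a p * e z p \<partial>M))\<^sup>2 \<partial>W) =
    (\<integral>p. a p * (\<integral>p'. cnj (a p') * (\<integral>z. e z p * cnj (e z p') \<partial>W) \<partial>M) \<partial>M)"
proof -
  interpret M: sigma_finite_measure M by fact
  interpret W: finite_measure W by fact
  interpret P: pair_sigma_finite W M ..
  have [measurable]: "a \<in> borel_measurable M" using a by auto
  have e': "e z \<in> borel_measurable M" if "z \<in> space W" for z
    using measurable_Pair2[OF e that] by simp
  have e'': "(\<lambda>z. e z p) \<in> borel_measurable W" if "p \<in> space M" for p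
    using measurable_Pair1[OF e that] by simp
  define I where "I z = (\<integral>p. a p * e z p \<partial>M)" for z
  have [measurable]: "I \<in> borel_measurable W"
    unfolding I_def by (intro M.borel_measurable_lebesgue_integral) measurable
  have I1: "norm (I z) \<le> (\<integral>p. norm (a p) \<partial>M)" for z
    unfolding I_def by (rule norm_integral_mult_le[OF a e1])
  have fub: "integrable (W \<Otimes>\<^sub>M M) (\<lambda>(z, p). b p * g z p)"
    if b: "integrable M b" and [measurable]: "(\<lambda>(z, p). g z p) \<in> borel_measurable (W \<Otimes>\<^sub>M M)"
      and g: "\<And>z p. z \<in> space W \<Longrightarrow> norm (g z p) \<le> c" for b :: "'b \<Rightarrow> complex" and g and c :: real
  proof (rule Bochner_Integration.integrable_bound)
    have [measurable]: "b \<in> borel_measurable M" using b by auto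
    show "integrable (W \<Otimes>\<^sub>M M) (\<lambda>(z, p). c * norm (b p))"
    proof (rule P.Fubini_integrable)
      show "AE z in W. integrable M (\<lambda>p. case (z, p) of (z, p) \<Rightarrow> c * norm (b p))"
        using b by auto
    qed (auto intro!: integrable_const)
    show "AE x in W \<Otimes>\<^sub>M M. norm (case x of (z, p) \<Rightarrow> b p * g z p) \<le> norm (case x of (z, p) \<Rightarrow> c * norm (b p))"
      by (auto simp: norm_mult space_pair_measure abs_mult mult.commute[of c] intro!: mult_left_mono
          order_trans[OF g] AE_I2)
    show "(\<lambda>(z, p). b p * g z p) \<in> borel_measurable (W \<Otimes>\<^sub>M M)" by measurable
  qed
  have "complex_of_real (\<integral>z. (norm (I z))\<^sup>2 \<partial>W) = (\<integral>z. I z * cnj (I z) \<partial>W)"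
    unfolding integral_complex_of_real[symmetric] complex_norm_square by simp
  also have "\<dots> = (\<integral>z. (\<integral>p. a p * (e z p * cnj (I z)) \<partial>M) \<partial>W)"
    unfolding integral_mult_left_zero[symmetric] I_def by (simp add: mult.assoc)
  also have "\<dots> = (\<integral>p. (\<integral>z. a p * (e z p * cnj (I z)) \<partial>W) \<partial>M)"
  proof (rule P.Fubini_integral[symmetric], rule fub[OF a])
    fix z p assume "z \<in> space W"
    then have "norm (e z p) * norm (I z) \<le> 1 * (\<integral>p. norm (a p) \<partial>M)"
      by (intro mult_mono e1 I1) auto
    then show "norm (e z p * cnj (I z)) \<le> (\<integral>p. norm (a p) \<partial>M)" by (simp add: norm_mult)
  qed measurable
  also have "\<dots> = (\<integral>p. a p * (\<integral>z. (\<integral>p'. cnj (a p') * (e z p * cnj (e z p')) \<partial>M) \<partial>W) \<partial>M)"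
  proof (rule Bochner_Integration.integral_cong[OF refl])
    fix p
    have "e z p * cnj (I z) = (\<integral>p'. cnj (a p') * (e z p * cnj (e z p')) \<partial>M)" for z
    proof -
      have "cnj (I z) = (\<integral>p'. cnj (a p') * cnj (e z p') \<partial>M)"
        unfolding I_def by (subst Bochner_Integration.integral_cnj[symmetric]) simp
      then have "e z p * cnj (I z) = (\<integral>p'. e z p * (cnj (a p') * cnj (e z p')) \<partial>M)"
        by (simp only: integral_mult_right_zero)
      then show ?thesis by (simp only: mult.left_commute)
    qed
    then show "(\<integral>z. a p * (e z p * cnj (I z)) \<partial>W) = a p * (\<integral>z. (\<integral>p'. cnj (a p') * (e z p * cnj (e z p')) \<partial>M) \<partial>W)"
      by simp
  qed
  also have "\<dots> = (\<integral>p. a p * (\<integral>p'. cnj (a p') * (\<integral>z. e z p * cnj (e z p') \<partial>W) \<partial>M) \<partial>M)"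
  proof (rule Bochner_Integration.integral_cong[OF refl])
    fix p assume p: "p \<in> space M"
    have "(\<integral>z. (\<integral>p'. cnj (a p') * (e z p * cnj (e z p')) \<partial>M) \<partial>W)
      = (\<integral>p'. (\<integral>z. cnj (a p') * (e z p * cnj (e z p')) \<partial>W) \<partial>M)"
    proof (rule P.Fubini_integral[symmetric], rule fub)
      show "integrable M (\<lambda>p'. cnj (a p'))" using a by simp
      show "norm (e z p * cnj (e z p')) \<le> 1" for z p'
        using mult_mono[OF e1[of z p] e1[of z p']] by (simp add: norm_mult)
      have "(\<lambda>x. e (fst x) p) \<in> borel_measurable (W \<Otimes>\<^sub>M M)"
        by (rule measurable_compose[OF measurable_fst e''[OF p]])
      then show "(\<lambda>(z, p'). e z p * cnj (e z p')) \<in> borel_measurable (W \<Otimes>\<^sub>M M)"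
        using e by (simp add: split_beta')
    qed
    then show "a p * (\<integral>z. (\<integral>p'. cnj (a p') * (e z p * cnj (e z p')) \<partial>M) \<partial>W)
      = a p * (\<integral>p'. cnj (a p') * (\<integral>z. e z p * cnj (e z p') \<partial>W) \<partial>M)" by simp
  qed
  finally show ?thesis unfolding I_def .
qed

text \<open>By \<open>|a(p) a(p')| \<le> (|a(p)|\<^sup>2 + |a(p')|\<^sup>2) / 2\<close> and the symmetry of the kernel, the quadratic form of
  the previous lemma is at most the largest row mass of the kernel times \<open>\<parallel>a\<parallel>\<^sup>2\<close>. This single inequality
  gives both Bessel's inequality (almost orthogonal plane waves) and the \<open>L\<^sup>4\<close> estimate (products
  of two plane waves).\<close>

lemma TTstar_Schur_bound:
  fixes a :: "'b \<Rightarrow> complex" and e :: "'a \<Rightarrow> 'b \<Rightarrow> complex"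
  assumes M: "sigma_finite_measure M" and W: "finite_measure W"
    and e[measurable]: "(\<lambda>(z, p). e z p) \<in> borel_measurable (W \<Otimes>\<^sub>M M)"
    and e1: "\<And>z p. norm (e z p) \<le> 1"
    and a: "integrable M a"
    and B: "\<And>p. p \<in> space M \<Longrightarrow> (\<integral>\<^sup>+p'. ennreal (norm (\<integral>z. e z p * cnj (e z p') \<partial>W)) \<partial>M) \<le> B"
  shows "L2sq W (\<lambda>z. \<integral>p. a p * e z p \<partial>M) \<le> B * L2sq M a"
proof -
  interpret M: sigma_finite_measure M by fact
  interpret W: finite_measure W by fact
  interpret MM: pair_sigma_finite M M ..
  interpret P: pair_sigma_finite M W ..
  have [measurable]: "a \<in> borel_measurable M" using a by auto
  have e': "e z \<in> borel_measurable M" if "z \<in> space W" for z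
    using measurable_Pair2[OF e that] by simp
  define k where "k p p' = ennreal (norm (\<integral>z. e z p * cnj (e z p') \<partial>W))" for p p'
  have es: "(\<lambda>x. e (snd x) (fst x)) \<in> borel_measurable (M \<Otimes>\<^sub>M W)"
    using measurable_compose[OF measurable_pair_swap' e] by (simp add: split_beta')
  have km: "(\<lambda>(p, p'). k p p') \<in> borel_measurable (M \<Otimes>\<^sub>M M)"
  proof -
    have "(\<lambda>((p, p'), z). e z p * cnj (e z p')) \<in> borel_measurable ((M \<Otimes>\<^sub>M M) \<Otimes>\<^sub>M W)"
    proof -
      have 1: "(\<lambda>x. e (snd x) (fst (fst x))) \<in> borel_measurable ((M \<Otimes>\<^sub>M M) \<Otimes>\<^sub>M W)"
        using measurable_compose[of "\<lambda>x. (fst (fst x), snd x)", OF _ es] by simp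
      have 2: "(\<lambda>x. e (snd x) (snd (fst x))) \<in> borel_measurable ((M \<Otimes>\<^sub>M M) \<Otimes>\<^sub>M W)"
        using measurable_compose[of "\<lambda>x. (snd (fst x), snd x)", OF _ es] by simp
      from 1 2 show ?thesis by (simp add: split_beta')
    qed
    then have "(\<lambda>q. \<integral>z. e z (fst q) * cnj (e z (snd q)) \<partial>W) \<in> borel_measurable (M \<Otimes>\<^sub>M M)"
      by (intro W.borel_measurable_lebesgue_integral) (simp add: split_beta')
    then show ?thesis unfolding k_def by (simp add: split_beta')
  qed
  have kp: "k p \<in> borel_measurable M" if "p \<in> space M" for p
    using measurable_Pair2[OF km that] by simp
  have ksym: "k p p' = k p' p" for p p'
  proof -
    have "(\<integral>z. e z p' * cnj (e z p) \<partial>W) = cnj (\<integral>z. e z p * cnj (e z p') \<partial>W)"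
      by (subst Bochner_Integration.integral_cnj[symmetric]) (simp only: complex_cnj_mult complex_cnj_cnj mult.commute)
    then show ?thesis by (simp add: k_def)
  qed
  define I where "I z = (\<integral>p. a p * e z p \<partial>M)" for z
  have [measurable]: "I \<in> borel_measurable W"
    unfolding I_def by (intro M.borel_measurable_lebesgue_integral) measurable
  have I1: "norm (I z) \<le> (\<integral>p. norm (a p) \<partial>M)" for z
    unfolding I_def by (rule norm_integral_mult_le[OF a e1])
  have "integrable W (\<lambda>z. (norm (I z))\<^sup>2)"
    using I1 by (intro W.integrable_const_bound[where B="(\<integral>p. norm (a p) \<partial>M)\<^sup>2"] AE_I2)
      (auto intro!: power_mono)
  then have "L2sq W I = ennreal (\<integral>z. (norm (I z))\<^sup>2 \<partial>W)" by (rule L2sq_eq_integral)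
  also have "\<dots> = ennreal (norm (complex_of_real (\<integral>z. (norm (I z))\<^sup>2 \<partial>W)))"
    by (simp add: abs_of_nonneg)
  also have "\<dots> = ennreal (norm (\<integral>p. a p * (\<integral>p'. cnj (a p') * (\<integral>z. e z p * cnj (e z p') \<partial>W) \<partial>M) \<partial>M))"
    unfolding I_def using TTstar_identity[OF M W e e1 a] by simp
  also have "\<dots> \<le> (\<integral>\<^sup>+p. ennreal (norm (a p * (\<integral>p'. cnj (a p') * (\<integral>z. e z p * cnj (e z p') \<partial>W) \<partial>M))) \<partial>M)"
    by (rule ennreal_norm_integral_le)
  also have "\<dots> \<le> (\<integral>\<^sup>+p. (\<integral>\<^sup>+p'. ennreal (norm (a p)) * (ennreal (norm (a p')) * k p p') \<partial>M) \<partial>M)"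
  proof (intro nn_integral_mono)
    fix p assume p: "p \<in> space M"
    have "ennreal (norm (\<integral>p'. cnj (a p') * (\<integral>z. e z p * cnj (e z p') \<partial>W) \<partial>M))
       \<le> (\<integral>\<^sup>+p'. ennreal (norm (a p')) * k p p' \<partial>M)"
      using ennreal_norm_integral_le[of M "\<lambda>p'. cnj (a p') * (\<integral>z. e z p * cnj (e z p') \<partial>W)"]
      by (simp add: norm_mult ennreal_mult k_def)
    then show "ennreal (norm (a p * (\<integral>p'. cnj (a p') * (\<integral>z. e z p * cnj (e z p') \<partial>W) \<partial>M)))
      \<le> (\<integral>\<^sup>+p'. ennreal (norm (a p)) * (ennreal (norm (a p')) * k p p') \<partial>M)"
      using kp[OF p] by (subst nn_integral_cmult) (auto simp: norm_mult ennreal_mult intro!: mult_left_mono)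
  qed
  also have "\<dots> \<le> (\<integral>\<^sup>+p. (\<integral>\<^sup>+p'. ennreal (1/2) * (ennreal ((norm (a p))\<^sup>2) * k p p' + ennreal ((norm (a p'))\<^sup>2) * k p p') \<partial>M) \<partial>M)"
  proof (intro nn_integral_mono)
    fix p p'
    have "norm (a p) * norm (a p') \<le> 1/2 * ((norm (a p))\<^sup>2 + (norm (a p'))\<^sup>2)"
      using sum_squares_bound[of "norm (a p)" "norm (a p')"] by simp
    then have "ennreal (norm (a p) * norm (a p')) * k p p' \<le> ennreal (1/2 * ((norm (a p))\<^sup>2 + (norm (a p'))\<^sup>2)) * k p p'"
      by (intro mult_right_mono ennreal_leI) auto
    moreover have "ennreal (1/2 * ((norm (a p))\<^sup>2 + (norm (a p'))\<^sup>2)) = ennreal (1/2) * (ennreal ((norm (a p))\<^sup>2) + ennreal ((norm (a p'))\<^sup>2))"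
      by (simp only: ennreal_mult ennreal_plus zero_le_power2 add_nonneg_nonneg)
    ultimately
    show "ennreal (norm (a p)) * (ennreal (norm (a p')) * k p p') \<le>
       ennreal (1/2) * (ennreal ((norm (a p))\<^sup>2) * k p p' + ennreal ((norm (a p'))\<^sup>2) * k p p')"
      by (simp add: ennreal_mult distrib_right mult.assoc)
  qed
  also have "\<dots> = ennreal (1/2) * ((\<integral>\<^sup>+p. (\<integral>\<^sup>+p'. ennreal ((norm (a p))\<^sup>2) * k p p' \<partial>M) \<partial>M)
      + (\<integral>\<^sup>+p. (\<integral>\<^sup>+p'. ennreal ((norm (a p'))\<^sup>2) * k p p' \<partial>M) \<partial>M))"
  proof -
    have "(\<integral>\<^sup>+p'. ennreal (1/2) * (ennreal ((norm (a p))\<^sup>2) * k p p' + ennreal ((norm (a p'))\<^sup>2) * k p p') \<partial>M)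
      = ennreal (1/2) * ((\<integral>\<^sup>+p'. ennreal ((norm (a p))\<^sup>2) * k p p' \<partial>M) + (\<integral>\<^sup>+p'. ennreal ((norm (a p'))\<^sup>2) * k p p' \<partial>M))"
      if p: "p \<in> space M" for p
    proof -
      note [measurable] = kp[OF p]
      show ?thesis by (subst nn_integral_cmult, measurable) (subst nn_integral_add; simp)
    qed
    then have "(\<integral>\<^sup>+p. (\<integral>\<^sup>+p'. ennreal (1/2) * (ennreal ((norm (a p))\<^sup>2) * k p p' + ennreal ((norm (a p'))\<^sup>2) * k p p') \<partial>M) \<partial>M)
      = (\<integral>\<^sup>+p. ennreal (1/2) * ((\<integral>\<^sup>+p'. ennreal ((norm (a p))\<^sup>2) * k p p' \<partial>M) + (\<integral>\<^sup>+p'. ennreal ((norm (a p'))\<^sup>2) * k p p' \<partial>M)) \<partial>M)"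
      by (rule nn_integral_cong)
    also have "\<dots> = ennreal (1/2) * ((\<integral>\<^sup>+p. (\<integral>\<^sup>+p'. ennreal ((norm (a p))\<^sup>2) * k p p' \<partial>M) \<partial>M)
      + (\<integral>\<^sup>+p. (\<integral>\<^sup>+p'. ennreal ((norm (a p'))\<^sup>2) * k p p' \<partial>M) \<partial>M))"
    proof -
      have "(\<lambda>p. \<integral>\<^sup>+p'. ennreal ((norm (a p))\<^sup>2) * k p p' \<partial>M) \<in> borel_measurable M"
        using km by (intro M.borel_measurable_nn_integral) (simp add: split_beta')
      moreover have "(\<lambda>p. \<integral>\<^sup>+p'. ennreal ((norm (a p'))\<^sup>2) * k p p' \<partial>M) \<in> borel_measurable M"
        using km by (intro M.borel_measurable_nn_integral) (simp add: split_beta')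
      ultimately show ?thesis by (simp add: nn_integral_cmult nn_integral_add)
    qed
    finally show ?thesis .
  qed
  also have "(\<integral>\<^sup>+p. (\<integral>\<^sup>+p'. ennreal ((norm (a p'))\<^sup>2) * k p p' \<partial>M) \<partial>M)
      = (\<integral>\<^sup>+p. (\<integral>\<^sup>+p'. ennreal ((norm (a p))\<^sup>2) * k p p' \<partial>M) \<partial>M)"
  proof -
    have "(\<integral>\<^sup>+p. (\<integral>\<^sup>+p'. ennreal ((norm (a p'))\<^sup>2) * k p p' \<partial>M) \<partial>M)
      = (\<integral>\<^sup>+p'. (\<integral>\<^sup>+p. ennreal ((norm (a p'))\<^sup>2) * k p p' \<partial>M) \<partial>M)"
      using km by (intro MM.Fubini'[symmetric]) (simp add: split_beta')
    also have "\<dots> = (\<integral>\<^sup>+p'. (\<integral>\<^sup>+p. ennreal ((norm (a p'))\<^sup>2) * k p' p \<partial>M) \<partial>M)"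
      by (intro nn_integral_cong arg_cong2[where f="(*)"] refl ksym)
    finally show ?thesis .
  qed
  also have "ennreal (1/2) * ((\<integral>\<^sup>+p. (\<integral>\<^sup>+p'. ennreal ((norm (a p))\<^sup>2) * k p p' \<partial>M) \<partial>M)
      + (\<integral>\<^sup>+p. (\<integral>\<^sup>+p'. ennreal ((norm (a p))\<^sup>2) * k p p' \<partial>M) \<partial>M))
      = (\<integral>\<^sup>+p. (\<integral>\<^sup>+p'. ennreal ((norm (a p))\<^sup>2) * k p p' \<partial>M) \<partial>M)"
    (is "_ * (?x + ?x) = ?x")
  proof -
    let ?h = "ennreal (1/2)"
    have "?h * (?x + ?x) = (?h + ?h) * ?x"
      by (simp only: distrib_left distrib_right)
    also have "ennreal (1/2) + ennreal (1/2) = ennreal (1/2 + 1/2)"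
      by (rule ennreal_plus[symmetric]) auto
    finally show ?thesis by simp
  qed
  also have "(\<integral>\<^sup>+p. (\<integral>\<^sup>+p'. ennreal ((norm (a p))\<^sup>2) * k p p' \<partial>M) \<partial>M)
     \<le> (\<integral>\<^sup>+p. ennreal ((norm (a p))\<^sup>2) * B \<partial>M)"
  proof (intro nn_integral_mono)
    fix p assume p: "p \<in> space M"
    have "(\<integral>\<^sup>+p'. ennreal ((norm (a p))\<^sup>2) * k p p' \<partial>M) = ennreal ((norm (a p))\<^sup>2) * (\<integral>\<^sup>+p'. k p p' \<partial>M)"
      by (rule nn_integral_cmult[OF kp[OF p]])
    also have "\<dots> \<le> ennreal ((norm (a p))\<^sup>2) * B"
      unfolding k_def by (rule mult_left_mono[OF B[OF p]]) simp
    finally show "(\<integral>\<^sup>+p'. ennreal ((norm (a p))\<^sup>2) * k p p' \<partial>M) \<le> ennreal ((norm (a p))\<^sup>2) * B" .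
  qed
  also have "\<dots> = B * L2sq M a"
    unfolding L2sq_def by (subst nn_integral_multc) (simp_all add: mult.commute)
  finally show ?thesis unfolding I_def .
qed

section \<open>Gaussian weights and plane waves\<close>

lemma cis_measurable [measurable]: "cis \<in> borel_measurable borel"
  by (intro borel_measurable_continuous_onI continuous_intros)

lemma integrable_pair_mult:
  fixes f :: "'a \<Rightarrow> complex" and g :: "'b \<Rightarrow> complex"
  assumes A: "sigma_finite_measure A" and B: "sigma_finite_measure B"
    and f: "integrable A f" and g: "integrable B g"
  shows "integrable (A \<Otimes>\<^sub>M B) (\<lambda>z. f (fst z) * g (snd z))"
    and "(\<integral>z. f (fst z) * g (snd z) \<partial>(A \<Otimes>\<^sub>M B)) = (\<integral>x. f x \<partial>A) * (\<integral>y. g y \<partial>B)"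
proof -
  interpret A: sigma_finite_measure A by fact
  interpret B: sigma_finite_measure B by fact
  interpret P: pair_sigma_finite A B ..
  have [measurable]: "f \<in> borel_measurable A" by (rule borel_measurable_integrable[OF f])
  have [measurable]: "g \<in> borel_measurable B" by (rule borel_measurable_integrable[OF g])
  show i: "integrable (A \<Otimes>\<^sub>M B) (\<lambda>z. f (fst z) * g (snd z))"
  proof (rule P.Fubini_integrable)
    show "integrable A (\<lambda>x. \<integral>y. norm (f (fst (x, y)) * g (snd (x, y))) \<partial>B)"
      using f by (simp add: norm_mult)
    show "AE x in A. integrable B (\<lambda>y. f (fst (x, y)) * g (snd (x, y)))"
      using g by simp
  qed measurable
  show "(\<integral>z. f (fst z) * g (snd z) \<partial>(A \<Otimes>\<^sub>M B)) = (\<integral>x. f x \<partial>A) * (\<integral>y. g y \<partial>B)"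
    using P.integral_fst'[OF i] by simp
qed

lemma integral_pair_mult:
  fixes f :: "'a \<Rightarrow> complex" and g :: "'b \<Rightarrow> complex"
  assumes A: "finite_measure A" and B: "finite_measure B"
    and f: "f \<in> borel_measurable A" "\<And>x. norm (f x) \<le> 1"
    and g: "g \<in> borel_measurable B" "\<And>x. norm (g x) \<le> 1"
  shows "(\<integral>z. f (fst z) * g (snd z) \<partial>(A \<Otimes>\<^sub>M B)) = (\<integral>x. f x \<partial>A) * (\<integral>y. g y \<partial>B)"
  using f g
  by (intro integrable_pair_mult(2) finite_measure.axioms(1)[OF A] finite_measure.axioms(1)[OF B]
      finite_measure.integrable_const_bound[OF A, where B=1] finite_measure.integrable_const_bound[OF B, where B=1]) auto

lemma torus_finite: "finite_measure torus"
  unfolding torus_def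
  by (rule finite_measureI) (simp add: emeasure_restrict_space space_restrict_space)

lemma space_torus [simp]: "space torus = {0..<2 * pi}"
  by (simp add: torus_def space_restrict_space)

lemma torus_le_borel: "f \<in> borel_measurable borel \<Longrightarrow> f \<in> borel_measurable torus"
  unfolding torus_def by (rule measurable_restrict_space1) simp

lemma integral_torus_cis:
  "(\<integral>y. cis (y * of_int k) \<partial>torus) = (if k = 0 then 2 * pi else 0)"
proof -
  have "(\<integral>y. cis (y * of_int k) \<partial>torus) = (\<integral>y. indicator {0..<2 * pi} y *\<^sub>R cis (y * of_int k) \<partial>lborel)"
    unfolding torus_def by (rule integral_restrict_space) simp
  also have "\<dots> = (\<integral>y. indicator {0..2 * pi} y *\<^sub>R cis (y * of_int k) \<partial>lborel)"
  proof (rule integral_cong_AE)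
    have "AE y in lborel. y \<noteq> 2 * pi" by (rule AE_lborel_singleton)
    then show "AE y in lborel. indicator {0..<2 * pi} y *\<^sub>R cis (y * of_int k) = (indicator {0..2 * pi} y *\<^sub>R cis (y * of_int k) :: complex)"
      by eventually_elim (auto simp: indicator_def)
  qed measurable
  also have "\<dots> = (if k = 0 then 2 * pi else 0)"
  proof (cases "k = 0")
    case True then show ?thesis by (simp add: scaleR_conv_of_real)
  next
    case False
    have "(\<integral>y. indicator {0..2 * pi} y *\<^sub>R cis (y * of_int k) \<partial>lborel)
      = cis (2 * pi * of_int k) / (\<i> * of_int k) - cis (0 * of_int k) / (\<i> * of_int k)"
    proof (rule integral_FTC_Icc)
      fix x
      show "((\<lambda>y. cis (y * of_int k) / (\<i> * of_int k)) has_vector_derivative cis (x * of_int k)) (at x within {0..2 * pi})"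
        unfolding cis_conv_exp
        by (rule has_vector_derivative_real_field derivative_eq_intros refl | use False in \<open>simp add: field_simps\<close>)+
    qed (auto intro!: continuous_intros)
    also have "cis (2 * pi * of_int k) = 1"
      using cis_multiple_2pi[of "of_int k"] by (simp add: mult_ac)
    finally show ?thesis using False by simp
  qed
  finally show ?thesis .
qed

text \<open>Lebesgue measure damped at scale \<open>R\<close>. It makes plane waves integrable on the line, has a positive,
  explicit, rapidly decaying Fourier transform, and increases to Lebesgue measure as \<open>R\<close> grows.\<close>

definition gauss :: "real \<Rightarrow> real measure" where
  "gauss R = density lborel (\<lambda>x. ennreal (exp (- (x / R)\<^sup>2 / 2)))"

lemma sets_gauss [measurable_cong, simp]: "sets (gauss R) = sets borel"
  by (simp add: gauss_def)

lemma space_gauss [simp]: "space (gauss R) = UNIV"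
  by (simp add: gauss_def)

lemma nn_integral_gaussian:
  assumes "c > 0"
  shows "(\<integral>\<^sup>+x. ennreal (exp (- (c * (x - m))\<^sup>2 / 2)) \<partial>lborel) = ennreal (sqrt (2 * pi) / c)"
proof -
  have "(\<integral>\<^sup>+x. ennreal (normal_density m (1 / c) x) \<partial>lborel) = 1"
    using prob_space.emeasure_space_1[OF prob_space_normal_density[of "1/c" m]] assms
    by (simp add: emeasure_density)
  moreover have "ennreal (exp (- (c * (x - m))\<^sup>2 / 2)) = ennreal (sqrt (2 * pi) / c) * ennreal (normal_density m (1 / c) x)" for x
  proof -
    have "exp (- (c * (x - m))\<^sup>2 / 2) = exp (- (x - m)\<^sup>2 / (2 * (1 / c)\<^sup>2))"
      using assms by (simp add: power_mult_distrib power_divide)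
    also have "\<dots> = sqrt (2 * pi) / c * normal_density m (1 / c) x"
      using assms unfolding normal_density_def
      by (simp add: real_sqrt_divide real_sqrt_mult)
    finally show ?thesis using assms by (simp add: ennreal_mult[symmetric])
  qed
  ultimately show ?thesis by (simp add: nn_integral_cmult)
qed

lemma integrable_gaussian:
  assumes "c > 0"
  shows "integrable lborel (\<lambda>x. exp (- (c * (x - m))\<^sup>2 / 2) :: real)"
  using nn_integral_gaussian[OF assms, of m] by (intro integrableI_nonneg) auto

lemma gauss_finite: "R > 0 \<Longrightarrow> finite_measure (gauss R)"
  using nn_integral_gaussian[of "1/R" 0]
  by (intro finite_measureI) (simp add: gauss_def emeasure_density)

lemma integral_gauss_cis:
  assumes "R > 0"
  shows "(\<integral>x. cis (x * s) \<partial>gauss R) = complex_of_real (R * sqrt (2 * pi) * exp (- (R * s)\<^sup>2 / 2))"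
proof -
  have "(\<integral>x. cis (x * s) \<partial>gauss R) = (\<integral>x. exp (- (x / R)\<^sup>2 / 2) *\<^sub>R cis (x * s) \<partial>lborel)"
    unfolding gauss_def by (rule integral_density) auto
  also have "\<dots> = R *\<^sub>R (\<integral>x. exp (- ((0 + R * x) / R)\<^sup>2 / 2) *\<^sub>R cis ((0 + R * x) * s) \<partial>lborel)"
    using assms by (subst lborel_integral_real_affine[where c=R and t=0]) auto
  also have "(\<integral>x. exp (- ((0 + R * x) / R)\<^sup>2 / 2) *\<^sub>R cis ((0 + R * x) * s) \<partial>lborel)
     = (\<integral>x. sqrt (2 * pi) *\<^sub>R (std_normal_density x *\<^sub>R iexp ((R * s) * x)) \<partial>lborel)"
    using assms by (intro Bochner_Integration.integral_cong refl)
      (simp add: std_normal_density_def cis_conv_exp mult_ac)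
  also have "\<dots> = sqrt (2 * pi) *\<^sub>R (\<integral>x. std_normal_density x *\<^sub>R iexp ((R * s) * x) \<partial>lborel)"
    by (rule Bochner_Integration.integral_scaleR_right) 
  also have "\<dots> = sqrt (2 * pi) *\<^sub>R char std_normal_distribution (R * s)"
    unfolding char_def by (subst integral_density) (auto simp del: of_real_mult)
  finally show ?thesis
    by (simp add: char_std_normal_distribution scaleR_conv_of_real mult_ac)
qed

text \<open>Estimates that are uniform in the damping scale pass to the undamped measure by monotone
  convergence.\<close>

lemma gauss_exhaustion:
  assumes T: "sigma_finite_measure T" and [measurable]: "g \<in> borel_measurable (lborel \<Otimes>\<^sub>M T)"
  shows "incseq (\<lambda>n. \<integral>\<^sup>+z. g z \<partial>(gauss (real (Suc n)) \<Otimes>\<^sub>M T))"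
    and "(\<integral>\<^sup>+z. g z \<partial>(lborel \<Otimes>\<^sub>M T)) = (SUP n. \<integral>\<^sup>+z. g z \<partial>(gauss (real (Suc n)) \<Otimes>\<^sub>M T))"
proof -
  interpret T: sigma_finite_measure T by fact
  define w where "w n x = ennreal (exp (- (x / real (Suc n))\<^sup>2 / 2))" for n :: nat and x :: real
  have [measurable]: "w n \<in> borel_measurable borel" for n unfolding w_def by measurable
  have eq: "(\<integral>\<^sup>+z. g z \<partial>(gauss (real (Suc n)) \<Otimes>\<^sub>M T)) = (\<integral>\<^sup>+z. w n (fst z) * g z \<partial>(lborel \<Otimes>\<^sub>M T))" for n
  proof -
    have s: "sets (gauss (real (Suc n)) \<Otimes>\<^sub>M T) = sets (lborel \<Otimes>\<^sub>M T)"
      by (intro sets_pair_measure_cong) auto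
    have "(\<integral>\<^sup>+z. g z \<partial>(gauss (real (Suc n)) \<Otimes>\<^sub>M T)) = (\<integral>\<^sup>+x. \<integral>\<^sup>+y. g (x, y) \<partial>T \<partial>gauss (real (Suc n)))"
      by (rule T.nn_integral_fst[symmetric]) (simp add: measurable_cong_sets[OF s refl])
    also have "\<dots> = (\<integral>\<^sup>+x. w n x * (\<integral>\<^sup>+y. g (x, y) \<partial>T) \<partial>lborel)"
      unfolding gauss_def w_def by (rule nn_integral_density) (simp, rule T.borel_measurable_nn_integral_fst, simp)
    also have "\<dots> = (\<integral>\<^sup>+x. (\<integral>\<^sup>+y. w n x * g (x, y) \<partial>T) \<partial>lborel)"
      by (intro nn_integral_cong nn_integral_cmult[symmetric]) simp
    also have "\<dots> = (\<integral>\<^sup>+z. w n (fst z) * g z \<partial>(lborel \<Otimes>\<^sub>M T))"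
      using T.nn_integral_fst[of "\<lambda>z. w n (fst z) * g z" lborel] by simp
    finally show ?thesis .
  qed
  have mono: "w m x \<le> w n x" if "m \<le> n" for m n x
    unfolding w_def using that
    by (intro ennreal_leI) (auto simp: power_divide intro!: divide_left_mono power_mono)
  then have inc: "incseq (\<lambda>n z. w n (fst z) * g z)"
    by (auto simp: incseq_def le_fun_def intro!: mult_right_mono)
  show "incseq (\<lambda>n. \<integral>\<^sup>+z. g z \<partial>(gauss (real (Suc n)) \<Otimes>\<^sub>M T))"
    unfolding eq using mono by (auto simp: incseq_def intro!: nn_integral_mono mult_right_mono)
  have sup: "(SUP n. w n x) = 1" for x
  proof (rule LIMSEQ_unique[OF LIMSEQ_SUP])
    show "incseq (\<lambda>n. w n x)" using mono by (auto simp: incseq_def)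
    have "(\<lambda>n. exp (- (x / real (Suc n))\<^sup>2 / 2)) \<longlonglongrightarrow> exp (- 0\<^sup>2 / 2)"
      by (intro tendsto_intros LIMSEQ_Suc[OF lim_const_over_n]) simp
    then show "(\<lambda>n. w n x) \<longlonglongrightarrow> 1"
      unfolding w_def by (simp add: tendsto_ennrealI flip: ennreal_1)
  qed
  show "(\<integral>\<^sup>+z. g z \<partial>(lborel \<Otimes>\<^sub>M T)) = (SUP n. \<integral>\<^sup>+z. g z \<partial>(gauss (real (Suc n)) \<Otimes>\<^sub>M T))"
    unfolding eq
    by (subst nn_integral_monotone_convergence_SUP[OF inc, symmetric])
       (simp_all add: SUP_mult_right_ennreal[symmetric] sup)
qed

definition plane_wave :: "real \<times> real \<times> real \<Rightarrow> real \<times> int \<times> int \<Rightarrow> complex" where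
  "plane_wave = (\<lambda>(x, y1, y2) (\<xi>, k1, k2). cis (x * \<xi> + (y1 * of_int k1 + y2 * of_int k2)))"

lemma norm_plane_wave [simp]: "norm (plane_wave z \<zeta>) = 1"
  by (auto simp: plane_wave_def split: prod.splits)

definition gauss_phys :: "real \<Rightarrow> (real \<times> real \<times> real) measure" where
  "gauss_phys R = gauss R \<Otimes>\<^sub>M (torus \<Otimes>\<^sub>M torus)"

lemma torus2_finite: "finite_measure (torus \<Otimes>\<^sub>M torus)"
  by (intro finite_measure_pair_measure torus_finite)

lemma gauss_phys_finite: "R > 0 \<Longrightarrow> finite_measure (gauss_phys R)"
  unfolding gauss_phys_def by (intro finite_measure_pair_measure gauss_finite torus2_finite)

lemma sigma_finite_torus2: "sigma_finite_measure (torus \<Otimes>\<^sub>M torus)"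
  using torus2_finite by (rule finite_measure.axioms(1)) 

lemma sigma_finite_phys: "sigma_finite_measure phys"
proof -
  interpret pair_sigma_finite lborel "torus \<Otimes>\<^sub>M torus"
    by (intro pair_sigma_finite.intro sigma_finite_lborel sigma_finite_torus2)
  show ?thesis unfolding phys_def ..
qed

lemma freq_eq: "freq = lborel \<Otimes>\<^sub>M count_space UNIV"
  unfolding freq_def by (subst pair_measure_countable) auto

lemma sigma_finite_lattice: "sigma_finite_measure (count_space (UNIV :: (int \<times> int) set))"
  by (rule sigma_finite_measure_count_space_countable) auto

lemma sigma_finite_freq: "sigma_finite_measure freq"
proof -
  interpret pair_sigma_finite lborel "count_space (UNIV :: (int \<times> int) set)"
    by (intro pair_sigma_finite.intro sigma_finite_lborel sigma_finite_lattice)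
  show ?thesis unfolding freq_eq ..
qed

lemma sets_gauss_phys [measurable_cong]: "sets (gauss_phys R) = sets phys"
  unfolding gauss_phys_def phys_def by (intro sets_pair_measure_cong) auto

lemma space_phys: "space phys = UNIV \<times> {0..<2*pi} \<times> {0..<2*pi}"
  by (simp add: phys_def space_pair_measure)

lemma phys_projections [measurable]:
  "fst \<in> borel_measurable phys"
  "(\<lambda>z. fst (snd z)) \<in> borel_measurable phys"
  "(\<lambda>z. snd (snd z)) \<in> borel_measurable phys"
proof -
  have t: "(\<lambda>x. x) \<in> borel_measurable torus" by (rule torus_le_borel) simp
  have "(\<lambda>z. fst (snd z)) \<in> measurable phys torus" "(\<lambda>z. snd (snd z)) \<in> measurable phys torus"
    unfolding phys_def by measurable
  from measurable_compose[OF this(1) t] measurable_compose[OF this(2) t]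
  show "(\<lambda>z. fst (snd z)) \<in> borel_measurable phys" "(\<lambda>z. snd (snd z)) \<in> borel_measurable phys" by auto
  show "fst \<in> borel_measurable phys" unfolding phys_def by measurable
qed

lemma freq_projections [measurable]:
  "fst \<in> borel_measurable freq"
  "(\<lambda>z. fst (snd z)) \<in> measurable freq (count_space UNIV)"
  "(\<lambda>z. snd (snd z)) \<in> measurable freq (count_space UNIV)"
  unfolding freq_def by measurable

lemma space_freq [simp]: "space freq = UNIV"
  by (simp add: freq_eq space_pair_measure)

lemma snd_measurable_freq [measurable]: "snd \<in> measurable freq (count_space UNIV)"
  unfolding freq_eq by measurable

lemma plane_wave_measurable [measurable (raw)]:
  assumes "f \<in> measurable M phys" "g \<in> measurable M freq"
  shows "(\<lambda>x. plane_wave (f x) (g x)) \<in> borel_measurable M"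
proof -
  have "(\<lambda>w. plane_wave (fst w) (snd w)) \<in> borel_measurable (phys \<Otimes>\<^sub>M freq)"
    unfolding plane_wave_def split_beta' by measurable
  from measurable_compose[OF measurable_Pair[OF assms] this] show ?thesis by simp
qed

lemma gauss_phys_character:
  assumes "R > 0"
  shows "(\<integral>(x, y1, y2). cis (x * s + (y1 * of_int m + y2 * of_int n)) \<partial>gauss_phys R)
    = complex_of_real (R * sqrt (2 * pi) * exp (- (R * s)\<^sup>2 / 2) *
        ((if m = 0 then 2 * pi else 0) * (if n = 0 then 2 * pi else 0)))"
proof -
  have [measurable]: "(\<lambda>y. cis (y * of_int m)) \<in> borel_measurable torus" for m
    by (rule torus_le_borel) measurable
  have "(\<integral>(x, y1, y2). cis (x * s + (y1 * of_int m + y2 * of_int n)) \<partial>gauss_phys R)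
     = (\<integral>z. cis (fst z * s) * (cis (fst (snd z) * of_int m) * cis (snd (snd z) * of_int n)) \<partial>gauss_phys R)"
    by (simp add: split_beta' cis_mult)
  also have "\<dots> = (\<integral>x. cis (x * s) \<partial>gauss R) *
      (\<integral>y. cis (fst y * of_int m) * cis (snd y * of_int n) \<partial>(torus \<Otimes>\<^sub>M torus))"
    unfolding gauss_phys_def using assms
    by (intro integral_pair_mult gauss_finite torus2_finite) (simp_all add: norm_mult)
  also have "(\<integral>y. cis (fst y * of_int m) * cis (snd y * of_int n) \<partial>(torus \<Otimes>\<^sub>M torus))
     = (\<integral>y. cis (y * of_int m) \<partial>torus) * (\<integral>y. cis (y * of_int n) \<partial>torus)"
    by (intro integral_pair_mult torus_finite) simp_all
  finally show ?thesis
    by (simp add: integral_gauss_cis[OF assms] integral_torus_cis)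
qed

text \<open>Distinct lattice frequencies are orthogonal on the torus, and on the line the damping makes
  frequencies farther apart than \<open>1/R\<close> almost orthogonal.\<close>

lemma gauss_phys_plane_wave_kernel:
  assumes "R > 0"
  shows "(\<integral>z. plane_wave z \<zeta> * cnj (plane_wave z \<zeta>') \<partial>gauss_phys R)
    = complex_of_real (R * sqrt (2 * pi) * exp (- (R * (fst \<zeta> - fst \<zeta>'))\<^sup>2 / 2) *
        (if snd \<zeta> = snd \<zeta>' then (2 * pi)\<^sup>2 else 0))"
proof -
  obtain \<xi> k1 k2 \<xi>' k1' k2' where *: "\<zeta> = (\<xi>, k1, k2)" "\<zeta>' = (\<xi>', k1', k2')"
    by (metis prod_cases3)
  have "(\<integral>z. plane_wave z \<zeta> * cnj (plane_wave z \<zeta>') \<partial>gauss_phys R)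
    = (\<integral>(x, y1, y2). cis (x * (\<xi> - \<xi>') + (y1 * of_int (k1 - k1') + y2 * of_int (k2 - k2'))) \<partial>gauss_phys R)"
    unfolding * plane_wave_def
    by (intro Bochner_Integration.integral_cong refl) (auto simp: cis_cnj cis_mult algebra_simps)
  then show ?thesis
    unfolding gauss_phys_character[OF assms] by (auto simp: * power2_eq_square)
qed

section \<open>Bessel inequalities\<close>

definition fourier_const :: real where "fourier_const = (2 * pi) powr (- 3 / 2)"

lemma fourier_const_pos: "fourier_const > 0"
  by (simp add: fourier_const_def)

lemma fourier_const_square: "fourier_const\<^sup>2 = 1 / (2 * pi)^3"
proof -
  have "fourier_const\<^sup>2 = (2 * pi) powr (- 3)"
    unfolding fourier_const_def power2_eq_square by (subst powr_add[symmetric]) simp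
  also have "\<dots> = 1 / (2 * pi) powr (real 3)" by (simp only: powr_minus_divide of_nat_numeral)
  also have "\<dots> = 1 / (2 * pi) ^ 3" by (subst powr_realpow) auto
  finally show ?thesis .
qed

text \<open>The Fourier inversion integral. It is used only for integrable \<open>G\<close>, where it converges
  absolutely at every point.\<close>

definition fourier_inverse ::
    "(real \<times> int \<times> int \<Rightarrow> complex) \<Rightarrow> real \<times> real \<times> real \<Rightarrow> complex" where
  "fourier_inverse G z = complex_of_real fourier_const * (\<integral>\<zeta>. G \<zeta> * plane_wave z \<zeta> \<partial>freq)"

lemma fourier_integral_eq:
  "fourier_integral f \<zeta> = complex_of_real fourier_const * (\<integral>z. f z * cnj (plane_wave z \<zeta>) \<partial>phys)"
  unfolding fourier_integral_def fourier_const_def plane_wave_def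
  by (auto simp: split_beta' cis_cnj intro!: Bochner_Integration.integral_cong)

lemma fourier_inverse_measurable [measurable]:
  assumes [measurable]: "G \<in> borel_measurable freq"
  shows "fourier_inverse G \<in> borel_measurable phys"
proof -
  interpret F: sigma_finite_measure freq by (rule sigma_finite_freq)
  show ?thesis unfolding fourier_inverse_def by measurable
qed

lemma fourier_integral_measurable [measurable]:
  assumes [measurable]: "f \<in> borel_measurable phys"
  shows "fourier_integral f \<in> borel_measurable freq"
proof -
  interpret P: sigma_finite_measure phys by (rule sigma_finite_phys)
  have "(\<lambda>\<zeta>. complex_of_real fourier_const * (\<integral>z. f z * cnj (plane_wave z \<zeta>) \<partial>phys)) \<in> borel_measurable freq"
    by measurable
  then show ?thesis by (simp add: fourier_integral_eq[abs_def])
qed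

lemma norm_fourier_integral_le:
  assumes "integrable phys f"
  shows "norm (fourier_integral f \<zeta>) \<le> fourier_const * (\<integral>z. norm (f z) \<partial>phys)"
proof -
  have "norm (\<integral>z. f z * cnj (plane_wave z \<zeta>) \<partial>phys) \<le> (\<integral>z. norm (f z) \<partial>phys)"
    by (rule norm_integral_mult_le[OF assms]) simp
  then show ?thesis
    using fourier_const_pos by (simp add: fourier_integral_eq norm_mult)
qed

lemma norm_fourier_inverse_le:
  assumes "integrable freq G"
  shows "norm (fourier_inverse G z) \<le> fourier_const * (\<integral>\<zeta>. norm (G \<zeta>) \<partial>freq)"
proof -
  have "norm (\<integral>\<zeta>. G \<zeta> * plane_wave z \<zeta> \<partial>freq) \<le> (\<integral>\<zeta>. norm (G \<zeta>) \<partial>freq)"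
    by (rule norm_integral_mult_le[OF assms]) simp
  then show ?thesis
    using fourier_const_pos by (simp add: fourier_inverse_def norm_mult)
qed

lemma L2sq_cmult: "f \<in> borel_measurable M \<Longrightarrow> L2sq M (\<lambda>z. c * f z) = ennreal ((norm c)\<^sup>2) * L2sq M f"
  unfolding L2sq_def by (subst nn_integral_cmult[symmetric]) (auto simp: norm_mult power_mult_distrib ennreal_mult)

lemma plane_wave_measurable_gauss_phys:
  "(\<lambda>(z, \<zeta>). plane_wave z \<zeta>) \<in> borel_measurable (gauss_phys R \<Otimes>\<^sub>M freq)"
proof -
  have s: "sets (gauss_phys R \<Otimes>\<^sub>M freq) = sets (phys \<Otimes>\<^sub>M freq)"
    by (intro sets_pair_measure_cong sets_gauss_phys refl)
  have "(\<lambda>w. plane_wave (fst w) (snd w)) \<in> borel_measurable (phys \<Otimes>\<^sub>M freq)" by measurable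
  then show ?thesis unfolding split_beta' by (simp only: measurable_cong_sets[OF s refl])
qed

lemma nn_integral_count_space_delta:
  assumes "\<And>j. j \<noteq> k \<Longrightarrow> f j = 0"
  shows "(\<integral>\<^sup>+j. f j \<partial>count_space UNIV) = f k"
proof -
  have "(\<integral>\<^sup>+j. f j \<partial>count_space UNIV) = (\<integral>\<^sup>+j. f k * indicator {k} j \<partial>count_space UNIV)"
    by (intro nn_integral_cong) (auto simp: indicator_def assms)
  also have "\<dots> = f k" by (subst nn_integral_cmult_indicator) auto
  finally show ?thesis .
qed

text \<open>The factors \<open>R\<close> and \<open>1/R\<close> cancel, so the bound does not depend on the damping.\<close>

lemma gauss_phys_kernel_mass:
  assumes R: "R > 0"
  shows "(\<integral>\<^sup>+\<zeta>'. ennreal (norm (\<integral>z. plane_wave z \<zeta> * cnj (plane_wave z \<zeta>') \<partial>gauss_phys R)) \<partial>freq) = ennreal ((2 * pi)^3)"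
proof -
  interpret C: sigma_finite_measure "count_space (UNIV :: (int \<times> int) set)"
    by (rule sigma_finite_lattice)
  define c where "c = R * sqrt (2 * pi) * (2 * pi)\<^sup>2"
  have c: "c \<ge> 0" using R by (simp add: c_def)
  have "(\<integral>\<^sup>+\<zeta>'. ennreal (norm (\<integral>z. plane_wave z \<zeta> * cnj (plane_wave z \<zeta>') \<partial>gauss_phys R)) \<partial>freq)
    = (\<integral>\<^sup>+\<zeta>'. ennreal (c * exp (- (R * (fst \<zeta> - fst \<zeta>'))\<^sup>2 / 2) * (if snd \<zeta>' = snd \<zeta> then 1 else 0)) \<partial>freq)"
    unfolding gauss_phys_plane_wave_kernel[OF R] norm_of_real using R
    by (intro nn_integral_cong) (auto simp: c_def abs_mult)
  also have "\<dots> = (\<integral>\<^sup>+\<xi>. (\<integral>\<^sup>+k. ennreal (c * exp (- (R * (fst \<zeta> - \<xi>))\<^sup>2 / 2) * (if k = snd \<zeta> then 1 else 0)) \<partial>count_space UNIV) \<partial>lborel)"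
    unfolding freq_eq by (subst C.nn_integral_fst[symmetric]) simp_all
  also have "\<dots> = (\<integral>\<^sup>+\<xi>. ennreal c * ennreal (exp (- (R * (\<xi> - fst \<zeta>))\<^sup>2 / 2)) \<partial>lborel)"
    by (intro nn_integral_cong, subst nn_integral_count_space_delta[of "snd \<zeta>"])
       (use c in \<open>auto simp: ennreal_mult[symmetric] power_mult_distrib power2_commute\<close>)
  also have "\<dots> = ennreal c * ennreal (sqrt (2 * pi) / R)"
    using nn_integral_gaussian[OF R, of "fst \<zeta>"] by (simp add: nn_integral_cmult)
  also have "\<dots> = ennreal ((2 * pi)^3)"
    using R c by (simp add: ennreal_mult[symmetric] c_def power2_eq_square power3_eq_cube field_simps)
  finally show ?thesis .
qed

lemma L2sq_phys_eq_SUP: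
  assumes [measurable]: "f \<in> borel_measurable phys"
  shows "L2sq phys f = (SUP n. L2sq (gauss_phys (real (Suc n))) f)"
    and "incseq (\<lambda>n. L2sq (gauss_phys (real (Suc n))) f)"
  using gauss_exhaustion[OF sigma_finite_torus2, of "\<lambda>z. ennreal ((norm (f z))\<^sup>2)"] assms
  unfolding L2sq_def phys_def[symmetric] gauss_phys_def[symmetric] by simp_all

text \<open>Schur's test with the row mass \<open>(2 \<pi>)\<^sup>3\<close>, which the normalisation of the Fourier transform
  compensates exactly, followed by removal of the damping.\<close>

theorem L2sq_fourier_inverse_le:
  assumes G: "integrable freq G"
  shows "L2sq phys (fourier_inverse G) \<le> L2sq freq G"
proof -
  have [measurable]: "G \<in> borel_measurable freq" using G by auto
  interpret F: sigma_finite_measure freq by (rule sigma_finite_freq)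
  define f where "f z = (\<integral>\<zeta>. G \<zeta> * plane_wave z \<zeta> \<partial>freq)" for z
  have [measurable]: "f \<in> borel_measurable phys" unfolding f_def by measurable
  have "L2sq (gauss_phys (real (Suc n))) f \<le> ennreal ((2 * pi)^3) * L2sq freq G" for n
    unfolding f_def
    by (rule TTstar_Schur_bound[OF sigma_finite_freq gauss_phys_finite plane_wave_measurable_gauss_phys _ G])
       (simp_all add: gauss_phys_kernel_mass del: of_nat_Suc)
  then have "L2sq phys f \<le> ennreal ((2 * pi)^3) * L2sq freq G"
    by (subst L2sq_phys_eq_SUP) (auto intro: SUP_least simp del: of_nat_Suc)
  then have "ennreal (fourier_const\<^sup>2) * L2sq phys f \<le> ennreal (fourier_const\<^sup>2) * (ennreal ((2 * pi)^3) * L2sq freq G)"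
    by (rule mult_left_mono) simp
  also have "\<dots> = L2sq freq G"
    by (simp add: mult.assoc[symmetric] ennreal_mult[symmetric] fourier_const_square)
  finally show ?thesis
    unfolding fourier_inverse_def f_def[symmetric] by (subst L2sq_cmult) auto
qed

lemma fourier_multiplication_formula:
  assumes f: "integrable phys f" and G: "integrable freq G"
  shows "(\<integral>\<zeta>. fourier_integral f \<zeta> * cnj (G \<zeta>) \<partial>freq) = (\<integral>z. f z * cnj (fourier_inverse G z) \<partial>phys)"
proof -
  interpret P: pair_sigma_finite phys freq
    by (intro pair_sigma_finite.intro sigma_finite_phys sigma_finite_freq)
  have [measurable]: "f \<in> borel_measurable phys" by (rule borel_measurable_integrable[OF f])
  have [measurable]: "G \<in> borel_measurable freq" by (rule borel_measurable_integrable[OF G])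
  have "integrable (phys \<Otimes>\<^sub>M freq) (\<lambda>(z, \<zeta>). f z * cnj (G \<zeta> * plane_wave z \<zeta>))"
  proof (rule P.Fubini_integrable)
    show "AE z in phys. integrable freq (\<lambda>\<zeta>. case (z, \<zeta>) of (z, \<zeta>) \<Rightarrow> f z * cnj (G \<zeta> * plane_wave z \<zeta>))"
    proof (intro AE_I2)
      fix z assume z: "z \<in> space phys"
      have 1: "integrable freq (\<lambda>\<zeta>. norm (f z) * norm (G \<zeta>))" using G by simp
      have 2: "plane_wave z \<in> borel_measurable freq"
        by (rule plane_wave_measurable[OF measurable_const[OF z] measurable_ident_sets[OF refl]])
      show "integrable freq (\<lambda>\<zeta>. case (z, \<zeta>) of (z, \<zeta>) \<Rightarrow> f z * cnj (G \<zeta> * plane_wave z \<zeta>))"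
        unfolding split_conv
      proof (rule Bochner_Integration.integrable_bound[OF 1])
        show "(\<lambda>\<zeta>. f z * cnj (G \<zeta> * plane_wave z \<zeta>)) \<in> borel_measurable freq"
          by (intro borel_measurable_times borel_measurable_cnj borel_measurable_const 2) fact
      qed (simp add: norm_mult)
    qed
    show "integrable phys (\<lambda>z. \<integral>\<zeta>. norm (case (z, \<zeta>) of (z, \<zeta>) \<Rightarrow> f z * cnj (G \<zeta> * plane_wave z \<zeta>)) \<partial>freq)"
      using f by (simp add: norm_mult)
  qed measurable
  then have "(\<integral>\<zeta>. (\<integral>z. f z * cnj (G \<zeta> * plane_wave z \<zeta>) \<partial>phys) \<partial>freq)
      = (\<integral>z. (\<integral>\<zeta>. f z * cnj (G \<zeta> * plane_wave z \<zeta>) \<partial>freq) \<partial>phys)"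
    by (rule P.Fubini_integral)
  moreover have "(\<integral>\<zeta>. f z * cnj (G \<zeta> * plane_wave z \<zeta>) \<partial>freq) = f z * cnj (\<integral>\<zeta>. G \<zeta> * plane_wave z \<zeta> \<partial>freq)" for z
    by (subst Bochner_Integration.integral_cnj[symmetric]) (rule integral_mult_right_zero)
  moreover have "(\<integral>z. f z * cnj (G \<zeta> * plane_wave z \<zeta>) \<partial>phys) = (\<integral>z. f z * cnj (plane_wave z \<zeta>) \<partial>phys) * cnj (G \<zeta>)" for \<zeta>
    by (subst integral_mult_left_zero[symmetric]) (simp add: mult_ac)
  ultimately have *: "(\<integral>\<zeta>. (\<integral>z. f z * cnj (plane_wave z \<zeta>) \<partial>phys) * cnj (G \<zeta>) \<partial>freq)
    = (\<integral>z. f z * cnj (\<integral>\<zeta>. G \<zeta> * plane_wave z \<zeta> \<partial>freq) \<partial>phys)"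
    by (simp only:)
  have "(\<integral>\<zeta>. fourier_integral f \<zeta> * cnj (G \<zeta>) \<partial>freq)
      = complex_of_real fourier_const * (\<integral>\<zeta>. (\<integral>z. f z * cnj (plane_wave z \<zeta>) \<partial>phys) * cnj (G \<zeta>) \<partial>freq)"
    by (subst integral_mult_right_zero[symmetric]) (simp add: fourier_integral_eq mult_ac)
  also have "\<dots> = (\<integral>z. f z * cnj (fourier_inverse G z) \<partial>phys)"
    unfolding * by (subst integral_mult_right_zero[symmetric]) (simp add: fourier_inverse_def mult_ac)
  finally show ?thesis .
qed

definition freq_box :: "real \<Rightarrow> (real \<times> int \<times> int) set" where
  "freq_box n = {(\<xi>, k1, k2). \<bar>\<xi>\<bar> \<le> n \<and> \<bar>of_int k1\<bar> \<le> n \<and> \<bar>of_int k2\<bar> \<le> n}"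

lemma freq_box_measurable [measurable]: "freq_box n \<in> sets freq"
proof -
  have "Measurable.pred freq (\<lambda>\<zeta>. \<bar>fst \<zeta>\<bar> \<le> n \<and> \<bar>real_of_int (fst (snd \<zeta>))\<bar> \<le> n \<and> \<bar>real_of_int (snd (snd \<zeta>))\<bar> \<le> n)"
    by measurable
  then show ?thesis by (simp add: freq_box_def pred_def split_beta')
qed

lemma emeasure_freq_box: "emeasure freq (freq_box n) < \<infinity>"
proof -
  interpret C: sigma_finite_measure "count_space (UNIV :: (int \<times> int) set)"
    by (rule sigma_finite_lattice)
  have "emeasure freq (freq_box n) \<le> emeasure freq ({- n..n} \<times> ({-\<lceil>n\<rceil>..\<lceil>n\<rceil>} \<times> {-\<lceil>n\<rceil>..\<lceil>n\<rceil>}))"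
  proof (rule emeasure_mono)
    show "freq_box n \<subseteq> {- n..n} \<times> ({-\<lceil>n\<rceil>..\<lceil>n\<rceil>} \<times> {-\<lceil>n\<rceil>..\<lceil>n\<rceil>})"
      unfolding freq_box_def by (auto; linarith)
  qed (auto simp: freq_eq)
  also have "\<dots> = emeasure lborel {-n..n} * emeasure (count_space UNIV) ({-\<lceil>n\<rceil>..\<lceil>n\<rceil>} \<times> {-\<lceil>n\<rceil>..\<lceil>n\<rceil>})"
    unfolding freq_eq by (rule C.emeasure_pair_measure_Times) auto
  also have "\<dots> < \<infinity>"
    by (simp add: emeasure_lborel_Icc_eq ennreal_mult_less_top emeasure_count_space_finite of_nat_less_top)
  finally show ?thesis .
qed

lemma integrable_on_freq_box:
  fixes F :: "real \<times> int \<times> int \<Rightarrow> complex"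
  assumes [measurable]: "F \<in> borel_measurable freq" and "\<And>\<zeta>. norm (F \<zeta>) \<le> b"
    and "\<And>\<zeta>. \<zeta> \<notin> freq_box n \<Longrightarrow> F \<zeta> = 0"
  shows "integrable freq F"
  using assms emeasure_freq_box[of n]
  by (intro integrableI_bounded_set[where A="freq_box n" and B=b]) auto

text \<open>Duality: the inner product of the transform of \<open>f\<close> with its own truncation \<open>G\<close> to a frequency box
  equals the inner product of \<open>f\<close> with the inverse transform of \<open>G\<close>, and the latter has at most the
  norm of \<open>G\<close>. Truncation is needed because \<open>G\<close> must be integrable and its norm must be known to be finite
  before it can be cancelled.\<close>

theorem bessel_inequality:
  assumes f: "integrable phys f" and f2: "L2sq phys f < \<infinity>"
  shows "L2sq freq (fourier_integral f) \<le> L2sq phys f"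
proof -
  have [measurable]: "f \<in> borel_measurable phys" using f by auto
  define G where "G n \<zeta> = fourier_integral f \<zeta> * indicator (freq_box (real n)) \<zeta>" for n :: nat and \<zeta>
  define b where "b = fourier_const * (\<integral>z. norm (f z) \<partial>phys)"
  have b: "norm (fourier_integral f \<zeta>) \<le> b" for \<zeta>
    unfolding b_def by (rule norm_fourier_integral_le[OF f])
  then have b0: "b \<ge> 0" by (meson norm_ge_zero order_trans)
  have [measurable]: "G n \<in> borel_measurable freq" for n unfolding G_def by measurable
  have Gi: "integrable freq (G n)" for n
    by (rule integrable_on_freq_box[where b=b and n="real n"])
       (use b b0 in \<open>auto simp: G_def indicator_def\<close>)
  have Gi2: "integrable freq (\<lambda>\<zeta>. complex_of_real ((norm (G n \<zeta>))\<^sup>2))" for n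
    by (rule integrable_on_freq_box[where b="b\<^sup>2" and n="real n"])
       (use b b0 in \<open>auto simp: G_def indicator_def norm_power intro!: power_mono\<close>)
  have main: "L2sq freq (G n) \<le> L2sq phys f" for n
  proof -
    define X where "X = (\<integral>\<zeta>. (norm (G n \<zeta>))\<^sup>2 \<partial>freq)"
    have X0: "X \<ge> 0" unfolding X_def by simp
    have "integrable freq (\<lambda>\<zeta>. (norm (G n \<zeta>))\<^sup>2)"
      using integrable_norm[OF Gi2[of n]] by (simp add: norm_power)
    then have LX: "L2sq freq (G n) = ennreal X" unfolding X_def by (rule L2sq_eq_integral)
    have "complex_of_real X = (\<integral>\<zeta>. fourier_integral f \<zeta> * cnj (G n \<zeta>) \<partial>freq)"
      unfolding X_def integral_complex_of_real[symmetric]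
      by (intro Bochner_Integration.integral_cong refl)
         (auto simp: G_def indicator_def complex_norm_square[symmetric])
    also have "\<dots> = (\<integral>z. f z * cnj (fourier_inverse (G n) z) \<partial>phys)"
      by (rule fourier_multiplication_formula[OF f Gi])
    finally have "ennreal (X\<^sup>2) = ennreal ((norm (\<integral>z. f z * cnj (fourier_inverse (G n) z) \<partial>phys))\<^sup>2)"
      by (metis norm_of_real power2_abs)
    also have "\<dots> \<le> L2sq phys f * L2sq phys (\<lambda>z. cnj (fourier_inverse (G n) z))"
      by (rule square_norm_integral_mult_le) measurable
    also have "L2sq phys (\<lambda>z. cnj (fourier_inverse (G n) z)) = L2sq phys (fourier_inverse (G n))"
      by (simp add: L2sq_def)
    also have "L2sq phys f * \<dots> \<le> L2sq phys f * ennreal X"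
      unfolding LX[symmetric] by (intro mult_left_mono L2sq_fourier_inverse_le Gi) simp
    finally have *: "ennreal (X\<^sup>2) \<le> L2sq phys f * ennreal X" .
    obtain l where l: "L2sq phys f = ennreal l" "l \<ge> 0" using f2 by (cases "L2sq phys f") auto
    from * have "X\<^sup>2 \<le> l * X" using l X0 by (simp add: ennreal_mult[symmetric])
    then have "X \<le> l" using X0 l(2) by (cases "X = 0") (auto simp: power2_eq_square)
    then show ?thesis unfolding LX l by (rule ennreal_leI)
  qed
  have "L2sq freq (fourier_integral f) \<le> (SUP n. L2sq freq (G n))"
  proof -
    have inc: "incseq (\<lambda>n \<zeta>. ennreal ((norm (G n \<zeta>))\<^sup>2))"
      unfolding incseq_def le_fun_def G_def
      by (auto simp: indicator_def freq_box_def)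
    have "(SUP n. ennreal ((norm (G n \<zeta>))\<^sup>2)) \<ge> ennreal ((norm (fourier_integral f \<zeta>))\<^sup>2)" for \<zeta>
    proof -
      obtain \<xi> k1 k2 where z: "\<zeta> = (\<xi>, k1, k2)" by (metis prod_cases3)
      obtain n :: nat where "real n \<ge> max \<bar>\<xi>\<bar> (max \<bar>of_int k1\<bar> \<bar>of_int k2\<bar>)"
        using real_arch_simple by blast
      then have "G n \<zeta> = fourier_integral f \<zeta>" by (simp add: G_def z freq_box_def)
      then show ?thesis by (intro SUP_upper2[of n]) simp_all
    qed
    then have "L2sq freq (fourier_integral f) \<le> (\<integral>\<^sup>+\<zeta>. (SUP n. ennreal ((norm (G n \<zeta>))\<^sup>2)) \<partial>freq)"
      unfolding L2sq_def by (intro nn_integral_mono)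
    also have "\<dots> = (SUP n. L2sq freq (G n))"
      unfolding L2sq_def by (rule nn_integral_monotone_convergence_SUP[OF inc]) measurable
    finally show ?thesis .
  qed
  also have "\<dots> \<le> L2sq phys f" using main by (rule SUP_least)
  finally show ?thesis .
qed

section \<open>Uniqueness of Fourier coefficients\<close>

text \<open>Integrals against the family \<open>e\<close> separate the integrable functions up to null sets. Uniqueness
  theorems are stated in this form because it passes to product measures.\<close>

definition determining :: "'a measure \<Rightarrow> ('i \<Rightarrow> 'a \<Rightarrow> complex) \<Rightarrow> bool" where
  "determining M e \<longleftrightarrow> (\<forall>h. integrable M h \<longrightarrow> (\<forall>i. (\<integral>x. h x * e i x \<partial>M) = 0) \<longrightarrow> (AE x in M. h x = 0))"

text \<open>A family closed under conjugation annihilates \<open>h\<close> if and only if it annihilates the real and the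
  imaginary part of \<open>h\<close>; real functions can then be split into positive and negative parts, that is,
  into measures.\<close>

lemma determiningI_real:
  fixes e :: "'i \<Rightarrow> 'a \<Rightarrow> complex"
  assumes e [measurable]: "\<And>i. e i \<in> borel_measurable M" and e1: "\<And>i x. norm (e i x) \<le> 1"
    and conj: "\<And>i. \<exists>j. \<forall>x. cnj (e i x) = e j x"
    and real: "\<And>g :: 'a \<Rightarrow> real. integrable M g \<Longrightarrow> (\<And>i. (\<integral>x. complex_of_real (g x) * e i x \<partial>M) = 0) \<Longrightarrow> AE x in M. g x = 0"
  shows "determining M e"
  unfolding determining_def
proof (intro allI impI)
  fix h :: "'a \<Rightarrow> complex" assume h: "integrable M h" and 0: "\<forall>i. (\<integral>x. h x * e i x \<partial>M) = 0"
  have [measurable]: "h \<in> borel_measurable M" using h by (rule borel_measurable_integrable)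
  have hi: "integrable M (\<lambda>x. h x * e i x)" for i
    using h by (rule Bochner_Integration.integrable_bound)
      (auto simp: norm_mult intro!: mult_left_le e1)
  have hc: "(\<integral>x. cnj (h x) * e i x \<partial>M) = 0" and hci: "integrable M (\<lambda>x. cnj (h x) * e i x)" for i
  proof -
    obtain j where j: "\<And>x. cnj (e i x) = e j x" using conj by blast
    have "cnj (h x) * e i x = cnj (h x * e j x)" for x by (simp add: j[symmetric])
    then show "(\<integral>x. cnj (h x) * e i x \<partial>M) = 0" "integrable M (\<lambda>x. cnj (h x) * e i x)"
      using 0 hi[of j] by (simp_all only: Bochner_Integration.integral_cnj integrable_cnj complex_cnj_zero)
  qed
  have "AE x in M. Re (h x) = 0"
  proof (rule real)
    show "(\<integral>x. complex_of_real (Re (h x)) * e i x \<partial>M) = 0" for i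
    proof -
      have "complex_of_real (Re (h x)) * e i x = (h x * e i x + cnj (h x) * e i x) / 2" for x
        by (simp only: distrib_right[symmetric] complex_add_cnj) simp
      then have "(\<integral>x. complex_of_real (Re (h x)) * e i x \<partial>M) = (\<integral>x. (h x * e i x + cnj (h x) * e i x) / 2 \<partial>M)"
        by (simp only:)
      then show ?thesis using 0 hc[of i] hi[of i] hci[of i] by simp
    qed
  qed (use h in simp)
  moreover have "AE x in M. Im (h x) = 0"
  proof (rule real)
    show "(\<integral>x. complex_of_real (Im (h x)) * e i x \<partial>M) = 0" for i
    proof -
      have "complex_of_real (Im (h x)) * e i x = (h x * e i x - cnj (h x) * e i x) / (2 * \<i>)" for x
      proof -
        have "complex_of_real (Im (h x)) = (h x - cnj (h x)) / (2 * \<i>)"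
          by (simp add: complex_eq_iff)
        then show ?thesis by (simp only: left_diff_distrib times_divide_eq_left)
      qed
      then have "(\<integral>x. complex_of_real (Im (h x)) * e i x \<partial>M) = (\<integral>x. (h x * e i x - cnj (h x) * e i x) / (2 * \<i>) \<partial>M)"
        by (simp only:)
      then show ?thesis using 0 hc[of i] hi[of i] hci[of i] by simp
    qed
  qed (use h in simp)
  ultimately show "AE x in M. h x = 0" by eventually_elim (simp add: complex_eq_iff)
qed

text \<open>Fubini's theorem reduces the product to the factors. Countability of the second index set allows
  the exceptional null sets in the first variable to be collected into one.\<close>

lemma determining_pair:
  fixes e :: "'i \<Rightarrow> 'a \<Rightarrow> complex" and f :: "'j::countable \<Rightarrow> 'b \<Rightarrow> complex"
  assumes A: "sigma_finite_measure A" and B: "sigma_finite_measure B"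
    and [measurable]: "\<And>i. e i \<in> borel_measurable A" "\<And>j. f j \<in> borel_measurable B"
    and e1: "\<And>i x. norm (e i x) \<le> 1" and f1: "\<And>j x. norm (f j x) \<le> 1"
    and dA: "determining A e" and dB: "determining B f"
  shows "determining (A \<Otimes>\<^sub>M B) (\<lambda>(i, j) z. e i (fst z) * f j (snd z))"
  unfolding determining_def
proof (intro allI impI)
  interpret A: sigma_finite_measure A by fact
  interpret B: sigma_finite_measure B by fact
  interpret P: pair_sigma_finite A B ..
  fix h :: "'a \<times> 'b \<Rightarrow> complex" assume h: "integrable (A \<Otimes>\<^sub>M B) h"
    and 0: "\<forall>ij. (\<integral>z. h z * (case ij of (i, j) \<Rightarrow> \<lambda>z. e i (fst z) * f j (snd z)) z \<partial>(A \<Otimes>\<^sub>M B)) = 0"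
  have hm[measurable]: "h \<in> borel_measurable (A \<Otimes>\<^sub>M B)" using h by (rule borel_measurable_integrable)
  have hf: "integrable (A \<Otimes>\<^sub>M B) (\<lambda>z. h z * f j (snd z))" for j
    using h by (rule Bochner_Integration.integrable_bound)
      (auto simp: norm_mult intro!: mult_left_le f1)
  have hef: "integrable (A \<Otimes>\<^sub>M B) (\<lambda>z. h z * f j (snd z) * e i (fst z))" for i j
    using hf[of j] by (rule Bochner_Integration.integrable_bound)
      (auto simp: norm_mult mult.assoc intro!: mult_left_mono mult_left_le e1)
  have "AE x in A. (\<integral>y. h (x, y) * f j y \<partial>B) = 0" for j
  proof -
    have "integrable A (\<lambda>x. \<integral>y. h (x, y) * f j y \<partial>B)"
      using P.integrable_fst'[OF hf[of j]] by simp
    moreover have "(\<integral>x. (\<integral>y. h (x, y) * f j y \<partial>B) * e i x \<partial>A) = 0" for i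
    proof -
      have "(\<integral>x. (\<integral>y. h (x, y) * f j y \<partial>B) * e i x \<partial>A) = (\<integral>x. (\<integral>y. h (x, y) * f j y * e i x \<partial>B) \<partial>A)"
        by simp
      also have "\<dots> = (\<integral>z. h z * f j (snd z) * e i (fst z) \<partial>(A \<Otimes>\<^sub>M B))"
        using P.integral_fst'[OF hef[of j i]] by simp
      also have "\<dots> = 0" using 0[rule_format, of "(i, j)"] by (simp add: mult_ac)
      finally show ?thesis .
    qed
    ultimately show ?thesis using dA unfolding determining_def by blast
  qed
  then have "AE x in A. \<forall>j. (\<integral>y. h (x, y) * f j y \<partial>B) = 0" by (simp add: AE_all_countable)
  moreover have "AE x in A. integrable B (\<lambda>y. h (x, y))"
    using P.AE_integrable_fst'[OF h] .
  ultimately have "AE x in A. AE y in B. h (x, y) = 0"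
    by eventually_elim (use dB in \<open>auto simp: determining_def\<close>)
  then show "AE z in A \<Otimes>\<^sub>M B. h z = 0"
    by (intro P.AE_pair_measure) measurable
qed

lemma nn_integral_ennreal_pos_part:
  fixes g :: "'a \<Rightarrow> real"
  assumes "integrable M g"
  shows "(\<integral>\<^sup>+x. ennreal (g x) \<partial>M) = ennreal (\<integral>x. max 0 (g x) \<partial>M)"
proof -
  have "(\<integral>\<^sup>+x. ennreal (g x) \<partial>M) = (\<integral>\<^sup>+x. ennreal (max 0 (g x)) \<partial>M)"
    by (intro nn_integral_cong) (simp add: max_def ennreal_neg)
  then show ?thesis using assms by (subst (asm) nn_integral_eq_integral) auto
qed

lemma integral_pos_minus_neg:
  fixes g :: "'a \<Rightarrow> real"
  assumes "integrable M g"
  shows "(\<integral>x. max 0 (g x) \<partial>M) - (\<integral>x. max 0 (- g x) \<partial>M) = (\<integral>x. g x \<partial>M)"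
proof -
  have "(\<integral>x. max 0 (g x) \<partial>M) - (\<integral>x. max 0 (- g x) \<partial>M) = (\<integral>x. max 0 (g x) - max 0 (- g x) \<partial>M)"
    by (rule Bochner_Integration.integral_diff[symmetric]) (use assms in auto)
  also have "\<dots> = (\<integral>x. g x \<partial>M)" by (intro Bochner_Integration.integral_cong) auto
  finally show ?thesis .
qed

lemma AE_zero_if_parts_eq:
  fixes g :: "'a \<Rightarrow> real"
  assumes "sigma_finite_measure M" "g \<in> borel_measurable M"
    and "density M (\<lambda>x. ennreal (g x)) = density M (\<lambda>x. ennreal (- g x))"
  shows "AE x in M. g x = 0"
proof -
  have "AE x in M. ennreal (g x) = ennreal (- g x)"
    using assms by (intro sigma_finite_measure.density_unique) auto
  then show ?thesis
  proof eventually_elim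
    case (elim x)
    then show ?case by (cases "g x \<ge> 0") (auto simp: ennreal_neg ennreal_eq_0_iff) 
  qed
qed

text \<open>If \<open>g\<close> has vanishing Fourier transform, its positive and negative parts have the same mass and
  the same characteristic function; after normalisation they are equal probability measures.\<close>

lemma determining_line: "determining lborel (\<lambda>b x. cis (- (x * b)))"
proof (rule determiningI_real)
  show "\<exists>j. \<forall>x. cnj (cis (- (x * b))) = cis (- (x * j))" for b
    by (rule exI[of _ "- b"]) (simp add: cis_cnj)
  fix g :: "real \<Rightarrow> real" assume g: "integrable lborel g"
    and 0: "\<And>b. (\<integral>x. complex_of_real (g x) * cis (- (x * b)) \<partial>lborel) = 0"
  have [measurable]: "g \<in> borel_measurable borel" using borel_measurable_integrable[OF g] by simp
  define c where "c = (\<integral>x. max 0 (g x) \<partial>lborel)"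
  have "(\<integral>x. g x \<partial>lborel) = 0" using 0[of 0] by simp
  then have c: "c = (\<integral>x. max 0 (- g x) \<partial>lborel)"
    using integral_pos_minus_neg[OF g] by (simp add: c_def)
  have c0: "c \<ge> 0" unfolding c_def by simp
  show "AE x in lborel. g x = 0"
  proof (cases "c = 0")
    case True
    have "AE x in lborel. max 0 (g x) = 0"
      using True g unfolding c_def by (subst (asm) integral_nonneg_eq_0_iff_AE) auto
    moreover have "AE x in lborel. max 0 (- g x) = 0"
      using True g unfolding c by (subst (asm) integral_nonneg_eq_0_iff_AE) auto
    ultimately show ?thesis by eventually_elim linarith
  next
    case False
    then have c1: "c > 0" using c0 by simp
    define P where "P s = density lborel (\<lambda>x. ennreal (max 0 (s * g x) / c))" for s :: real
    have sP: "real_distribution (P s)" if s: "s = 1 \<or> s = - 1" for s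
    proof -
      have "emeasure (P s) (space (P s)) = (\<integral>\<^sup>+x. ennreal (max 0 (s * g x) / c) \<partial>lborel)"
        by (simp add: P_def emeasure_density)
      also have "\<dots> = ennreal (\<integral>x. max 0 (s * g x) / c \<partial>lborel)"
        using c1 g by (intro nn_integral_eq_integral) auto
      also have "\<dots> = 1" using s c1 c c_def by auto
      finally have "prob_space (P s)" by (rule prob_spaceI)
      then show ?thesis by (rule real_distribution.intro) (simp add: real_distribution_axioms_def P_def)
    qed
    have char: "char (P s) b = complex_of_real (1 / c) * (\<integral>x. complex_of_real (max 0 (s * g x)) * cis (- (x * - b)) \<partial>lborel)" for s b
    proof -
      have "char (P s) b = (\<integral>x. (max 0 (s * g x) / c) *\<^sub>R iexp (b * x) \<partial>lborel)"
        unfolding char_def P_def using c1 by (subst integral_density) auto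
      also have "\<dots> = (\<integral>x. complex_of_real (1 / c) * (complex_of_real (max 0 (s * g x)) * cis (- (x * - b))) \<partial>lborel)"
        by (intro Bochner_Integration.integral_cong refl) (simp add: scaleR_conv_of_real cis_conv_exp mult_ac)
      finally show ?thesis by (simp only: integral_mult_right_zero)
    qed
    have "P 1 = P (- 1)"
    proof (rule Levy_uniqueness)
      have int: "integrable lborel (\<lambda>x. complex_of_real (max 0 (s * g x)) * cis (- (x * - b)))" for s b
      proof (rule Bochner_Integration.integrable_bound)
        show "integrable lborel (\<lambda>x. max 0 (s * g x))" using g by auto
      qed (auto simp: norm_mult)
      have "char (P 1) b - char (P (- 1)) b = 0" for b
        unfolding char right_diff_distrib[symmetric] using int[of 1 b] int[of "-1" b]
      proof (subst Bochner_Integration.integral_diff[symmetric])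
        have "complex_of_real (max 0 (1 * g x)) * cis (- (x * - b)) - complex_of_real (max 0 (- 1 * g x)) * cis (- (x * - b))
          = complex_of_real (g x) * cis (- (x * - b))" for x
          by (simp add: left_diff_distrib[symmetric] max_def)
        then show "complex_of_real (1 / c) * (\<integral>x. complex_of_real (max 0 (1 * g x)) * cis (- (x * - b)) - complex_of_real (max 0 (- 1 * g x)) * cis (- (x * - b)) \<partial>lborel) = 0"
          using 0[of "- b"] by simp
      qed auto
      then show "char (P 1) = char (P (- 1))" by (auto simp: fun_eq_iff)
    qed (use sP in auto)
    then have "AE x in lborel. ennreal (max 0 (1 * g x) / c) = ennreal (max 0 (- 1 * g x) / c)"
      unfolding P_def by (intro sigma_finite_measure.density_unique[OF sigma_finite_lborel]) auto
    then show ?thesis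
    proof eventually_elim
      case (elim x)
      then have "max 0 (g x) = max 0 (- g x)" using c1 by simp
      then show ?case by (auto simp: max_def split: if_splits)
    qed
  qed
qed auto

text \<open>Multiplication by \<open>cos\<close> or \<open>sin\<close> shifts Fourier coefficients, so the functions with vanishing
  coefficients are stable under multiplication by polynomials on the circle. In this form
  the induction on polynomials needs no explicit description of trigonometric polynomials.\<close>

lemma annihilator_mult_polynomial:
  fixes p :: "complex \<Rightarrow> real"
  assumes "real_polynomial_function p"
  shows "\<And>h :: real \<Rightarrow> complex. integrable torus h \<Longrightarrow> (\<And>k::int. (\<integral>y. h y * cis (- (y * of_int k)) \<partial>torus) = 0) \<Longrightarrow>
    integrable torus (\<lambda>y. h y * complex_of_real (p (cis y))) \<and>
    (\<forall>k::int. (\<integral>y. h y * complex_of_real (p (cis y)) * cis (- (y * of_int k)) \<partial>torus) = 0)"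
  using assms
proof (induction p rule: real_polynomial_function.induct)
  case (linear f)
  have hm[measurable]: "h \<in> borel_measurable torus" by (rule borel_measurable_integrable[OF linear(2)])
  have hc: "integrable torus (\<lambda>y. h y * cis (- (y * of_int k)))" for k :: int
    using linear(2) by (rule Bochner_Integration.integrable_bound)
      (simp_all add: norm_mult borel_measurable_times[OF hm torus_le_borel])
  have f: "complex_of_real (f (cis y)) = of_real (f 1) * ((cis y + cis (- y)) / 2) + of_real (f \<i>) * ((cis y - cis (- y)) / (2 * \<i>))" for y
  proof -
    interpret bounded_linear f by fact
    have "cis y = cos y *\<^sub>R 1 + sin y *\<^sub>R \<i>" by (simp add: complex_eq_iff)
    then have "f (cis y) = cos y * f 1 + sin y * f \<i>" by (simp add: add scale)
    moreover have "(cis y + cis (- y)) / 2 = of_real (cos y)" "(cis y - cis (- y)) / (2 * \<i>) = of_real (sin y)"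
      by (simp_all add: complex_eq_iff)
    ultimately show ?thesis by (simp only:) simp
  qed
  define \<alpha> where "\<alpha> = complex_of_real (f 1) / 2 + of_real (f \<i>) / (2 * \<i>)"
  define \<beta> where "\<beta> = complex_of_real (f 1) / 2 - of_real (f \<i>) / (2 * \<i>)"
  have f': "h y * complex_of_real (f (cis y)) * cis (- (y * of_int k)) =
      \<alpha> * (h y * cis (- (y * of_int (k - 1)))) + \<beta> * (h y * cis (- (y * of_int (k + 1))))" for y k
  proof -
    have a: "cis y * cis (- (y * of_int k)) = cis (- (y * of_int (k - 1)))"
      "cis (- y) * cis (- (y * of_int k)) = cis (- (y * of_int (k + 1)))"
      by (simp_all add: cis_mult algebra_simps)
    have b: "complex_of_real (f (cis y)) = \<alpha> * cis y + \<beta> * cis (- y)"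
      unfolding f \<alpha>_def \<beta>_def by (simp add: field_simps)
    have "h y * (\<alpha> * cis y + \<beta> * cis (- y)) * c = \<alpha> * (h y * (cis y * c)) + \<beta> * (h y * (cis (- y) * c))" for c
      by (simp only: distrib_left distrib_right mult_ac)
    from this[of "cis (- (y * of_int k))"] show ?thesis unfolding b a .
  qed
  have "integrable torus (\<lambda>y. h y * complex_of_real (f (cis y)) * cis (- (y * of_int 0)))"
    unfolding f' using hc[of "0 - 1"] hc[of "0 + 1"] by (intro Bochner_Integration.integrable_add integrable_mult_right)
  moreover have "(\<integral>y. h y * complex_of_real (f (cis y)) * cis (- (y * of_int k)) \<partial>torus) = 0" for k :: int
    unfolding f' using hc[of "k - 1"] hc[of "k + 1"] linear(3)[of "k - 1"] linear(3)[of "k + 1"]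
    by (subst Bochner_Integration.integral_add)
       (simp_all only: integrable_mult_right integral_mult_right_zero mult_zero_right add_0_right)
  ultimately show ?case by simp
next
  case (const c)
  have "(\<integral>y. h y * complex_of_real c * cis (- (y * of_int k)) \<partial>torus) = of_real c * (\<integral>y. h y * cis (- (y * of_int k)) \<partial>torus)" for k :: int
    by (subst integral_mult_right_zero[symmetric]) (simp add: mult_ac)
  then show ?case using const by simp
next
  case (add f g)
  have *: "integrable torus (\<lambda>y. h y * complex_of_real (q (cis y)) * cis (- (y * of_int k)))"
    if "integrable torus (\<lambda>y. h y * complex_of_real (q (cis y)))" for q and k :: int
    using that by (rule Bochner_Integration.integrable_bound)
      (simp_all add: norm_mult borel_measurable_times[OF borel_measurable_integrable[OF that] torus_le_borel])
  from add have f: "integrable torus (\<lambda>y. h y * complex_of_real (f (cis y)))"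
    "\<And>k::int. (\<integral>y. h y * complex_of_real (f (cis y)) * cis (- (y * of_int k)) \<partial>torus) = 0"
    and g: "integrable torus (\<lambda>y. h y * complex_of_real (g (cis y)))"
    "\<And>k::int. (\<integral>y. h y * complex_of_real (g (cis y)) * cis (- (y * of_int k)) \<partial>torus) = 0"
    by blast+
  show ?case
    unfolding of_real_add distrib_left distrib_right
    using f g *[OF f(1)] *[OF g(1)] by (simp add: Bochner_Integration.integral_add)
next
  case (mult f g)
  have "integrable torus (\<lambda>y. h y * complex_of_real (f (cis y)))"
    "\<And>k::int. (\<integral>y. h y * complex_of_real (f (cis y)) * cis (- (y * of_int k)) \<partial>torus) = 0"
    using mult.IH(1)[OF mult.prems] by blast+
  from mult.IH(2)[OF this] show ?case by (simp add: mult.assoc)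
qed

text \<open>A Borel measurable inverse of \<open>y \<mapsto> e\<^sup>i\<^sup>y\<close> on \<open>[0, 2 \<pi>)\<close>; it transports measurable sets of angles to
  measurable subsets of the plane. The clamping keeps the argument of \<open>arccos\<close> in
  the interval on which it is continuous.\<close>

definition cis_inverse :: "complex \<Rightarrow> real" where
  "cis_inverse z = (let a = arccos (max (- 1) (min 1 (Re z))) in if 0 \<le> Im z then a else 2 * pi - a)"

lemma cis_inverse_cis: "y \<in> {0..<2 * pi} \<Longrightarrow> cis_inverse (cis y) = y"
proof -
  assume y: "y \<in> {0..<2 * pi}"
  show ?thesis
  proof (cases "y \<le> pi")
    case True
    then show ?thesis using y sin_ge_zero[of y] by (simp add: cis_inverse_def arccos_cos)
  next
    case False
    then have "sin y < 0" using y sin_gt_zero[of "y - pi"] by (simp add: sin_diff)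
    moreover have "arccos (cos y) = 2 * pi - y"
      using False y arccos_cos[of "2 * pi - y"] by (simp add: cos_diff)
    ultimately show ?thesis by (simp add: cis_inverse_def)
  qed
qed

lemma cis_inverse_measurable [measurable]: "cis_inverse \<in> borel_measurable borel"
proof -
  have "continuous_on UNIV (\<lambda>z::complex. arccos (max (- 1) (min 1 (Re z))))"
    by (intro continuous_on_arccos continuous_intros) auto
  then have [measurable]: "(\<lambda>z::complex. arccos (max (- 1) (min 1 (Re z)))) \<in> borel_measurable borel"
    by (rule borel_measurable_continuous_onI)
  show ?thesis unfolding cis_inverse_def Let_def by measurable
qed

text \<open>By the Stone-Weierstrass theorem a function with vanishing coefficients integrates to zero
  against every continuous function on the circle, hence over every relatively open set. So its positive and
  negative parts, transported to the circle, agree on a generator of the Borel sets that is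
  stable under intersection.\<close>

lemma determining_torus: "determining torus (\<lambda>k::int. \<lambda>y. cis (- (y * of_int k)))"
proof (rule determiningI_real)
  show "\<exists>j. \<forall>x. cnj (cis (- (x * real_of_int k))) = cis (- (x * real_of_int j))" for k
    by (rule exI[of _ "- k"]) (simp add: cis_cnj)
  show "(\<lambda>y. cis (- (y * real_of_int k))) \<in> borel_measurable torus" for k
    by (rule torus_le_borel) measurable
  interpret T: finite_measure torus by (rule torus_finite)
  have cm[measurable]: "cis \<in> borel_measurable torus" by (rule torus_le_borel) measurable
  fix g :: "real \<Rightarrow> real" assume g: "integrable torus g"
    and 0: "\<And>k::int. (\<integral>x. complex_of_real (g x) * cis (- (x * of_int k)) \<partial>torus) = 0"
  have [measurable]: "g \<in> borel_measurable torus" using borel_measurable_integrable[OF g] by simp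
  have poly: "integrable torus (\<lambda>y. g y * p (cis y))" "(\<integral>y. g y * p (cis y) \<partial>torus) = 0"
    if p: "real_polynomial_function p" for p
  proof -
    have *: "integrable torus (\<lambda>y. complex_of_real (g y) * complex_of_real (p (cis y)))"
      "(\<integral>y. complex_of_real (g y) * complex_of_real (p (cis y)) * cis (- (y * of_int 0)) \<partial>torus) = 0"
      using annihilator_mult_polynomial[OF p, of "\<lambda>y. complex_of_real (g y)"] g 0 by blast+
    then have "integrable torus (\<lambda>y. complex_of_real (g y * p (cis y)))"
      "(\<integral>y. complex_of_real (g y * p (cis y)) \<partial>torus) = 0"
      by simp_all
    then show "integrable torus (\<lambda>y. g y * p (cis y))" "(\<integral>y. g y * p (cis y) \<partial>torus) = 0"
      by (simp_all only: integral_complex_of_real complex_of_real_integrable_eq of_real_eq_0_iff)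
  qed
  have cont: "(\<integral>y. g y * q (cis y) \<partial>torus) = 0"
    if q: "continuous_on UNIV q" and qb: "\<And>z. \<bar>q z\<bar> \<le> 1" for q :: "complex \<Rightarrow> real"
  proof -
    have [measurable]: "q \<in> borel_measurable borel" using q by (rule borel_measurable_continuous_onI)
    have iq: "integrable torus (\<lambda>y. g y * q (cis y))"
      using g by (rule Bochner_Integration.integrable_bound)
        (auto simp: abs_mult intro!: mult_left_le qb)
    have "\<bar>\<integral>y. g y * q (cis y) \<partial>torus\<bar> \<le> e * (\<integral>y. \<bar>g y\<bar> \<partial>torus)" if e: "e > 0" for e
    proof -
      obtain p where p: "real_polynomial_function p" "\<And>z. z \<in> sphere 0 1 \<Longrightarrow> \<bar>q z - p z\<bar> < e"
        using Stone_Weierstrass_real_polynomial_function[of "sphere 0 1" q e] q e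
        by (metis compact_sphere continuous_on_subset subset_UNIV)
      have "(\<integral>y. g y * q (cis y) \<partial>torus) = (\<integral>y. g y * q (cis y) - g y * p (cis y) \<partial>torus)"
        using poly[OF p(1)] iq by simp
      also have "\<bar>\<dots>\<bar> \<le> (\<integral>y. \<bar>g y * q (cis y) - g y * p (cis y)\<bar> \<partial>torus)"
        by (rule integral_abs_bound)
      also have "\<dots> \<le> (\<integral>y. \<bar>g y\<bar> * e \<partial>torus)"
      proof (rule integral_mono)
        show "\<bar>g y * q (cis y) - g y * p (cis y)\<bar> \<le> \<bar>g y\<bar> * e" for y
          using p(2)[of "cis y"] by (auto simp: right_diff_distrib[symmetric] abs_mult intro!: mult_left_mono)
      qed (use g poly[OF p(1)] iq in auto)
      finally show ?thesis by (simp add: mult.commute)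
    qed
    note bound = this
    have "\<bar>\<integral>y. g y * q (cis y) \<partial>torus\<bar> \<le> 0 + e" if "e > 0" for e
    proof -
      have pos: "(\<integral>y. \<bar>g y\<bar> \<partial>torus) + 1 > 0" by (intro add_nonneg_pos) auto
      then have "\<bar>\<integral>y. g y * q (cis y) \<partial>torus\<bar> \<le> e / ((\<integral>y. \<bar>g y\<bar> \<partial>torus) + 1) * (\<integral>y. \<bar>g y\<bar> \<partial>torus)"
        using that pos by (intro bound divide_pos_pos)
      also have "\<dots> \<le> e" using pos that by (simp add: field_simps)
      finally show ?thesis by simp
    qed
    then show ?thesis using field_le_epsilon[of "\<bar>\<integral>y. g y * q (cis y) \<partial>torus\<bar>" 0] by simp
  qed
  have open_zero: "(\<integral>y. g y * indicator U (cis y) \<partial>torus) = 0" if U: "open U" for U :: "complex set"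
  proof (cases "U = UNIV")
    case True
    then show ?thesis using cont[of "\<lambda>_. 1"] by simp
  next
    case False
    then have ne: "- U \<noteq> {}" by auto
    \<comment> \<open>Continuous functions increasing to the indicator of \<open>U\<close>.\<close>
    define q where "q n z = min 1 (real n * infdist z (- U))" for n :: nat and z
    have qc: "continuous_on UNIV (q n)" for n
      unfolding q_def by (intro continuous_intros)
    have [measurable]: "q n \<in> borel_measurable borel" for n
      using qc by (rule borel_measurable_continuous_onI)
    have [measurable]: "U \<in> sets borel" using U by simp
    have q1: "\<bar>q n z\<bar> \<le> 1" for n z by (simp add: q_def infdist_nonneg)
    have lim: "(\<lambda>n. q n z) \<longlonglongrightarrow> indicator U z" for z
    proof (cases "z \<in> U")
      case True
      then have d: "infdist z (- U) > 0"
        using in_closed_iff_infdist_zero[of "- U" z] U ne infdist_nonneg[of z "- U"] by (auto simp: closed_def less_le)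
      have "\<forall>\<^sub>F n in sequentially. q n z = 1"
      proof -
        obtain m :: nat where m: "1 / infdist z (- U) < real m" using reals_Archimedean2 by blast
        have "q n z = 1" if "n \<ge> m" for n
        proof -
          have "1 / infdist z (- U) \<le> real n" using m that by linarith
          then have "1 \<le> real n * infdist z (- U)" using d by (simp add: field_simps)
          then show ?thesis by (simp add: q_def)
        qed
        then show ?thesis by (auto simp: eventually_sequentially)
      qed
      then show ?thesis using True by (auto intro: tendsto_eventually)
    next
      case False
      then have "infdist z (- U) = 0" by simp
      then show ?thesis using False by (simp add: q_def)
    qed
    have "(\<lambda>n. \<integral>y. g y * q n (cis y) \<partial>torus) \<longlonglongrightarrow> (\<integral>y. g y * indicator U (cis y) \<partial>torus)"
    proof (rule integral_dominated_convergence)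
      show "integrable torus (\<lambda>y. \<bar>g y\<bar>)" using g by simp
      show "AE y in torus. (\<lambda>n. g y * q n (cis y)) \<longlonglongrightarrow> g y * indicator U (cis y)"
        by (intro AE_I2 tendsto_intros lim)
      show "AE y in torus. norm (g y * q n (cis y)) \<le> \<bar>g y\<bar>" for n
        by (auto simp: abs_mult intro!: mult_left_le q1)
    qed measurable
    then show ?thesis
      using cont[OF qc q1] LIMSEQ_unique by (simp add: LIMSEQ_const_iff)
  qed
  define P where "P s = density torus (\<lambda>y. ennreal (s * g y))" for s :: real
  have P_eq: "emeasure (distr (P s) borel cis) U = ennreal (\<integral>y. max 0 (s * (g y * indicator U (cis y))) \<partial>torus)"
    if [measurable]: "U \<in> sets borel" for s and U :: "complex set"
  proof -
    have i: "integrable torus (\<lambda>y. s * (g y * indicator U (cis y)))"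
    proof -
      have "integrable torus (\<lambda>y. g y * indicator U (cis y))"
        using g by (rule Bochner_Integration.integrable_bound) (auto simp: indicator_def)
      then show ?thesis by simp
    qed
    have "emeasure (distr (P s) borel cis) U = (\<integral>\<^sup>+y. ennreal (s * g y) * indicator (cis -` U \<inter> space torus) y \<partial>torus)"
    proof -
      have "cis -` U \<inter> space torus \<in> sets torus" by (rule measurable_sets[OF cm]) simp
      then show ?thesis
        unfolding P_def by (subst emeasure_distr) (simp_all add: emeasure_density)
    qed
    also have "\<dots> = (\<integral>\<^sup>+y. ennreal (s * (g y * indicator U (cis y))) \<partial>torus)"
      by (intro nn_integral_cong) (auto simp: indicator_def)
    finally show ?thesis using nn_integral_ennreal_pos_part[OF i] by simp
  qed
  have P_open: "emeasure (distr (P 1) borel cis) U = emeasure (distr (P (- 1)) borel cis) U" if U: "open U" for U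
  proof -
    have "integrable torus (\<lambda>y. g y * indicator U (cis y))"
    proof (rule Bochner_Integration.integrable_bound[OF g])
      have [measurable]: "U \<in> sets borel" using U by simp
      show "(\<lambda>y. g y * indicator U (cis y)) \<in> borel_measurable torus" by measurable
    qed (auto simp: indicator_def)
    from integral_pos_minus_neg[OF this] open_zero[OF U] U show ?thesis
      by (simp add: P_eq)
  qed
  have distr_eq: "distr (P 1) borel cis = distr (P (- 1)) borel cis"
  proof (rule measure_eqI_generator_eq[where E="{U. open U}" and \<Omega>=UNIV and A="\<lambda>_. UNIV"])
    show "Int_stable {U::complex set. open U}" by (auto simp: Int_stable_def)
    show "emeasure (distr (P 1) borel cis) (UNIV::complex set) \<noteq> \<infinity>" by (simp add: P_eq)
  qed (use P_open in \<open>auto simp: borel_def\<close>)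
  have "density torus (\<lambda>y. ennreal (g y)) = density torus (\<lambda>y. ennreal (- g y))"
  proof (rule measure_eqI)
    fix S assume "S \<in> sets (density torus (\<lambda>y. ennreal (g y)))"
    then have S: "S \<in> sets torus" by simp
    then have Sb: "S \<in> sets borel" and Ss: "S \<subseteq> {0..<2*pi}"
      unfolding torus_def by (auto simp: sets_restrict_space)
    define B where "B = cis_inverse -` S"
    have B: "B \<in> sets borel" unfolding B_def using measurable_sets[OF cis_inverse_measurable Sb] by simp
    have "cis -` B \<inter> {0..<2*pi} = S" using Ss by (auto simp: B_def cis_inverse_cis)
    then have eq: "emeasure (P s) S = emeasure (distr (P s) borel cis) B" for s
      using B by (subst emeasure_distr) (simp_all add: P_def)
    have "emeasure (P 1) S = emeasure (P (- 1)) S" unfolding eq distr_eq ..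
    then show "emeasure (density torus (\<lambda>y. ennreal (g y))) S = emeasure (density torus (\<lambda>y. ennreal (- g y))) S"
      by (simp add: P_def)
  qed simp
  then show "AE y in torus. g y = 0"
    by (intro AE_zero_if_parts_eq T.sigma_finite_measure_axioms) auto
qed auto

text \<open>The phase space is the product of a line and two circles, on each of which the characters are
  determining.\<close>

theorem fourier_integral_injective:
  assumes W: "integrable phys W" and 0: "\<And>\<zeta>. (\<integral>z. W z * cnj (plane_wave z \<zeta>) \<partial>phys) = 0"
  shows "AE z in phys. W z = 0"
proof -
  have t: "(\<lambda>y. cis (- (y * real_of_int k))) \<in> borel_measurable torus" for k
    by (rule torus_le_borel) measurable
  have sT: "sigma_finite_measure torus" using torus_finite by (rule finite_measure.axioms(1))
  have d: "determining (torus \<Otimes>\<^sub>M torus) (\<lambda>(k1::int, k2::int) z. cis (- (fst z * of_int k1)) * cis (- (snd z * of_int k2)))"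
    using determining_pair[OF sT sT t t _ _ determining_torus determining_torus] by simp
  have "determining phys (\<lambda>(b, k) z. cis (- (fst z * b)) * (case k of (k1::int, k2::int) \<Rightarrow> \<lambda>z. cis (- (fst z * of_int k1)) * cis (- (snd z * of_int k2))) (snd z))"
    unfolding phys_def
  proof (rule determining_pair[OF sigma_finite_lborel sigma_finite_torus2 _ _ _ _ determining_line d])
    show "(case k of (k1::int, k2::int) \<Rightarrow> \<lambda>z. cis (- (fst z * of_int k1)) * cis (- (snd z * of_int k2)))
      \<in> borel_measurable (torus \<Otimes>\<^sub>M torus)" for k
      using borel_measurable_times[OF measurable_compose[OF measurable_fst t] measurable_compose[OF measurable_snd t]]
      by (simp add: split_beta')
  qed (auto simp: norm_mult split: prod.splits)
  moreover have "(\<integral>z. W z * (case bk of (b, k) \<Rightarrow> \<lambda>z. cis (- (fst z * b)) * (case k of (k1::int, k2::int) \<Rightarrow> \<lambda>z. cis (- (fst z * of_int k1)) * cis (- (snd z * of_int k2))) (snd z)) z \<partial>phys) = 0" for bk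
  proof -
    obtain b k1 k2 where bk: "bk = (b, k1, k2)" by (metis prod_cases3)
    show ?thesis using 0[of bk] unfolding bk plane_wave_def
      by (simp add: split_beta' cis_cnj cis_mult algebra_simps)
  qed
  ultimately show ?thesis using W unfolding determining_def by blast
qed

section \<open>The Fourier transform as a closed graph\<close>

lemma has_fourierE:
  assumes "has_fourier f F"
  obtains \<phi> where "f \<in> borel_measurable phys" "L2sq phys f < \<infinity>"
    "F \<in> borel_measurable freq" "L2sq freq F < \<infinity>"
    "\<And>n::nat. integrable phys (\<phi> n)" "\<And>n. \<phi> n \<in> borel_measurable phys" "\<And>n. L2sq phys (\<phi> n) < \<infinity>"
    "(\<lambda>n. L2sq phys (\<lambda>z. \<phi> n z - f z)) \<longlonglongrightarrow> 0"
    "(\<lambda>n. L2sq freq (\<lambda>\<zeta>. fourier_integral (\<phi> n) \<zeta> - F \<zeta>)) \<longlonglongrightarrow> 0"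
  using assms that unfolding has_fourier_def in_L2_iff Lp_norm_2_tendsto_0_iff by blast

lemma fourier_integral_diff:
  assumes "integrable phys f" "integrable phys g"
  shows "fourier_integral (\<lambda>z. f z - g z) \<zeta> = fourier_integral f \<zeta> - fourier_integral g \<zeta>"
proof -
  have i: "integrable phys (\<lambda>z. h z * cnj (plane_wave z \<zeta>))" if h: "integrable phys h" for h
  proof (rule Bochner_Integration.integrable_bound[OF h])
    have [measurable]: "h \<in> borel_measurable phys" by (rule borel_measurable_integrable[OF h])
    show "(\<lambda>z. h z * cnj (plane_wave z \<zeta>)) \<in> borel_measurable phys" by measurable
  qed (simp add: norm_mult)
  show ?thesis
    unfolding fourier_integral_eq using i[OF assms(1)] i[OF assms(2)]
    by (simp add: left_diff_distrib right_diff_distrib)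
qed

lemma tendsto_zero_cmult_ennreal:
  fixes x :: "nat \<Rightarrow> ennreal"
  assumes "x \<longlonglongrightarrow> 0" shows "(\<lambda>n. 2 * x n) \<longlonglongrightarrow> 0"
  using tendsto_mult_ennreal[OF tendsto_const[of 2] assms] by simp

text \<open>The constant 4 comes from using \<open>|a + b|\<^sup>2 \<le> 2 |a|\<^sup>2 + 2 |b|\<^sup>2\<close> instead of the triangle inequality; for
  the upper bound any absolute constant will do.\<close>

lemma has_fourier_norm_le:
  assumes "has_fourier f F"
  shows "L2sq freq F \<le> 4 * L2sq phys f"
proof -
  obtain \<phi> where fm: "f \<in> borel_measurable phys" and f2: "L2sq phys f < \<infinity>"
    and Fm: "F \<in> borel_measurable freq" and F2: "L2sq freq F < \<infinity>"
    and \<phi>1: "\<And>n::nat. integrable phys (\<phi> n)" and \<phi>m: "\<And>n. \<phi> n \<in> borel_measurable phys"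
    and \<phi>2: "\<And>n. L2sq phys (\<phi> n) < \<infinity>"
    and lim1: "(\<lambda>n. L2sq phys (\<lambda>z. \<phi> n z - f z)) \<longlonglongrightarrow> 0"
    and lim2: "(\<lambda>n. L2sq freq (\<lambda>\<zeta>. fourier_integral (\<phi> n) \<zeta> - F \<zeta>)) \<longlonglongrightarrow> 0"
    by (rule has_fourierE[OF assms]) (rule that; simp)
  note [measurable] = fm Fm \<phi>m and \<phi> = \<phi>1 \<phi>2
  note lim = lim1 lim2
  let ?a = "\<lambda>n. L2sq phys (\<lambda>z. \<phi> n z - f z)"
  let ?b = "\<lambda>n. L2sq freq (\<lambda>\<zeta>. fourier_integral (\<phi> n) \<zeta> - F \<zeta>)"
  have "L2sq freq F \<le> 2 * (2 * ?a n) + 2 * ?b n + 4 * L2sq phys f" for n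
  proof -
    have "L2sq freq F \<le> 2 * L2sq freq (fourier_integral (\<phi> n)) + 2 * ?b n"
      using L2sq_diff_le[of "fourier_integral (\<phi> n)" freq "\<lambda>\<zeta>. fourier_integral (\<phi> n) \<zeta> - F \<zeta>"] by simp
    also have "L2sq freq (fourier_integral (\<phi> n)) \<le> L2sq phys (\<phi> n)" by (rule bessel_inequality[OF \<phi>])
    also have "L2sq phys (\<phi> n) \<le> 2 * ?a n + 2 * L2sq phys f"
      using L2sq_add_le[of "\<lambda>z. \<phi> n z - f z" phys f] by simp
    finally have "L2sq freq F \<le> 2 * (2 * ?a n + 2 * L2sq phys f) + 2 * ?b n" by (simp add: mult_left_mono add_right_mono)
    also have "\<dots> = 2 * (2 * ?a n) + 2 * ?b n + 4 * L2sq phys f"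
      by (simp add: distrib_left mult.assoc[symmetric] add_ac)
    finally show ?thesis .
  qed
  moreover have "(\<lambda>n. 2 * (2 * ?a n) + 2 * ?b n + 4 * L2sq phys f) \<longlonglongrightarrow> 0 + 0 + 4 * L2sq phys f"
    by (intro tendsto_add tendsto_zero_cmult_ennreal lim tendsto_const)
  ultimately show ?thesis by (intro LIMSEQ_le_const[where X="\<lambda>n. 2 * (2 * ?a n) + 2 * ?b n + 4 * L2sq phys f"]) auto
qed

text \<open>The approximating sequences for the two transforms have the same limit, so their difference tends
  to zero, and Bessel's inequality carries this to the frequency side.\<close>

lemma has_fourier_unique:
  assumes "has_fourier f F" "has_fourier f F'"
  shows "AE \<zeta> in freq. F \<zeta> = F' \<zeta>"
proof -
  obtain \<phi> where fm: "f \<in> borel_measurable phys" and f2: "L2sq phys f < \<infinity>"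
    and Fm: "F \<in> borel_measurable freq" and F2: "L2sq freq F < \<infinity>"
    and \<phi>1: "\<And>n::nat. integrable phys (\<phi> n)" and \<phi>m: "\<And>n. \<phi> n \<in> borel_measurable phys"
    and \<phi>2: "\<And>n. L2sq phys (\<phi> n) < \<infinity>"
    and lim1: "(\<lambda>n. L2sq phys (\<lambda>z. \<phi> n z - f z)) \<longlonglongrightarrow> 0"
    and lim2: "(\<lambda>n. L2sq freq (\<lambda>\<zeta>. fourier_integral (\<phi> n) \<zeta> - F \<zeta>)) \<longlonglongrightarrow> 0"
    by (rule has_fourierE[OF assms(1)]) (rule that; simp)
  note [measurable] = fm Fm \<phi>m and \<phi> = \<phi>1 \<phi>2
  note lim = lim1 lim2
  obtain \<psi> where fm': "f \<in> borel_measurable phys" and f2': "L2sq phys f < \<infinity>"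
    and Fm': "F' \<in> borel_measurable freq" and F2': "L2sq freq F' < \<infinity>"
    and \<psi>1: "\<And>n::nat. integrable phys (\<psi> n)" and \<psi>m: "\<And>n. \<psi> n \<in> borel_measurable phys"
    and \<psi>2: "\<And>n. L2sq phys (\<psi> n) < \<infinity>"
    and lim1': "(\<lambda>n. L2sq phys (\<lambda>z. \<psi> n z - f z)) \<longlonglongrightarrow> 0"
    and lim2': "(\<lambda>n. L2sq freq (\<lambda>\<zeta>. fourier_integral (\<psi> n) \<zeta> - F' \<zeta>)) \<longlonglongrightarrow> 0"
    by (rule has_fourierE[OF assms(2)]) (rule that; simp)
  note [measurable] = fm' Fm' \<psi>m and \<psi> = \<psi>1 \<psi>2
  note lim' = lim1' lim2'
  let ?a = "\<lambda>n. L2sq phys (\<lambda>z. \<phi> n z - f z)" and ?a' = "\<lambda>n. L2sq phys (\<lambda>z. \<psi> n z - f z)"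
  let ?b = "\<lambda>n. L2sq freq (\<lambda>\<zeta>. fourier_integral (\<phi> n) \<zeta> - F \<zeta>)" and ?b' = "\<lambda>n. L2sq freq (\<lambda>\<zeta>. fourier_integral (\<psi> n) \<zeta> - F' \<zeta>)"
  have "L2sq freq (\<lambda>\<zeta>. F \<zeta> - F' \<zeta>) \<le> 2 * (2 * (2 * ?a n + 2 * ?a' n) + 2 * ?b' n) + 2 * ?b n" for n
  proof -
    have d: "L2sq phys (\<lambda>z. \<phi> n z - \<psi> n z) \<le> 2 * ?a n + 2 * ?a' n"
      using L2sq_diff_le[of "\<lambda>z. \<phi> n z - f z" phys "\<lambda>z. \<psi> n z - f z"] by simp
    also have "\<dots> < \<infinity>"
    proof -
      have "?a n \<le> 2 * L2sq phys (\<phi> n) + 2 * L2sq phys f" "?a' n \<le> 2 * L2sq phys (\<psi> n) + 2 * L2sq phys f"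
        by (rule L2sq_diff_le; measurable)+
      moreover have "2 * L2sq phys (\<phi> n) + 2 * L2sq phys f < \<infinity>" "2 * L2sq phys (\<psi> n) + 2 * L2sq phys f < \<infinity>"
        using f2 \<phi>(2)[of n] \<psi>(2)[of n] by (auto simp: ennreal_mult_less_top)
      ultimately have "?a n < \<infinity>" "?a' n < \<infinity>" by (auto intro: le_less_trans)
      then show ?thesis by (auto simp: ennreal_mult_less_top)
    qed
    finally have fin: "L2sq phys (\<lambda>z. \<phi> n z - \<psi> n z) < \<infinity>" .
    have eq: "(\<lambda>\<zeta>. fourier_integral (\<phi> n) \<zeta> - fourier_integral (\<psi> n) \<zeta>) = fourier_integral (\<lambda>z. \<phi> n z - \<psi> n z)"
      using fourier_integral_diff[OF \<phi>(1) \<psi>(1)] by (auto simp: fun_eq_iff)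
    have "L2sq freq (\<lambda>\<zeta>. fourier_integral (\<phi> n) \<zeta> - fourier_integral (\<psi> n) \<zeta>) \<le> L2sq phys (\<lambda>z. \<phi> n z - \<psi> n z)"
      unfolding eq by (rule bessel_inequality[OF _ fin]) (use \<phi> \<psi> in auto)
    with d have d': "L2sq freq (\<lambda>\<zeta>. fourier_integral (\<phi> n) \<zeta> - fourier_integral (\<psi> n) \<zeta>) \<le> 2 * ?a n + 2 * ?a' n"
      by (rule order_trans[rotated])
    have "L2sq freq (\<lambda>\<zeta>. F \<zeta> - F' \<zeta>) \<le> 2 * L2sq freq (\<lambda>\<zeta>. fourier_integral (\<phi> n) \<zeta> - F' \<zeta>) + 2 * ?b n"
      using L2sq_diff_le[of "\<lambda>\<zeta>. fourier_integral (\<phi> n) \<zeta> - F' \<zeta>" freq "\<lambda>\<zeta>. fourier_integral (\<phi> n) \<zeta> - F \<zeta>"] by simp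
    also have "L2sq freq (\<lambda>\<zeta>. fourier_integral (\<phi> n) \<zeta> - F' \<zeta>) \<le> 2 * L2sq freq (\<lambda>\<zeta>. fourier_integral (\<phi> n) \<zeta> - fourier_integral (\<psi> n) \<zeta>) + 2 * ?b' n"
      using L2sq_add_le[of "\<lambda>\<zeta>. fourier_integral (\<phi> n) \<zeta> - fourier_integral (\<psi> n) \<zeta>" freq "\<lambda>\<zeta>. fourier_integral (\<psi> n) \<zeta> - F' \<zeta>"] by simp
    also note d'
    finally show ?thesis by (simp add: mult_left_mono add_right_mono)
  qed
  moreover have "(\<lambda>n. 2 * (2 * (2 * ?a n + 2 * ?a' n) + 2 * ?b' n) + 2 * ?b n) \<longlonglongrightarrow> 0"
  proof -
    have "(\<lambda>n. 2 * ?a n + 2 * ?a' n) \<longlonglongrightarrow> 0 + 0"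
      by (intro tendsto_add tendsto_zero_cmult_ennreal lim lim')
    then have 1: "(\<lambda>n. 2 * (2 * ?a n + 2 * ?a' n)) \<longlonglongrightarrow> 0" by (intro tendsto_zero_cmult_ennreal) simp
    have "(\<lambda>n. 2 * (2 * ?a n + 2 * ?a' n) + 2 * ?b' n) \<longlonglongrightarrow> 0 + 0"
      by (intro tendsto_add 1 tendsto_zero_cmult_ennreal lim lim')
    then have 2: "(\<lambda>n. 2 * (2 * (2 * ?a n + 2 * ?a' n) + 2 * ?b' n)) \<longlonglongrightarrow> 0" by (intro tendsto_zero_cmult_ennreal) simp
    have "(\<lambda>n. 2 * (2 * (2 * ?a n + 2 * ?a' n) + 2 * ?b' n) + 2 * ?b n) \<longlonglongrightarrow> 0 + 0"
      by (intro tendsto_add 2 tendsto_zero_cmult_ennreal lim lim')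
    then show ?thesis by simp
  qed
  ultimately have "L2sq freq (\<lambda>\<zeta>. F \<zeta> - F' \<zeta>) \<le> 0"
    by (intro LIMSEQ_le_const[where X="\<lambda>n. 2 * (2 * (2 * ?a n + 2 * ?a' n) + 2 * ?b' n) + 2 * ?b n"]) auto
  then have "AE \<zeta> in freq. ennreal ((norm (F \<zeta> - F' \<zeta>))\<^sup>2) = 0"
    unfolding L2sq_def by (subst nn_integral_0_iff_AE[symmetric]) auto
  then show ?thesis by eventually_elim simp
qed

lemma integral_freq_slice:
  fixes F :: "real \<times> int \<times> int \<Rightarrow> complex"
  assumes F: "integrable freq F" and 0: "\<And>\<xi> j. j \<noteq> k \<Longrightarrow> F (\<xi>, j) = 0"
  shows "(\<integral>\<zeta>. F \<zeta> \<partial>freq) = (\<integral>\<xi>. F (\<xi>, k) \<partial>lborel)"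
proof -
  interpret pair_sigma_finite lborel "count_space (UNIV :: (int \<times> int) set)"
    by (intro pair_sigma_finite.intro sigma_finite_lborel sigma_finite_lattice)
  have "(\<integral>\<zeta>. F \<zeta> \<partial>freq) = (\<integral>\<xi>. (\<integral>j. F (\<xi>, j) \<partial>count_space UNIV) \<partial>lborel)"
    using integral_fst'[of F] F unfolding freq_eq by simp
  moreover have "(\<integral>j. F (\<xi>, j) \<partial>count_space UNIV) = F (\<xi>, k)" for \<xi>
  proof -
    have "(\<integral>j. F (\<xi>, j) \<partial>count_space UNIV) = (\<integral>j. indicator {k} j *\<^sub>R F (\<xi>, k) \<partial>count_space UNIV)"
      by (intro Bochner_Integration.integral_cong refl) (auto simp: indicator_def 0)
    also have "\<dots> = F (\<xi>, k)" by simp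
    finally show ?thesis .
  qed
  ultimately show ?thesis by simp
qed

lemma gauss_phys_eq_density:
  "gauss_phys R = density phys (\<lambda>z. ennreal (exp (- (fst z / R)\<^sup>2 / 2)))"
proof -
  have "gauss_phys R = density lborel (\<lambda>x. ennreal (exp (- (x / R)\<^sup>2 / 2))) \<Otimes>\<^sub>M density (torus \<Otimes>\<^sub>M torus) (\<lambda>_. 1)"
    by (simp add: gauss_phys_def gauss_def density_1)
  also have "\<dots> = density phys (\<lambda>z. ennreal (exp (- (fst z / R)\<^sup>2 / 2)))"
    unfolding phys_def
    by (subst pair_measure_density) (simp_all add: density_1 sigma_finite_torus2 split_beta')
  finally show ?thesis .
qed

text \<open>Test functions on the frequency side whose inverse transforms are explicit and integrable: a
  Gaussian on one lattice fibre.\<close>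

definition gaussian_bump :: "real \<times> int \<times> int \<Rightarrow> real \<times> int \<times> int \<Rightarrow> complex" where
  "gaussian_bump \<zeta>0 \<zeta> = complex_of_real (if snd \<zeta> = snd \<zeta>0 then exp (- (fst \<zeta> - fst \<zeta>0)\<^sup>2 / 2) else 0)"

lemma gaussian_bump_measurable [measurable]: "gaussian_bump \<zeta>0 \<in> borel_measurable freq"
  unfolding gaussian_bump_def by measurable

lemma gaussian_bump_nn_integral:
  "(\<integral>\<^sup>+\<zeta>. ennreal (norm (gaussian_bump \<zeta>0 \<zeta>)) \<partial>freq) = ennreal (sqrt (2 * pi))"
proof -
  interpret C: sigma_finite_measure "count_space (UNIV :: (int \<times> int) set)"
    by (rule sigma_finite_lattice)
  have "(\<integral>\<^sup>+\<zeta>. ennreal (norm (gaussian_bump \<zeta>0 \<zeta>)) \<partial>freq)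
    = (\<integral>\<^sup>+\<xi>. (\<integral>\<^sup>+k. ennreal (norm (gaussian_bump \<zeta>0 (\<xi>, k))) \<partial>count_space UNIV) \<partial>lborel)"
    using C.nn_integral_fst[of "\<lambda>\<zeta>. ennreal (norm (gaussian_bump \<zeta>0 \<zeta>))" lborel] gaussian_bump_measurable
    unfolding freq_eq by simp
  also have "\<dots> = (\<integral>\<^sup>+\<xi>. ennreal (exp (- (1 * (\<xi> - fst \<zeta>0))\<^sup>2 / 2)) \<partial>lborel)"
    by (intro nn_integral_cong, subst nn_integral_count_space_delta[of "snd \<zeta>0"]) (auto simp: gaussian_bump_def)
  also have "\<dots> = ennreal (sqrt (2 * pi))"
    using nn_integral_gaussian[of 1 "fst \<zeta>0"] by simp
  finally show ?thesis .
qed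

lemma gaussian_bump_integrable: "integrable freq (gaussian_bump \<zeta>0)"
  using gaussian_bump_nn_integral[of \<zeta>0] by (intro integrableI_bounded) auto

lemma gaussian_bump_L2: "L2sq freq (gaussian_bump \<zeta>0) < \<infinity>"
proof -
  have "L2sq freq (gaussian_bump \<zeta>0) \<le> (\<integral>\<^sup>+\<zeta>. ennreal (norm (gaussian_bump \<zeta>0 \<zeta>)) \<partial>freq)"
    unfolding L2sq_def by (intro nn_integral_mono ennreal_leI) (auto simp: gaussian_bump_def power_le_one_iff power2_eq_square mult_le_one)
  then show ?thesis unfolding gaussian_bump_nn_integral by (rule le_less_trans) simp
qed

lemma gaussian_bump_transform:
  assumes z: "z \<in> space phys"
  shows "(\<integral>\<zeta>. gaussian_bump \<zeta>0 \<zeta> * plane_wave z \<zeta> \<partial>freq) = complex_of_real (sqrt (2 * pi) * exp (- (fst z)\<^sup>2 / 2)) * plane_wave z \<zeta>0"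
proof -
  have pm: "plane_wave z \<in> borel_measurable freq"
    by (rule plane_wave_measurable[OF measurable_const[OF z] measurable_ident_sets[OF refl]])
  have i: "integrable freq (\<lambda>\<zeta>. gaussian_bump \<zeta>0 \<zeta> * plane_wave z \<zeta>)"
    by (rule Bochner_Integration.integrable_bound[OF gaussian_bump_integrable[of \<zeta>0]]) (use pm in \<open>auto simp: norm_mult\<close>)
  obtain x y1 y2 b k1 k2 where zz: "z = (x, y1, y2)" "\<zeta>0 = (b, k1, k2)" by (metis prod_cases3)
  let ?c = "cis (y1 * of_int k1 + y2 * of_int k2)"
  have "(\<integral>\<zeta>. gaussian_bump \<zeta>0 \<zeta> * plane_wave z \<zeta> \<partial>freq) = (\<integral>\<xi>. gaussian_bump \<zeta>0 (\<xi>, snd \<zeta>0) * plane_wave z (\<xi>, snd \<zeta>0) \<partial>lborel)"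
    by (rule integral_freq_slice[OF i]) (simp add: gaussian_bump_def)
  also have "\<dots> = \<bar>1\<bar> *\<^sub>R (\<integral>s. gaussian_bump \<zeta>0 (b + 1 * s, snd \<zeta>0) * plane_wave z (b + 1 * s, snd \<zeta>0) \<partial>lborel)"
    by (rule lborel_integral_real_affine) simp
  also have "\<dots> = (\<integral>s. (exp (- (s / 1)\<^sup>2 / 2) *\<^sub>R cis (s * x)) * plane_wave z \<zeta>0 \<partial>lborel)"
  proof -
    have "plane_wave z (b + 1 * s, snd \<zeta>0) = cis (s * x) * plane_wave z \<zeta>0" for s
      by (simp add: zz plane_wave_def cis_mult algebra_simps)
    moreover have "gaussian_bump \<zeta>0 (b + 1 * s, snd \<zeta>0) = complex_of_real (exp (- (s / 1)\<^sup>2 / 2))" for s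
      by (simp add: gaussian_bump_def zz)
    ultimately show ?thesis by (simp only: scaleR_conv_of_real abs_one of_real_1 mult_1_left mult.assoc)
  qed
  also have "\<dots> = (\<integral>s. exp (- (s / 1)\<^sup>2 / 2) *\<^sub>R cis (s * x) \<partial>lborel) * plane_wave z \<zeta>0"
    by (rule integral_mult_left_zero)
  also have "(\<integral>s. exp (- (s / 1)\<^sup>2 / 2) *\<^sub>R cis (s * x) \<partial>lborel) = (\<integral>s. cis (s * x) \<partial>gauss 1)"
    unfolding gauss_def by (rule integral_density[symmetric]) auto
  finally show ?thesis by (simp add: integral_gauss_cis zz)
qed

text \<open>The inverse transform of a Gaussian bump, conjugated and without its constant factor.\<close>

definition gaussian_packet :: "real \<times> int \<times> int \<Rightarrow> real \<times> real \<times> real \<Rightarrow> complex" where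
  "gaussian_packet \<zeta>0 z = complex_of_real (exp (- (fst z)\<^sup>2 / 2)) * cnj (plane_wave z \<zeta>0)"

lemma gaussian_packet_measurable [measurable]: "gaussian_packet \<zeta>0 \<in> borel_measurable phys"
proof -
  have [measurable]: "\<zeta>0 \<in> space freq" by simp
  show ?thesis unfolding gaussian_packet_def by measurable
qed

lemma gaussian_packet_L2: "L2sq phys (gaussian_packet \<zeta>0) < \<infinity>"
proof -
  have "L2sq phys (gaussian_packet \<zeta>0) \<le> (\<integral>\<^sup>+z. ennreal (exp (- (fst z / 1)\<^sup>2 / 2)) \<partial>phys)"
    unfolding L2sq_def by (intro nn_integral_mono ennreal_leI) (auto simp: gaussian_packet_def norm_mult power2_eq_square mult_le_one exp_ge_zero)
  also have "\<dots> = emeasure (gauss_phys 1) (space (gauss_phys 1))"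
    unfolding gauss_phys_eq_density by (subst emeasure_density) auto
  also have "\<dots> < \<infinity>"
    using finite_measure.emeasure_finite[OF gauss_phys_finite[of 1]] by (simp add: top.not_eq_extremum)
  finally show ?thesis .
qed

lemma gaussian_pairing_fourier_integral:
  assumes f: "integrable phys f"
  shows "(\<integral>\<zeta>. fourier_integral f \<zeta> * gaussian_bump \<zeta>0 \<zeta> \<partial>freq)
    = complex_of_real (fourier_const * sqrt (2 * pi)) * (\<integral>z. f z * gaussian_packet \<zeta>0 z \<partial>phys)"
proof -
  have "(\<integral>\<zeta>. fourier_integral f \<zeta> * gaussian_bump \<zeta>0 \<zeta> \<partial>freq) = (\<integral>\<zeta>. fourier_integral f \<zeta> * cnj (gaussian_bump \<zeta>0 \<zeta>) \<partial>freq)"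
    by (simp add: gaussian_bump_def)
  also have "\<dots> = (\<integral>z. f z * cnj (fourier_inverse (gaussian_bump \<zeta>0) z) \<partial>phys)"
    by (rule fourier_multiplication_formula[OF f gaussian_bump_integrable])
  also have "\<dots> = (\<integral>z. complex_of_real (fourier_const * sqrt (2 * pi)) * (f z * gaussian_packet \<zeta>0 z) \<partial>phys)"
  proof (intro Bochner_Integration.integral_cong refl)
    fix z assume z: "z \<in> space phys"
    have "cnj (fourier_inverse (gaussian_bump \<zeta>0) z) = complex_of_real (fourier_const * sqrt (2 * pi)) * gaussian_packet \<zeta>0 z"
      unfolding fourier_inverse_def gaussian_bump_transform[OF z] gaussian_packet_def by simp
    then show "f z * cnj (fourier_inverse (gaussian_bump \<zeta>0) z) = complex_of_real (fourier_const * sqrt (2 * pi)) * (f z * gaussian_packet \<zeta>0 z)"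
      by (simp only: mult.left_commute)
  qed
  finally show ?thesis by (simp only: integral_mult_right_zero)
qed

text \<open>The Gaussian factor of the packet turns the integral over physical space into one over the damped
  measure, where plane waves are paired by the explicit kernel.\<close>

lemma gaussian_pairing_fourier_inverse:
  assumes G: "integrable freq G"
  shows "complex_of_real (fourier_const * sqrt (2 * pi)) * (\<integral>z. fourier_inverse G z * gaussian_packet \<zeta>0 z \<partial>phys)
    = (\<integral>\<zeta>. G \<zeta> * gaussian_bump \<zeta>0 \<zeta> \<partial>freq)"
proof -
  interpret B: finite_measure "gauss_phys 1" by (rule gauss_phys_finite) simp
  interpret F: sigma_finite_measure freq by (rule sigma_finite_freq)
  interpret P: pair_sigma_finite "gauss_phys 1" freq ..
  have [measurable]: "G \<in> borel_measurable freq" by (rule borel_measurable_integrable[OF G])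
  have [measurable]: "\<zeta>0 \<in> space freq" by simp
  have i: "integrable (gauss_phys 1 \<Otimes>\<^sub>M freq) (\<lambda>(z, \<zeta>). G \<zeta> * (plane_wave z \<zeta> * cnj (plane_wave z \<zeta>0)))"
  proof (rule P.Fubini_integrable)
    show "integrable (gauss_phys 1) (\<lambda>z. \<integral>\<zeta>. norm (case (z, \<zeta>) of (z, \<zeta>) \<Rightarrow> G \<zeta> * (plane_wave z \<zeta> * cnj (plane_wave z \<zeta>0))) \<partial>freq)"
      by (simp add: norm_mult)
    show "AE z in gauss_phys 1. integrable freq (\<lambda>\<zeta>. case (z, \<zeta>) of (z, \<zeta>) \<Rightarrow> G \<zeta> * (plane_wave z \<zeta> * cnj (plane_wave z \<zeta>0)))"
    proof (intro AE_I2)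
      fix z assume "z \<in> space (gauss_phys 1)"
      then have z: "z \<in> space phys" by (simp only: sets_eq_imp_space_eq[OF sets_gauss_phys[of 1]])
      have pm: "plane_wave z \<in> borel_measurable freq"
        by (rule plane_wave_measurable[OF measurable_const[OF z] measurable_ident_sets[OF refl]])
      show "integrable freq (\<lambda>\<zeta>. case (z, \<zeta>) of (z, \<zeta>) \<Rightarrow> G \<zeta> * (plane_wave z \<zeta> * cnj (plane_wave z \<zeta>0)))"
        unfolding split_conv
        by (rule Bochner_Integration.integrable_bound[OF G]) (use pm in \<open>auto simp: norm_mult\<close>)
    qed
  qed measurable
  have "(\<integral>z. fourier_inverse G z * gaussian_packet \<zeta>0 z \<partial>phys) = (\<integral>z. fourier_inverse G z * cnj (plane_wave z \<zeta>0) \<partial>gauss_phys 1)"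
    unfolding gauss_phys_eq_density
    by (subst integral_density) (auto simp: gaussian_packet_def scaleR_conv_of_real mult_ac)
  also have "\<dots> = complex_of_real fourier_const * (\<integral>z. (\<integral>\<zeta>. G \<zeta> * (plane_wave z \<zeta> * cnj (plane_wave z \<zeta>0)) \<partial>freq) \<partial>gauss_phys 1)"
    unfolding fourier_inverse_def
    by (subst integral_mult_right_zero[symmetric]) (simp add: mult.assoc integral_mult_left_zero[symmetric] del: integral_mult_left_zero)
  also have "(\<integral>z. (\<integral>\<zeta>. G \<zeta> * (plane_wave z \<zeta> * cnj (plane_wave z \<zeta>0)) \<partial>freq) \<partial>gauss_phys 1)
     = (\<integral>\<zeta>. (\<integral>z. G \<zeta> * (plane_wave z \<zeta> * cnj (plane_wave z \<zeta>0)) \<partial>gauss_phys 1) \<partial>freq)"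
    by (rule P.Fubini_integral[OF i, symmetric])
  also have "\<dots> = (\<integral>\<zeta>. complex_of_real (sqrt (2 * pi) * (2 * pi)\<^sup>2) * (G \<zeta> * gaussian_bump \<zeta>0 \<zeta>) \<partial>freq)"
    by (intro Bochner_Integration.integral_cong refl)
       (auto simp: gauss_phys_plane_wave_kernel gaussian_bump_def)
  also have "\<dots> = complex_of_real (sqrt (2 * pi) * (2 * pi)\<^sup>2) * (\<integral>\<zeta>. G \<zeta> * gaussian_bump \<zeta>0 \<zeta> \<partial>freq)"
    by (rule integral_mult_right_zero)
  finally have "complex_of_real (fourier_const * sqrt (2 * pi)) * (\<integral>z. fourier_inverse G z * gaussian_packet \<zeta>0 z \<partial>phys)
     = complex_of_real (fourier_const * sqrt (2 * pi) * fourier_const * (sqrt (2 * pi) * (2 * pi)\<^sup>2)) * (\<integral>\<zeta>. G \<zeta> * gaussian_bump \<zeta>0 \<zeta> \<partial>freq)"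
    by (simp only: of_real_mult mult_ac)
  moreover have "fourier_const * sqrt (2 * pi) * fourier_const * (sqrt (2 * pi) * (2 * pi)\<^sup>2) = 1"
  proof -
    have "fourier_const * sqrt (2 * pi) * fourier_const * (sqrt (2 * pi) * (2 * pi)\<^sup>2) = fourier_const\<^sup>2 * (sqrt (2 * pi))\<^sup>2 * (2 * pi)\<^sup>2"
      by (simp only: power2_eq_square mult_ac)
    also have "\<dots> = 1" unfolding fourier_const_square by (simp add: power2_eq_square power3_eq_cube)
    finally show ?thesis .
  qed
  ultimately show ?thesis by (simp only: of_real_1 mult_1_left)
qed

text \<open>Pairings with Gaussian packets are continuous in \<open>L\<^sup>2\<close>, so \<open>g\<close> and the inverse transform of \<open>G\<close>
  have the same pairings with all packets. This says that their difference times a fixed Gaussian, which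
  is an integrable function, has vanishing Fourier transform.\<close>

theorem has_fourier_imp_fourier_inverse:
  assumes fg: "has_fourier g G" and G: "integrable freq G"
  shows "AE z in phys. g z = fourier_inverse G z"
proof -
  obtain \<phi> where gm: "g \<in> borel_measurable phys" and g2: "L2sq phys g < \<infinity>"
    and Gm: "G \<in> borel_measurable freq" and G2: "L2sq freq G < \<infinity>"
    and \<phi>1: "\<And>n::nat. integrable phys (\<phi> n)" and \<phi>m: "\<And>n. \<phi> n \<in> borel_measurable phys"
    and \<phi>2: "\<And>n. L2sq phys (\<phi> n) < \<infinity>"
    and lim1: "(\<lambda>n. L2sq phys (\<lambda>z. \<phi> n z - g z)) \<longlonglongrightarrow> 0"
    and lim2: "(\<lambda>n. L2sq freq (\<lambda>\<zeta>. fourier_integral (\<phi> n) \<zeta> - G \<zeta>)) \<longlonglongrightarrow> 0"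
    by (rule has_fourierE[OF fg]) (rule that; simp)
  note [measurable] = gm Gm \<phi>m and \<phi> = \<phi>1 \<phi>2
  note lim = lim1 lim2
  let ?c = "complex_of_real (fourier_const * sqrt (2 * pi))"
  have c: "?c \<noteq> 0" using fourier_const_pos by simp
  have \<phi>F2: "L2sq freq (fourier_integral (\<phi> n)) < \<infinity>" for n
    using bessel_inequality[OF \<phi>] \<phi>(2) by (rule le_less_trans)
  have h2: "L2sq phys (fourier_inverse G) < \<infinity>"
    using L2sq_fourier_inverse_le[OF G] G2 by (rule le_less_trans)
  have pair: "?c * (\<integral>z. g z * gaussian_packet \<zeta>0 z \<partial>phys) = (\<integral>\<zeta>. G \<zeta> * gaussian_bump \<zeta>0 \<zeta> \<partial>freq)" for \<zeta>0
  proof (rule LIMSEQ_unique)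
    have "(\<lambda>n. \<integral>z. (\<phi> n z - g z) * gaussian_packet \<zeta>0 z \<partial>phys) \<longlonglongrightarrow> 0"
      by (rule L2_mult_integral_tendsto_0[OF _ _ lim(1) gaussian_packet_L2]) measurable
    moreover have "(\<integral>z. (\<phi> n z - g z) * gaussian_packet \<zeta>0 z \<partial>phys)
      = (\<integral>z. \<phi> n z * gaussian_packet \<zeta>0 z \<partial>phys) - (\<integral>z. g z * gaussian_packet \<zeta>0 z \<partial>phys)" for n
      unfolding left_diff_distrib
      by (intro Bochner_Integration.integral_diff integrable_L2_mult gaussian_packet_L2 \<phi> g2) measurable
    ultimately have "(\<lambda>n. \<integral>z. \<phi> n z * gaussian_packet \<zeta>0 z \<partial>phys) \<longlonglongrightarrow> (\<integral>z. g z * gaussian_packet \<zeta>0 z \<partial>phys)"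
      by (simp add: LIM_zero_iff)
    then show "(\<lambda>n. ?c * (\<integral>z. \<phi> n z * gaussian_packet \<zeta>0 z \<partial>phys)) \<longlonglongrightarrow> ?c * (\<integral>z. g z * gaussian_packet \<zeta>0 z \<partial>phys)"
      by (intro tendsto_mult tendsto_const)
    have "(\<lambda>n. \<integral>\<zeta>. (fourier_integral (\<phi> n) \<zeta> - G \<zeta>) * gaussian_bump \<zeta>0 \<zeta> \<partial>freq) \<longlonglongrightarrow> 0"
      by (rule L2_mult_integral_tendsto_0[OF _ _ lim(2) gaussian_bump_L2]) measurable
    moreover have "(\<integral>\<zeta>. (fourier_integral (\<phi> n) \<zeta> - G \<zeta>) * gaussian_bump \<zeta>0 \<zeta> \<partial>freq)
      = (\<integral>\<zeta>. fourier_integral (\<phi> n) \<zeta> * gaussian_bump \<zeta>0 \<zeta> \<partial>freq) - (\<integral>\<zeta>. G \<zeta> * gaussian_bump \<zeta>0 \<zeta> \<partial>freq)" for n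
      unfolding left_diff_distrib
      by (intro Bochner_Integration.integral_diff integrable_L2_mult gaussian_bump_L2 \<phi>F2 G2) measurable
    ultimately show "(\<lambda>n. ?c * (\<integral>z. \<phi> n z * gaussian_packet \<zeta>0 z \<partial>phys)) \<longlonglongrightarrow> (\<integral>\<zeta>. G \<zeta> * gaussian_bump \<zeta>0 \<zeta> \<partial>freq)"
      unfolding gaussian_pairing_fourier_integral[OF \<phi>(1), symmetric] by (simp add: LIM_zero_iff)
  qed
  \<comment> \<open>The Gaussian makes the square-integrable difference integrable.\<close>
  define W where "W z = (g z - fourier_inverse G z) * complex_of_real (exp (- (fst z)\<^sup>2 / 2))" for z
  have e2: "L2sq phys (\<lambda>z. complex_of_real (exp (- (fst z)\<^sup>2 / 2))) < \<infinity>"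
    using gaussian_packet_L2[of "(0, 0, 0)"] by (simp add: L2sq_def gaussian_packet_def norm_mult)
  have Wi: "integrable phys W"
  proof -
    have "L2sq phys (\<lambda>z. g z - fourier_inverse G z) \<le> 2 * L2sq phys g + 2 * L2sq phys (fourier_inverse G)"
      by (rule L2sq_diff_le) measurable
    also have "\<dots> < \<infinity>" using g2 h2 by (auto simp: ennreal_mult_less_top)
    finally show ?thesis unfolding W_def by (intro integrable_L2_mult e2) measurable
  qed
  have "AE z in phys. W z = 0"
  proof (rule fourier_integral_injective[OF Wi])
    fix \<zeta>0
    have "(\<integral>z. W z * cnj (plane_wave z \<zeta>0) \<partial>phys)
      = (\<integral>z. g z * gaussian_packet \<zeta>0 z - fourier_inverse G z * gaussian_packet \<zeta>0 z \<partial>phys)"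
      by (intro Bochner_Integration.integral_cong refl) (simp add: W_def gaussian_packet_def algebra_simps)
    also have "\<dots> = (\<integral>z. g z * gaussian_packet \<zeta>0 z \<partial>phys) - (\<integral>z. fourier_inverse G z * gaussian_packet \<zeta>0 z \<partial>phys)"
      by (intro Bochner_Integration.integral_diff integrable_L2_mult gaussian_packet_L2 g2 h2) measurable
    finally have "?c * (\<integral>z. W z * cnj (plane_wave z \<zeta>0) \<partial>phys) = 0"
      using pair[of \<zeta>0] gaussian_pairing_fourier_inverse[OF G, of \<zeta>0] by (simp only: right_diff_distrib diff_self)
    then show "(\<integral>z. W z * cnj (plane_wave z \<zeta>0) \<partial>phys) = 0" using c by simp
  qed
  then show ?thesis by eventually_elim (simp add: W_def)
qed

section \<open>Plancherel's identity for continuous spectra\<close>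

lemma integral_std_gaussian: "(\<integral>s. exp (- s\<^sup>2 / 2) \<partial>lborel) = sqrt (2 * pi)"
  using nn_integral_gaussian[of 1 0] by (intro integral_eq_nn_integral[THEN trans]) auto

lemma integrable_norm_square_bounded:
  assumes G: "integrable M G" and b: "\<And>\<zeta>. norm (G \<zeta>) \<le> b"
  shows "integrable M (\<lambda>\<zeta>. (norm (G \<zeta> :: complex))\<^sup>2)"
proof (rule Bochner_Integration.integrable_bound)
  have [measurable]: "G \<in> borel_measurable M" by (rule borel_measurable_integrable[OF G])
  show "(\<lambda>\<zeta>. (norm (G \<zeta>))\<^sup>2) \<in> borel_measurable M" by measurable
  show "integrable M (\<lambda>\<zeta>. b * norm (G \<zeta>))" using G by simp
  have "(norm (G \<zeta>))\<^sup>2 \<le> b * norm (G \<zeta>)" for \<zeta>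
    unfolding power2_eq_square by (intro mult_right_mono b) simp
  then show "AE \<zeta> in M. norm ((norm (G \<zeta>))\<^sup>2) \<le> norm (b * norm (G \<zeta>))"
    by (auto intro: order_trans[OF _ abs_ge_self])
qed

text \<open>In the identity for \<open>T T\<^sup>*\<close> the damped kernel is an approximate identity of total mass
  \<open>(2 \<pi>)\<^sup>3\<close>. Continuity of the spectrum in \<open>\<xi>\<close> gives pointwise convergence, and boundedness gives domination.\<close>

theorem plancherel_continuous:
  assumes G: "integrable freq G" and b: "\<And>\<zeta>. norm (G \<zeta>) \<le> b"
    and cont: "\<And>k. continuous_on UNIV (\<lambda>\<xi>. G (\<xi>, k))"
  shows "L2sq phys (fourier_inverse G) = L2sq freq G"
proof -
  interpret F: sigma_finite_measure freq by (rule sigma_finite_freq)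
  have Gm[measurable]: "G \<in> borel_measurable freq" by (rule borel_measurable_integrable[OF G])
  have b0: "b \<ge> 0" using b[of undefined] norm_ge_zero order_trans by blast
  have Gk[measurable]: "(\<lambda>\<xi>. G (\<xi>, k)) \<in> borel_measurable borel" for k
    using cont by (rule borel_measurable_continuous_onI)
  define f where "f z = (\<integral>\<zeta>. G \<zeta> * plane_wave z \<zeta> \<partial>freq)" for z
  have fm[measurable]: "f \<in> borel_measurable phys" unfolding f_def by measurable
  define c where "c = sqrt (2 * pi) * (2 * pi)\<^sup>2"
  have c0: "c \<ge> 0" by (simp add: c_def)
  define J where "J n p = (\<integral>s. cnj (G (fst p + s / real (Suc n), snd p)) * complex_of_real (exp (- s\<^sup>2 / 2)) \<partial>lborel)" for n :: nat and p
  have gi: "integrable lborel (\<lambda>s. b * exp (- s\<^sup>2 / 2))"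
    using integrable_gaussian[of 1 0] by simp
  have Jb: "norm (J n p) \<le> b * sqrt (2 * pi)" for n p
  proof -
    have "norm (J n p) \<le> (\<integral>s. norm (cnj (G (fst p + s / real (Suc n), snd p)) * complex_of_real (exp (- s\<^sup>2 / 2))) \<partial>lborel)"
      unfolding J_def by (rule integral_norm_bound)
    also have "\<dots> \<le> (\<integral>s. b * exp (- s\<^sup>2 / 2) \<partial>lborel)"
      by (rule integral_mono'[OF gi]) (use b b0 in \<open>auto simp: norm_mult intro!: mult_right_mono\<close>)
    finally have "norm (J n p) \<le> (\<integral>s. b * exp (- s\<^sup>2 / 2) \<partial>lborel)" .
    then show ?thesis by (simp only: integral_mult_right_zero integral_std_gaussian)
  qed
  have Jlim: "(\<lambda>n. J n p) \<longlonglongrightarrow> cnj (G p) * complex_of_real (sqrt (2 * pi))" for p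
  proof -
    have "(\<lambda>n. J n p) \<longlonglongrightarrow> (\<integral>s. cnj (G p) * complex_of_real (exp (- s\<^sup>2 / 2)) \<partial>lborel)"
      unfolding J_def
    proof (rule integral_dominated_convergence[where w="\<lambda>s. b * exp (- s\<^sup>2 / 2)"])
      show "AE s in lborel. (\<lambda>n. cnj (G (fst p + s / real (Suc n), snd p)) * complex_of_real (exp (- s\<^sup>2 / 2)))
         \<longlonglongrightarrow> cnj (G p) * complex_of_real (exp (- s\<^sup>2 / 2))"
      proof (intro AE_I2 tendsto_mult tendsto_cnj tendsto_const)
        fix s
        have l: "(\<lambda>n. fst p + s / real (Suc n)) \<longlonglongrightarrow> fst p + 0"
          by (intro tendsto_add tendsto_const LIMSEQ_Suc[OF lim_const_over_n])
        have "isCont (\<lambda>\<xi>. G (\<xi>, snd p)) (fst p)"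
          using cont by (simp add: continuous_on_eq_continuous_at)
        from isCont_tendsto_compose[OF this] l
        show "(\<lambda>n. G (fst p + s / real (Suc n), snd p)) \<longlonglongrightarrow> G p" by simp
      qed
      show "AE s in lborel. norm (cnj (G (fst p + s / real (Suc n), snd p)) * complex_of_real (exp (- s\<^sup>2 / 2))) \<le> b * exp (- s\<^sup>2 / 2)" for n
        by (auto simp: norm_mult intro!: mult_right_mono b)
    qed (use gi in simp_all)
    also have "(\<integral>s. cnj (G p) * complex_of_real (exp (- s\<^sup>2 / 2)) \<partial>lborel) = cnj (G p) * complex_of_real (sqrt (2 * pi))"
      by (simp only: integral_mult_right_zero integral_complex_of_real integral_std_gaussian)
    finally show ?thesis .
  qed
  have inner: "(\<integral>p'. cnj (G p') * (\<integral>z. plane_wave z p * cnj (plane_wave z p') \<partial>gauss_phys (real (Suc n))) \<partial>freq) = complex_of_real c * J n p" for n p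
  proof -
    define R where "R = real (Suc n)"
    have R: "R > 0" by (simp add: R_def)
    define k where "k p' = complex_of_real (R * sqrt (2 * pi) * exp (- (R * (fst p - fst p'))\<^sup>2 / 2) *
        (if snd p = snd p' then (2 * pi)\<^sup>2 else 0))" for p' :: "real \<times> int \<times> int"
    have km[measurable]: "k \<in> borel_measurable freq" unfolding k_def by measurable
    have kb: "norm (k p') \<le> R * c" for p'
      using R unfolding k_def norm_of_real by (auto simp: c_def abs_mult intro!: mult_left_le)
    have ki: "integrable freq (\<lambda>p'. cnj (G p') * k p')"
    proof (rule Bochner_Integration.integrable_bound)
      show "integrable freq (\<lambda>p'. R * c * norm (G p'))" using G by simp
      have "norm (cnj (G p') * k p') \<le> R * c * norm (G p')" for p'
        using mult_right_mono[OF kb[of p'], of "norm (G p')"] by (simp add: norm_mult mult.commute)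
      then show "AE p' in freq. norm (cnj (G p') * k p') \<le> norm (R * c * norm (G p'))"
        by (intro AE_I2) (smt (verit) real_norm_def)
    qed measurable
    have "(\<integral>p'. cnj (G p') * (\<integral>z. plane_wave z p * cnj (plane_wave z p') \<partial>gauss_phys R) \<partial>freq) = (\<integral>p'. cnj (G p') * k p' \<partial>freq)"
      by (simp only: gauss_phys_plane_wave_kernel[OF R] k_def)
    also have "\<dots> = (\<integral>\<xi>'. cnj (G (\<xi>', snd p)) * k (\<xi>', snd p) \<partial>lborel)"
      by (rule integral_freq_slice[OF ki]) (simp add: k_def)
    also have "\<dots> = \<bar>1 / R\<bar> *\<^sub>R (\<integral>s. cnj (G (fst p + 1 / R * s, snd p)) * k (fst p + 1 / R * s, snd p) \<partial>lborel)"
      using R by (intro lborel_integral_real_affine) simp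
    also have "\<dots> = complex_of_real (1 / R) * (\<integral>s. complex_of_real (R * c) * (cnj (G (fst p + s / R, snd p)) * complex_of_real (exp (- s\<^sup>2 / 2))) \<partial>lborel)"
    proof -
      have "k (fst p + 1 / R * s, snd p) = complex_of_real (R * c) * complex_of_real (exp (- s\<^sup>2 / 2))" for s
        using R by (simp add: k_def c_def)
      then show ?thesis using R by (simp add: scaleR_conv_of_real mult_ac)
    qed
    also have "\<dots> = complex_of_real c * J n p"
      unfolding J_def R_def[symmetric] integral_mult_right_zero using R by simp
    finally show ?thesis unfolding R_def .
  qed
  have int2: "integrable freq (\<lambda>p. (norm (G p))\<^sup>2)" by (rule integrable_norm_square_bounded[OF G b])
  have JM: "J n \<in> borel_measurable freq" for n
  proof -
    have "(\<lambda>x. G (fst (fst x) + snd x / real (Suc n), snd (fst x))) \<in> borel_measurable (freq \<Otimes>\<^sub>M lborel)"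
    proof (rule measurable_compose[OF _ Gm])
      show "(\<lambda>x. (fst (fst x) + snd x / real (Suc n), snd (fst x))) \<in> measurable (freq \<Otimes>\<^sub>M lborel) freq"
        unfolding freq_eq by measurable
    qed
    then show ?thesis unfolding J_def by measurable
  qed
  have "(\<lambda>n. \<integral>p. G p * (complex_of_real c * J n p) \<partial>freq) \<longlonglongrightarrow> (\<integral>p. G p * (complex_of_real c * (cnj (G p) * complex_of_real (sqrt (2 * pi)))) \<partial>freq)"
  proof (rule integral_dominated_convergence)
    show "integrable freq (\<lambda>p. norm (G p) * (c * (b * sqrt (2 * pi))))" using G by simp
    show "AE p in freq. (\<lambda>n. G p * (complex_of_real c * J n p)) \<longlonglongrightarrow> G p * (complex_of_real c * (cnj (G p) * complex_of_real (sqrt (2 * pi))))"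
      by (intro AE_I2 tendsto_mult tendsto_const Jlim)
    show "AE p in freq. norm (G p * (complex_of_real c * J n p)) \<le> norm (G p) * (c * (b * sqrt (2 * pi)))" for n
      using c0 Jb by (intro AE_I2) (auto simp: norm_mult intro!: mult_left_mono)
  qed (use JM in measurable)
  also have "(\<integral>p. G p * (complex_of_real c * (cnj (G p) * complex_of_real (sqrt (2 * pi)))) \<partial>freq)
     = (\<integral>p. complex_of_real (c * sqrt (2 * pi)) * complex_of_real ((norm (G p))\<^sup>2) \<partial>freq)"
    unfolding complex_norm_square by (intro Bochner_Integration.integral_cong refl) (simp add: mult_ac)
  also have "\<dots> = complex_of_real (c * sqrt (2 * pi) * (\<integral>p. (norm (G p))\<^sup>2 \<partial>freq))"
    by (simp only: integral_mult_right_zero integral_complex_of_real of_real_mult)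
  also have "c * sqrt (2 * pi) = (2 * pi)^3"
    by (simp add: c_def power2_eq_square power3_eq_cube)
  also have "(\<lambda>n. \<integral>p. G p * (complex_of_real c * J n p) \<partial>freq)
      = (\<lambda>n. complex_of_real (\<integral>z. (norm (f z))\<^sup>2 \<partial>gauss_phys (real (Suc n))))"
    unfolding f_def
    by (intro ext, subst TTstar_identity[OF sigma_finite_freq gauss_phys_finite plane_wave_measurable_gauss_phys _ G])
       (simp_all add: inner del: of_nat_Suc)
  finally have lim: "(\<lambda>n. \<integral>z. (norm (f z))\<^sup>2 \<partial>gauss_phys (real (Suc n))) \<longlonglongrightarrow> (2 * pi)^3 * (\<integral>p. (norm (G p))\<^sup>2 \<partial>freq)"
    by (simp only: tendsto_of_real_iff)
  have fb: "norm (f z) \<le> (\<integral>\<zeta>. norm (G \<zeta>) \<partial>freq)" for z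
    unfolding f_def by (rule norm_integral_mult_le[OF G]) simp
  have L: "L2sq (gauss_phys (real (Suc n))) f = ennreal (\<integral>z. (norm (f z))\<^sup>2 \<partial>gauss_phys (real (Suc n)))" for n
  proof (rule L2sq_eq_integral, rule finite_measure.integrable_const_bound[where B="(\<integral>\<zeta>. norm (G \<zeta>) \<partial>freq)\<^sup>2"])
    show "finite_measure (gauss_phys (real (Suc n)))" by (rule gauss_phys_finite) simp
    show "AE z in gauss_phys (real (Suc n)). norm ((norm (f z))\<^sup>2) \<le> (\<integral>\<zeta>. norm (G \<zeta>) \<partial>freq)\<^sup>2"
      using fb by (auto intro!: power_mono)
  qed measurable
  have "L2sq phys f = ennreal ((2 * pi)^3 * (\<integral>p. (norm (G p))\<^sup>2 \<partial>freq))"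
  proof (rule LIMSEQ_unique)
    show "(\<lambda>n. L2sq (gauss_phys (real (Suc n))) f) \<longlonglongrightarrow> L2sq phys f"
      unfolding L2sq_phys_eq_SUP(1)[OF fm] by (rule LIMSEQ_SUP[OF L2sq_phys_eq_SUP(2)[OF fm]])
    show "(\<lambda>n. L2sq (gauss_phys (real (Suc n))) f) \<longlonglongrightarrow> ennreal ((2 * pi)^3 * (\<integral>p. (norm (G p))\<^sup>2 \<partial>freq))"
      unfolding L by (rule tendsto_ennrealI[OF lim])
  qed
  then have "L2sq phys (fourier_inverse G) = ennreal (fourier_const\<^sup>2) * ennreal ((2 * pi)^3 * (\<integral>p. (norm (G p))\<^sup>2 \<partial>freq))"
    unfolding fourier_inverse_def f_def[symmetric] by (subst L2sq_cmult) auto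
  also have "\<dots> = ennreal (\<integral>p. (norm (G p))\<^sup>2 \<partial>freq)"
    by (subst ennreal_mult[symmetric]) (auto simp: fourier_const_square)
  also have "\<dots> = L2sq freq G" by (rule L2sq_eq_integral[OF int2, symmetric])
  finally show ?thesis .
qed

text \<open>Cutting \<open>f = fourier_inverse G\<close> off to \<open>|x| \<le> n\<close> gives integrable functions \<open>\<phi>\<^sub>n\<close>. By Bessel's
  inequality and duality, \<open>\<parallel>F \<phi>\<^sub>n - G\<parallel>\<^sup>2 \<le> \<parallel>\<phi>\<^sub>n\<parallel>\<^sup>2 - 2 \<parallel>\<phi>\<^sub>n\<parallel>\<^sup>2 + \<parallel>G\<parallel>\<^sup>2\<close>, and this tends to zero exactly when
  Plancherel's identity holds for \<open>G\<close>.\<close>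

theorem has_fourier_fourier_inverse:
  assumes G: "integrable freq G" and G2: "L2sq freq G < \<infinity>"
    and eq: "L2sq phys (fourier_inverse G) = L2sq freq G"
  shows "has_fourier (fourier_inverse G) G"
proof -
  have Gm[measurable]: "G \<in> borel_measurable freq" by (rule borel_measurable_integrable[OF G])
  define f where "f = fourier_inverse G"
  have fm[measurable]: "f \<in> borel_measurable phys" unfolding f_def by measurable
  have f2: "L2sq phys f < \<infinity>" using eq G2 by (simp add: f_def)
  define b where "b = fourier_const * (\<integral>\<zeta>. norm (G \<zeta>) \<partial>freq)"
  have fb: "norm (f z) \<le> b" for z unfolding f_def b_def by (rule norm_fourier_inverse_le[OF G])
  have b0: "b \<ge> 0" using fb[of undefined] norm_ge_zero order_trans by blast
  define \<phi> where "\<phi> n z = f z * indicator {z. \<bar>fst z\<bar> \<le> real n} z" for n :: nat and z :: "real \<times> real \<times> real"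
  have ind[measurable]: "(\<lambda>z. indicator {z. \<bar>fst z\<bar> \<le> real n} z :: complex) \<in> borel_measurable phys" for n
    unfolding indicator_def mem_Collect_eq by measurable
  have \<phi>m[measurable]: "\<phi> n \<in> borel_measurable phys" for n unfolding \<phi>_def by measurable
  have \<phi>le: "norm (\<phi> n z) \<le> norm (f z)" for n z by (simp add: \<phi>_def indicator_def)
  have \<phi>2: "L2sq phys (\<phi> n) < \<infinity>" for n
    using L2sq_mono[of phys "\<phi> n" f] \<phi>le f2 by (auto intro: le_less_trans)
  have \<phi>i: "integrable phys (\<phi> n)" for n
  proof (rule integrableI_bounded_set[where A="{- real n..real n} \<times> space (torus \<Otimes>\<^sub>M torus)" and B=b])
    interpret T: finite_measure "torus \<Otimes>\<^sub>M torus" by (rule torus2_finite)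
    show "{- real n..real n} \<times> space (torus \<Otimes>\<^sub>M torus) \<in> sets phys"
      unfolding phys_def by (intro pair_measureI) auto
    have "emeasure phys ({- real n..real n} \<times> space (torus \<Otimes>\<^sub>M torus)) = emeasure lborel {- real n..real n} * emeasure (torus \<Otimes>\<^sub>M torus) (space (torus \<Otimes>\<^sub>M torus))"
      unfolding phys_def by (rule T.emeasure_pair_measure_Times) auto
    also have "\<dots> < \<infinity>"
      using T.emeasure_finite[of "space (torus \<Otimes>\<^sub>M torus)"]
      by (simp add: ennreal_mult_eq_top_iff less_top[symmetric])
    finally show "emeasure phys ({- real n..real n} \<times> space (torus \<Otimes>\<^sub>M torus)) < \<infinity>" .
    show "AE z in phys. z \<notin> {- real n..real n} \<times> space (torus \<Otimes>\<^sub>M torus) \<longrightarrow> \<phi> n z = 0"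
      by (intro AE_I2) (auto simp: \<phi>_def space_phys space_pair_measure indicator_def)
    show "AE z\<in>{- real n..real n} \<times> space (torus \<Otimes>\<^sub>M torus) in phys. norm (\<phi> n z) \<le> b"
      by (intro AE_I2 impI order_trans[OF \<phi>le fb])
  qed measurable
  have fi: "integrable phys (\<lambda>z. (norm (f z))\<^sup>2)" by (rule integrable_square_norm[OF fm f2])
  have Gi: "integrable freq (\<lambda>\<zeta>. (norm (G \<zeta>))\<^sup>2)" by (rule integrable_square_norm[OF Gm G2])
  have \<phi>i2: "integrable phys (\<lambda>z. (norm (\<phi> n z))\<^sup>2)" for n by (rule integrable_square_norm[OF \<phi>m \<phi>2])
  have Fm[measurable]: "fourier_integral (\<phi> n) \<in> borel_measurable freq" for n by measurable
  have F2: "L2sq freq (fourier_integral (\<phi> n)) < \<infinity>" for n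
    using bessel_inequality[OF \<phi>i \<phi>2] \<phi>2 by (rule le_less_trans)
  have Fi: "integrable freq (\<lambda>\<zeta>. (norm (fourier_integral (\<phi> n) \<zeta>))\<^sup>2)" for n by (rule integrable_square_norm[OF Fm F2])
  define L where "L = (\<integral>z. (norm (f z))\<^sup>2 \<partial>phys)"
  define B where "B n = (\<integral>z. (norm (\<phi> n z))\<^sup>2 \<partial>phys)" for n
  have LG: "(\<integral>\<zeta>. (norm (G \<zeta>))\<^sup>2 \<partial>freq) = L"
    using eq unfolding f_def[symmetric] L2sq_eq_integral[OF fi] L2sq_eq_integral[OF Gi] L_def by simp
  have Blim: "(\<lambda>n. L - B n) \<longlonglongrightarrow> 0"
  proof -
    have "B \<longlonglongrightarrow> L" unfolding B_def[abs_def] L_def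
    proof (rule integral_dominated_convergence[OF _ _ fi])
      show "AE z in phys. (\<lambda>n. (norm (\<phi> n z))\<^sup>2) \<longlonglongrightarrow> (norm (f z))\<^sup>2"
      proof (intro AE_I2 tendsto_eventually)
        fix z :: "real \<times> real \<times> real"
        obtain m :: nat where m: "\<bar>fst z\<bar> \<le> real m" using real_arch_simple by blast
        have "(norm (\<phi> n z))\<^sup>2 = (norm (f z))\<^sup>2" if "n \<ge> m" for n
        proof -
          have "\<bar>fst z\<bar> \<le> real n" using m that by linarith
          then show ?thesis by (simp add: \<phi>_def)
        qed
        then show "\<forall>\<^sub>F n in sequentially. (norm (\<phi> n z))\<^sup>2 = (norm (f z))\<^sup>2" by (auto simp: eventually_sequentially)
      qed
      show "AE z in phys. norm ((norm (\<phi> n z))\<^sup>2) \<le> (norm (f z))\<^sup>2" for n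
        using \<phi>le by (auto intro!: power_mono)
    qed measurable
    then have "(\<lambda>n. L - B n) \<longlonglongrightarrow> L - L" by (intro tendsto_intros)
    then show ?thesis by simp
  qed
  have 1: "L2sq phys (\<lambda>z. \<phi> n z - f z) = ennreal (L - B n)" for n
  proof -
    have pw: "(norm (\<phi> n z - f z))\<^sup>2 = (norm (f z))\<^sup>2 - (norm (\<phi> n z))\<^sup>2" for z
      by (simp add: \<phi>_def indicator_def)
    have "L2sq phys (\<lambda>z. \<phi> n z - f z) = ennreal (\<integral>z. (norm (f z))\<^sup>2 - (norm (\<phi> n z))\<^sup>2 \<partial>phys)"
      unfolding pw[symmetric] by (rule L2sq_eq_integral) (use fi \<phi>i2 in \<open>simp add: pw\<close>)
    then show ?thesis using fi \<phi>i2 by (simp add: L_def B_def)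
  qed
  have 2: "L2sq freq (\<lambda>\<zeta>. fourier_integral (\<phi> n) \<zeta> - G \<zeta>) \<le> ennreal (L - B n)" for n
  proof -
    let ?F = "fourier_integral (\<phi> n)"
    have FG: "integrable freq (\<lambda>\<zeta>. ?F \<zeta> * cnj (G \<zeta>))"
      by (rule integrable_L2_mult) (use F2 G2 in \<open>auto simp: L2sq_def\<close>)
    have "(\<integral>\<zeta>. ?F \<zeta> * cnj (G \<zeta>) \<partial>freq) = (\<integral>z. \<phi> n z * cnj (f z) \<partial>phys)"
      unfolding f_def by (rule fourier_multiplication_formula[OF \<phi>i G])
    also have "\<dots> = (\<integral>z. complex_of_real ((norm (\<phi> n z))\<^sup>2) \<partial>phys)"
      unfolding complex_norm_square by (intro Bochner_Integration.integral_cong refl) (simp add: \<phi>_def indicator_def)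
    finally have pair: "(\<integral>\<zeta>. Re (?F \<zeta> * cnj (G \<zeta>)) \<partial>freq) = B n"
      unfolding Bochner_Integration.integral_Re[OF FG] by (simp only: integral_complex_of_real B_def Re_complex_of_real)
    have pw: "(norm (?F \<zeta> - G \<zeta>))\<^sup>2 = (norm (?F \<zeta>))\<^sup>2 - 2 * Re (?F \<zeta> * cnj (G \<zeta>)) + (norm (G \<zeta>))\<^sup>2" for \<zeta>
      unfolding cmod_power2 by (simp add: power2_eq_square algebra_simps)
    have "L2sq freq (\<lambda>\<zeta>. ?F \<zeta> - G \<zeta>) = ennreal (\<integral>\<zeta>. (norm (?F \<zeta>))\<^sup>2 - 2 * Re (?F \<zeta> * cnj (G \<zeta>)) + (norm (G \<zeta>))\<^sup>2 \<partial>freq)"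
    proof -
      have "integrable freq (\<lambda>\<zeta>. (norm (?F \<zeta> - G \<zeta>))\<^sup>2)"
        unfolding pw by (intro Bochner_Integration.integrable_add Bochner_Integration.integrable_diff
            integrable_mult_right Fi Gi integrable_Re FG)
      from L2sq_eq_integral[OF this] show ?thesis unfolding pw .
    qed
    also have "(\<integral>\<zeta>. (norm (?F \<zeta>))\<^sup>2 - 2 * Re (?F \<zeta> * cnj (G \<zeta>)) + (norm (G \<zeta>))\<^sup>2 \<partial>freq)
      = (\<integral>\<zeta>. (norm (?F \<zeta>))\<^sup>2 \<partial>freq) - 2 * (\<integral>\<zeta>. Re (?F \<zeta> * cnj (G \<zeta>)) \<partial>freq) + L"
    proof -
      have "integrable freq (\<lambda>\<zeta>. Re (?F \<zeta> * cnj (G \<zeta>)))" using FG by (rule integrable_Re)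
      then show ?thesis using Fi[of n] Gi LG by (simp del: times_complex.sel)
    qed
    also have "ennreal \<dots> \<le> ennreal (L - B n)"
    proof (rule ennreal_leI)
      have "ennreal (\<integral>\<zeta>. (norm (?F \<zeta>))\<^sup>2 \<partial>freq) \<le> ennreal (B n)"
        using bessel_inequality[OF \<phi>i \<phi>2, of n] unfolding L2sq_eq_integral[OF Fi] L2sq_eq_integral[OF \<phi>i2] B_def .
      then have "(\<integral>\<zeta>. (norm (?F \<zeta>))\<^sup>2 \<partial>freq) \<le> B n" by (simp add: B_def)
      then show "(\<integral>\<zeta>. (norm (?F \<zeta>))\<^sup>2 \<partial>freq) - 2 * (\<integral>\<zeta>. Re (?F \<zeta> * cnj (G \<zeta>)) \<partial>freq) + L \<le> L - B n"
        unfolding pair by simp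
    qed
    finally show ?thesis .
  qed
  have lim0: "(\<lambda>n. ennreal (L - B n)) \<longlonglongrightarrow> 0" using tendsto_ennrealI[OF Blim] by simp
  have "(\<lambda>n. L2sq freq (\<lambda>\<zeta>. fourier_integral (\<phi> n) \<zeta> - G \<zeta>)) \<longlonglongrightarrow> 0"
    by (rule tendsto_sandwich[OF always_eventually always_eventually tendsto_const lim0]) (use 2 in auto)
  moreover have "(\<lambda>n. L2sq phys (\<lambda>z. \<phi> n z - f z)) \<longlonglongrightarrow> 0" unfolding 1 by (rule lim0)
  ultimately show ?thesis
    unfolding has_fourier_def in_L2_iff Lp_norm_2_tendsto_0_iff f_def[symmetric]
    using \<phi>i \<phi>2 \<phi>m f2 G2 by (intro conjI exI[of _ \<phi>]) auto
qed

section \<open>Counting near-resonances of the indefinite form\<close>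

text \<open>A smooth version of the measure of \<open>{d. |2 d\<^sup>2 - \<sigma>| \<le> 1}\<close>, where the Gaussian arises from the weight in
  time.\<close>

definition resonance :: "real \<Rightarrow> ennreal" where
  "resonance \<sigma> = (\<integral>\<^sup>+d. ennreal (exp (- (2 * d\<^sup>2 - \<sigma>)\<^sup>2 / 2)) \<partial>lborel)"

text \<open>The factor \<open>exp (3 / 2)\<close> comes from the range \<open>|\<sigma>| \<le> 1\<close>, where the Gaussian of \<open>2 d\<^sup>2 - \<sigma>\<close> is
  compared with a Gaussian of \<open>d\<close>.\<close>

definition resonance_const :: real where "resonance_const = 2 * exp (3 / 2) * sqrt (2 * pi)"

lemma resonance_const_pos: "resonance_const > 0" by (simp add: resonance_const_def)

lemma sqrt_2pi_le_resonance_const: "2 * sqrt (2 * pi) \<le> resonance_const"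
proof -
  have "1 \<le> exp (3 / 2 :: real)" by simp
  then have "2 * sqrt (2 * pi) * 1 \<le> 2 * sqrt (2 * pi) * exp (3 / 2)" by (intro mult_left_mono) auto
  then show ?thesis by (simp add: resonance_const_def mult_ac)
qed

text \<open>For \<open>\<sigma> = 2 r\<^sup>2 > 0\<close> the zeros \<open>d = r\<close> and \<open>d = - r\<close> are simple with slope of order \<open>r\<close>: one has
  \<open>|2 d\<^sup>2 - \<sigma>| \<ge> 2 r |d - r|\<close> for \<open>d \<ge> 0\<close>, and symmetrically for \<open>d < 0\<close>, so two Gaussians of width \<open>1/r\<close> dominate. For
  \<open>\<sigma> < 0\<close> there is no zero and \<open>(2 d\<^sup>2 + |\<sigma>|)\<^sup>2 \<ge> 8 |\<sigma>| d\<^sup>2\<close> suffices.\<close>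

lemma resonance_decay:
  assumes "\<sigma> \<noteq> 0"
  shows "resonance \<sigma> \<le> ennreal (resonance_const / sqrt \<bar>\<sigma>\<bar>)"
proof (cases "\<sigma> > 0")
  case True
  define r where "r = sqrt (\<sigma> / 2)"
  have r: "r > 0" "\<sigma> = 2 * r\<^sup>2" using True by (auto simp: r_def)
  have pw: "exp (- (2 * d\<^sup>2 - \<sigma>)\<^sup>2 / 2) \<le> exp (- (2 * r * (d - r))\<^sup>2 / 2) + exp (- (2 * r * (d - - r))\<^sup>2 / 2)" for d
  proof -
    have eq: "2 * d\<^sup>2 - \<sigma> = 2 * (d + r) * (d - r)" by (simp add: r power2_eq_square algebra_simps)
    have "(2 * r * (d - r))\<^sup>2 \<le> (2 * d\<^sup>2 - \<sigma>)\<^sup>2 \<or> (2 * r * (d - - r))\<^sup>2 \<le> (2 * d\<^sup>2 - \<sigma>)\<^sup>2"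
    proof (cases "d \<ge> 0")
      case True
      then have "r\<^sup>2 \<le> (d + r)\<^sup>2" using r by (intro power_mono) auto
      then have "r\<^sup>2 * (2 * (d - r))\<^sup>2 \<le> (d + r)\<^sup>2 * (2 * (d - r))\<^sup>2" by (intro mult_right_mono) auto
      moreover have "r\<^sup>2 * (2 * (d - r))\<^sup>2 = (2 * r * (d - r))\<^sup>2" "(d + r)\<^sup>2 * (2 * (d - r))\<^sup>2 = (2 * (d + r) * (d - r))\<^sup>2"
        by (simp_all only: power_mult_distrib mult_ac)
      ultimately show ?thesis unfolding eq by simp
    next
      case False
      then have "r\<^sup>2 \<le> (r - d)\<^sup>2" using r by (intro power_mono) auto
      then have "r\<^sup>2 * (2 * (d + r))\<^sup>2 \<le> (d - r)\<^sup>2 * (2 * (d + r))\<^sup>2"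
        by (intro mult_right_mono) (auto simp: power2_commute)
      moreover have "r\<^sup>2 * (2 * (d + r))\<^sup>2 = (2 * r * (d - - r))\<^sup>2" "(d - r)\<^sup>2 * (2 * (d + r))\<^sup>2 = (2 * (d + r) * (d - r))\<^sup>2"
        by (simp_all add: power_mult_distrib mult_ac)
      ultimately show ?thesis unfolding eq by simp
    qed
    then have "exp (- (2 * d\<^sup>2 - \<sigma>)\<^sup>2 / 2) \<le> exp (- (2 * r * (d - r))\<^sup>2 / 2) \<or>
        exp (- (2 * d\<^sup>2 - \<sigma>)\<^sup>2 / 2) \<le> exp (- (2 * r * (d - - r))\<^sup>2 / 2)"
      by simp
    then show ?thesis
      using exp_gt_zero[of "- (2 * r * (d - r))\<^sup>2 / 2"] exp_gt_zero[of "- (2 * r * (d - - r))\<^sup>2 / 2"] by linarith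
  qed
  have "resonance \<sigma> \<le> (\<integral>\<^sup>+d. ennreal (exp (- (2 * r * (d - r))\<^sup>2 / 2)) + ennreal (exp (- (2 * r * (d - - r))\<^sup>2 / 2)) \<partial>lborel)"
    unfolding resonance_def
  proof (intro nn_integral_mono)
    fix d
    have "ennreal (exp (- (2 * d\<^sup>2 - \<sigma>)\<^sup>2 / 2)) \<le> ennreal (exp (- (2 * r * (d - r))\<^sup>2 / 2) + exp (- (2 * r * (d - - r))\<^sup>2 / 2))"
      by (intro ennreal_leI pw)
    also have "\<dots> = ennreal (exp (- (2 * r * (d - r))\<^sup>2 / 2)) + ennreal (exp (- (2 * r * (d - - r))\<^sup>2 / 2))"
      by (rule ennreal_plus) auto
    finally show "ennreal (exp (- (2 * d\<^sup>2 - \<sigma>)\<^sup>2 / 2))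
      \<le> ennreal (exp (- (2 * r * (d - r))\<^sup>2 / 2)) + ennreal (exp (- (2 * r * (d - - r))\<^sup>2 / 2))" .
  qed
  also have "\<dots> = ennreal (sqrt (2 * pi) / (2 * r)) + ennreal (sqrt (2 * pi) / (2 * r))"
    using nn_integral_gaussian[of "2 * r" r] nn_integral_gaussian[of "2 * r" "- r"] r
    by (subst nn_integral_add) simp_all
  also have "\<dots> = ennreal (sqrt (2 * pi) / r)"
    using r by (simp add: ennreal_plus[symmetric] del: ennreal_plus)
  also have "\<dots> \<le> ennreal (resonance_const / sqrt \<bar>\<sigma>\<bar>)"
  proof (rule ennreal_leI)
    have 1: "sqrt \<bar>\<sigma>\<bar> = sqrt 2 * r" using r by (simp add: real_sqrt_mult)
    have "sqrt 2 \<le> (2 :: real)" by (rule real_le_lsqrt) auto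
    then have "sqrt (2 * pi) * sqrt 2 \<le> sqrt (2 * pi) * 2" by (intro mult_left_mono) auto
    then have "sqrt (2 * pi) * sqrt 2 \<le> resonance_const" using sqrt_2pi_le_resonance_const by linarith
    then show "sqrt (2 * pi) / r \<le> resonance_const / sqrt \<bar>\<sigma>\<bar>"
      unfolding 1 using r(1) by (simp add: field_simps del: real_sqrt_mult)
  qed
  finally show ?thesis .
next
  case False
  define s where "s = - \<sigma>"
  have s: "s > 0" "\<sigma> = - s" using False assms by (auto simp: s_def)
  define c where "c = 2 * sqrt (2 * s)"
  have c: "c > 0" "c\<^sup>2 = 8 * s" using s by (auto simp: c_def power_mult_distrib)
  have "resonance \<sigma> \<le> (\<integral>\<^sup>+d. ennreal (exp (- (c * (d - 0))\<^sup>2 / 2)) \<partial>lborel)"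
    unfolding resonance_def
  proof (intro nn_integral_mono ennreal_leI)
    fix d
    have "(c * (d - 0))\<^sup>2 = 8 * s * d\<^sup>2" by (simp add: power_mult_distrib c)
    also have "\<dots> \<le> (2 * d\<^sup>2 - \<sigma>)\<^sup>2"
      using zero_le_power2[of "2 * d\<^sup>2 - s"] by (simp add: s power2_eq_square algebra_simps)
    finally show "exp (- (2 * d\<^sup>2 - \<sigma>)\<^sup>2 / 2) \<le> exp (- (c * (d - 0))\<^sup>2 / 2)" by simp
  qed
  also have "\<dots> = ennreal (sqrt (2 * pi) / c)" by (rule nn_integral_gaussian[OF c(1)])
  also have "\<dots> \<le> ennreal (resonance_const / sqrt \<bar>\<sigma>\<bar>)"
  proof (intro ennreal_leI frac_le)
    show "sqrt (2 * pi) \<le> resonance_const" using sqrt_2pi_le_resonance_const by (smt (verit) real_sqrt_ge_zero pi_ge_zero)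
    have "sqrt s \<le> sqrt (2 * s)" using s by simp
    moreover have "sqrt (2 * s) \<ge> 0" "\<bar>\<sigma>\<bar> = s" using s by auto
    ultimately have "sqrt \<bar>\<sigma>\<bar> \<le> sqrt (2 * s)" by simp
    then show "sqrt \<bar>\<sigma>\<bar> \<le> c" using \<open>sqrt (2 * s) \<ge> 0\<close> unfolding c_def by linarith
  qed (use s resonance_const_pos in auto)
  finally show ?thesis .
qed

lemma resonance_bounded: "resonance \<sigma> \<le> ennreal resonance_const"
proof (cases "\<bar>\<sigma>\<bar> \<le> 1")
  case True
  have "resonance \<sigma> \<le> (\<integral>\<^sup>+d. ennreal (exp (3 / 2)) * ennreal (exp (- (2 * (d - 0))\<^sup>2 / 2)) \<partial>lborel)"
    unfolding resonance_def
  proof (intro nn_integral_mono)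
    fix d
    have "2 * (2 * d\<^sup>2 - \<sigma>) - 1 \<le> (2 * d\<^sup>2 - \<sigma>)\<^sup>2"
      using zero_le_power2[of "2 * d\<^sup>2 - \<sigma> - 1"] by (simp add: power2_eq_square algebra_simps)
    then have "- (2 * d\<^sup>2 - \<sigma>)\<^sup>2 / 2 \<le> 3 / 2 + (- (2 * (d - 0))\<^sup>2 / 2)"
      using True by (simp add: power_mult_distrib)
    then have "exp (- (2 * d\<^sup>2 - \<sigma>)\<^sup>2 / 2) \<le> exp (3 / 2 + (- (2 * (d - 0))\<^sup>2 / 2))" by simp
    then show "ennreal (exp (- (2 * d\<^sup>2 - \<sigma>)\<^sup>2 / 2)) \<le> ennreal (exp (3 / 2)) * ennreal (exp (- (2 * (d - 0))\<^sup>2 / 2))"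
      by (simp only: ennreal_mult[symmetric] exp_ge_zero exp_add[symmetric] ennreal_leI)
  qed
  also have "\<dots> = ennreal (exp (3 / 2)) * ennreal (sqrt (2 * pi) / 2)"
    using nn_integral_gaussian[of 2 0] by (subst nn_integral_cmult) auto
  also have "\<dots> \<le> ennreal resonance_const"
    by (auto simp: ennreal_mult[symmetric] resonance_const_def intro!: ennreal_leI)
  finally show ?thesis .
next
  case False
  have "resonance \<sigma> \<le> ennreal (resonance_const / sqrt \<bar>\<sigma>\<bar>)" using False by (intro resonance_decay) auto
  also have "\<dots> \<le> ennreal resonance_const"
    using False resonance_const_pos by (intro ennreal_leI) (simp add: field_simps)
  finally show ?thesis .
qed

lemma sum_inverse_sqrt_le: "(\<Sum>i=1..n. 1 / sqrt (real i)) \<le> 2 * sqrt (real n)"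
proof (induction n)
  case (Suc n)
  have "1 / sqrt (real (Suc n)) \<le> 2 * (sqrt (real (Suc n)) - sqrt (real n))"
  proof -
    have "(sqrt (real (Suc n)) - sqrt (real n)) * (sqrt (real (Suc n)) + sqrt (real n)) = 1"
      by (simp add: algebra_simps)
    moreover have "sqrt (real (Suc n)) - sqrt (real n) \<ge> 0" by simp
    ultimately have "1 \<le> (sqrt (real (Suc n)) - sqrt (real n)) * (2 * sqrt (real (Suc n)))"
      using mult_left_mono[of "sqrt (real (Suc n)) + sqrt (real n)" "2 * sqrt (real (Suc n))" "sqrt (real (Suc n)) - sqrt (real n)"]
      by simp
    then show ?thesis by (simp add: field_simps)
  qed
  then show ?case using Suc by simp
qed simp

text \<open>In one row the arguments form an arithmetic progression of step \<open>|a|/2\<close>. The two terms next to its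
  zero are bounded trivially and the others by the sum of \<open>(|a| i / 2)\<^sup>-\<^sup>1\<^sup>/\<^sup>2\<close> over \<open>1 \<le> i \<le> 2 A\<close> on each side.\<close>

lemma resonance_row_sum:
  fixes a :: int and A :: nat
  assumes a: "a \<noteq> 0" and A: "A \<ge> 1"
  shows "(\<Sum>b\<in>{- int A..int A}. resonance (\<tau> - of_int a * of_int b / 2))
    \<le> ennreal (resonance_const * (2 + 8 * sqrt (real A) / sqrt \<bar>of_int a\<bar>))"
proof -
  define \<beta>' where "\<beta>' = 2 * \<tau> / of_int a"
  \<comment> \<open>The zero of \<open>b \<mapsto> \<tau> - a b / 2\<close> is moved to the nearest point of \<open>[- A, A]\<close>. This brings it
    no farther from any \<open>b\<close> in the sum, and all distances become at most \<open>2 A\<close>, even if \<open>\<tau>\<close> is large.\<close>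
  define \<beta> where "\<beta> = max (- real A) (min (real A) \<beta>')"
  define b0 where "b0 = \<lfloor>\<beta>\<rfloor>"
  define c where "c = resonance_const * (sqrt 2 / sqrt \<bar>of_int a\<bar>)"
  have c0: "c \<ge> 0" using resonance_const_pos by (simp add: c_def)
  have \<beta>A: "- real A \<le> \<beta>" "\<beta> \<le> real A" by (auto simp: \<beta>_def)
  have b0: "real_of_int b0 \<le> \<beta>" "\<beta> < real_of_int b0 + 1" by (auto simp: b0_def)
  have b0A: "- int A \<le> b0" "b0 \<le> int A" using \<beta>A by (auto simp: b0_def le_floor_iff floor_le_iff)
  define f where "f b = (if b \<in> {- int A..int A} then resonance (\<tau> - of_int a * of_int b / 2) else 0)" for b
  have far: "f b \<le> ennreal (c * (1 / sqrt (real i)))" if i: "i \<ge> 1" "real i \<le> \<bar>of_int b - \<beta>\<bar>" for b i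
  proof (cases "b \<in> {- int A..int A}")
    case True
    define \<sigma> where "\<sigma> = \<tau> - of_int a * of_int b / 2"
    have "\<bar>of_int b - \<beta>\<bar> \<le> \<bar>of_int b - \<beta>'\<bar>"
    proof -
      have "- real A \<le> of_int b" "of_int b \<le> real A" using True by auto
      then show ?thesis unfolding \<beta>_def by linarith
    qed
    then have "\<bar>of_int a\<bar> / 2 * real i \<le> \<bar>of_int a\<bar> / 2 * \<bar>of_int b - \<beta>'\<bar>" using i by (intro mult_left_mono) auto
    also have "\<dots> = \<bar>of_int a / 2 * (of_int b - \<beta>')\<bar>" by (simp add: abs_mult)
    also have "of_int a / 2 * (of_int b - \<beta>') = - \<sigma>" using a by (simp add: \<beta>'_def \<sigma>_def field_simps)
    finally have \<sigma>: "\<bar>of_int a\<bar> / 2 * real i \<le> \<bar>\<sigma>\<bar>" by simp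
    have pos: "\<bar>of_int a\<bar> / 2 * real i > 0" using a i by simp
    have "f b \<le> ennreal (resonance_const / sqrt \<bar>\<sigma>\<bar>)"
      unfolding f_def \<sigma>_def[symmetric] using True \<sigma> pos by (auto intro!: resonance_decay)
    also have "\<dots> \<le> ennreal (resonance_const / sqrt (\<bar>of_int a\<bar> / 2 * real i))"
      using \<sigma> pos resonance_const_pos by (intro ennreal_leI divide_left_mono) auto
    also have "resonance_const / sqrt (\<bar>of_int a\<bar> / 2 * real i) = c * (1 / sqrt (real i))"
      by (simp add: c_def real_sqrt_mult real_sqrt_divide)
    finally show ?thesis .
  next
    case False
    then show ?thesis unfolding f_def by (simp only: if_False zero_le)
  qed
  have near: "f b \<le> ennreal resonance_const" for b by (simp add: f_def resonance_bounded)
  let ?I = "{1..2 * A}"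
  have inj: "inj_on (\<lambda>i. b0 + 1 + int i) ?I" "inj_on (\<lambda>i. b0 - int i) ?I" by (auto simp: inj_on_def)
  have sub: "{- int A..int A} \<subseteq> {b0, b0 + 1} \<union> ((\<lambda>i. b0 + 1 + int i) ` ?I \<union> (\<lambda>i. b0 - int i) ` ?I)"
  proof
    fix b assume b: "b \<in> {- int A..int A}"
    show "b \<in> {b0, b0 + 1} \<union> ((\<lambda>i. b0 + 1 + int i) ` ?I \<union> (\<lambda>i. b0 - int i) ` ?I)"
    proof -
      consider "b = b0 \<or> b = b0 + 1" | "b > b0 + 1" | "b < b0" by linarith
      then show ?thesis
      proof cases
        case 2
        then have "b = b0 + 1 + int (nat (b - b0 - 1))" "nat (b - b0 - 1) \<in> ?I" using b b0A by auto
        then show ?thesis by blast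
      next
        case 3
        then have "b = b0 - int (nat (b0 - b))" "nat (b0 - b) \<in> ?I" using b b0A by auto
        then show ?thesis by blast
      qed auto
    qed
  qed
  have "(\<Sum>b\<in>{- int A..int A}. resonance (\<tau> - of_int a * of_int b / 2)) = (\<Sum>b\<in>{- int A..int A}. f b)"
    by (intro sum.cong) (auto simp: f_def)
  also have "\<dots> \<le> (\<Sum>b\<in>{b0, b0 + 1} \<union> ((\<lambda>i. b0 + 1 + int i) ` ?I \<union> (\<lambda>i. b0 - int i) ` ?I). f b)"
    by (intro sum_mono2 sub) auto
  also have "\<dots> = (\<Sum>b\<in>{b0, b0 + 1}. f b) + ((\<Sum>b\<in>(\<lambda>i. b0 + 1 + int i) ` ?I. f b) + (\<Sum>b\<in>(\<lambda>i. b0 - int i) ` ?I. f b))"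
    by (subst sum.union_disjoint; (subst sum.union_disjoint)?) auto
  also have "\<dots> = (\<Sum>b\<in>{b0, b0 + 1}. f b) + ((\<Sum>i\<in>?I. f (b0 + 1 + int i)) + (\<Sum>i\<in>?I. f (b0 - int i)))"
    using inj by (simp add: sum.reindex)
  also have "\<dots> \<le> ennreal (2 * resonance_const) + ((\<Sum>i\<in>?I. ennreal (c * (1 / sqrt (real i)))) + (\<Sum>i\<in>?I. ennreal (c * (1 / sqrt (real i)))))"
  proof (intro add_mono sum_mono)
    have "(\<Sum>b\<in>{b0, b0 + 1}. f b) = f b0 + f (b0 + 1)" by simp
    also have "\<dots> \<le> ennreal resonance_const + ennreal resonance_const" by (intro add_mono near)
    also have "\<dots> = ennreal (2 * resonance_const)" using resonance_const_pos by (simp add: ennreal_plus[symmetric] del: ennreal_plus)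
    finally show "(\<Sum>b\<in>{b0, b0 + 1}. f b) \<le> ennreal (2 * resonance_const)" .
  next
    fix i assume "i \<in> ?I"
    then show "f (b0 + 1 + int i) \<le> ennreal (c * (1 / sqrt (real i)))" using b0 by (intro far) auto
  next
    fix i assume "i \<in> ?I"
    then show "f (b0 - int i) \<le> ennreal (c * (1 / sqrt (real i)))" using b0 by (intro far) auto
  qed
  also have "\<dots> = ennreal (2 * resonance_const + 2 * (c * (\<Sum>i\<in>?I. 1 / sqrt (real i))))"
  proof -
    have "(\<Sum>i\<in>?I. ennreal (c * (1 / sqrt (real i)))) = ennreal (c * (\<Sum>i\<in>?I. 1 / sqrt (real i)))"
      using c0 by (simp add: sum_ennreal sum_distrib_left)
    moreover have "c * (\<Sum>i\<in>?I. 1 / sqrt (real i)) \<ge> 0" using c0 by (intro mult_nonneg_nonneg sum_nonneg) auto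
    ultimately show ?thesis using resonance_const_pos by (simp add: ennreal_plus[symmetric] del: ennreal_plus)
  qed
  also have "\<dots> \<le> ennreal (resonance_const * (2 + 8 * sqrt (real A) / sqrt \<bar>of_int a\<bar>))"
  proof (rule ennreal_leI)
    have "c * (\<Sum>i\<in>?I. 1 / sqrt (real i)) \<le> c * (2 * sqrt (real (2 * A)))"
      using c0 by (intro mult_left_mono sum_inverse_sqrt_le) auto
    also have "\<dots> = resonance_const * (4 * sqrt (real A) / sqrt \<bar>of_int a\<bar>)"
      by (simp add: c_def real_sqrt_mult)
    finally have "2 * resonance_const + 2 * (c * (\<Sum>i\<in>?I. 1 / sqrt (real i))) \<le> 2 * resonance_const + 2 * (resonance_const * (4 * sqrt (real A) / sqrt \<bar>of_int a\<bar>))"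
      by linarith
    also have "\<dots> = resonance_const * (2 + 8 * sqrt (real A) / sqrt \<bar>of_int a\<bar>)" by (simp add: algebra_simps)
    finally show "2 * resonance_const + 2 * (c * (\<Sum>i\<in>?I. 1 / sqrt (real i))) \<le> resonance_const * (2 + 8 * sqrt (real A) / sqrt \<bar>of_int a\<bar>)" .
  qed
  finally show ?thesis .
qed

text \<open>The row \<open>a = 0\<close>, in which nothing decays, already has the size \<open>A\<close> of the whole bound; this is the
  contribution of the null directions that also produce the lower bound. The constant is
  \<open>39 = 3 + 2 * 18\<close>, with 3 from this row and 18 from the rows of either sign.\<close>

lemma resonance_double_sum:
  fixes A :: nat
  assumes A: "A \<ge> 1"
  shows "(\<Sum>a\<in>{- int A..int A}. \<Sum>b\<in>{- int A..int A}. resonance (\<tau> - of_int a * of_int b / 2))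
    \<le> ennreal (39 * resonance_const * real A)"
proof -
  define S where "S a = (\<Sum>b\<in>{- int A..int A}. resonance (\<tau> - of_int a * of_int b / 2))" for a :: int
  define g where "g i = resonance_const * (2 + 8 * sqrt (real A) / sqrt (real i))" for i :: nat
  have g0: "g i \<ge> 0" for i using resonance_const_pos by (simp add: g_def)
  have S0: "S 0 \<le> ennreal (3 * resonance_const * real A)"
  proof -
    have "S 0 \<le> (\<Sum>b\<in>{- int A..int A}. ennreal resonance_const)" unfolding S_def by (intro sum_mono resonance_bounded)
    also have "\<dots> = ennreal (real (2 * A + 1) * resonance_const)"
      using resonance_const_pos by (simp add: ennreal_mult ennreal_of_nat_eq_real_of_nat nat_add_distrib nat_mult_distrib)
    also have "\<dots> \<le> ennreal (3 * resonance_const * real A)"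
      using resonance_const_pos A by (intro ennreal_leI) (simp add: algebra_simps)
    finally show ?thesis .
  qed
  have row: "S a \<le> ennreal (g i)" if "\<bar>a\<bar> = int i" "i \<ge> 1" for a i
  proof -
    have "\<bar>real_of_int a\<bar> = real i" using that(1) by linarith
    then show ?thesis using resonance_row_sum[of a A \<tau>] that A by (auto simp: S_def g_def)
  qed
  have "{- int A..int A} = {0} \<union> (int ` {1..A} \<union> (\<lambda>i. - int i) ` {1..A})"
  proof (intro equalityI subsetI)
    fix a assume a: "a \<in> {- int A..int A}"
    consider "a = 0" | "a > 0" | "a < 0" by linarith
    then show "a \<in> {0} \<union> (int ` {1..A} \<union> (\<lambda>i. - int i) ` {1..A})"
    proof cases
      case 2
      then have "a = int (nat a)" "nat a \<in> {1..A}" using a by auto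
      then show ?thesis by blast
    next
      case 3
      then have "a = - int (nat (- a))" "nat (- a) \<in> {1..A}" using a by auto
      then show ?thesis by blast
    qed auto
  qed auto
  then have "(\<Sum>a\<in>{- int A..int A}. S a) = (\<Sum>a\<in>{0} \<union> (int ` {1..A} \<union> (\<lambda>i. - int i) ` {1..A}). S a)" by simp
  also have "\<dots> = S 0 + ((\<Sum>a\<in>int ` {1..A}. S a) + (\<Sum>a\<in>(\<lambda>i. - int i) ` {1..A}. S a))"
    by (subst sum.union_disjoint; (subst sum.union_disjoint)?) auto
  also have "\<dots> = S 0 + ((\<Sum>i\<in>{1..A}. S (int i)) + (\<Sum>i\<in>{1..A}. S (- int i)))"
    by (simp add: sum.reindex inj_on_def)
  also have "\<dots> \<le> ennreal (3 * resonance_const * real A) + ((\<Sum>i\<in>{1..A}. ennreal (g i)) + (\<Sum>i\<in>{1..A}. ennreal (g i)))"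
    by (intro add_mono sum_mono S0 row) auto
  also have "\<dots> = ennreal (3 * resonance_const * real A + 2 * (\<Sum>i\<in>{1..A}. g i))"
    using resonance_const_pos g0 by (simp add: sum_ennreal sum_nonneg ennreal_plus[symmetric] del: ennreal_plus)
  also have "\<dots> \<le> ennreal (39 * resonance_const * real A)"
  proof (rule ennreal_leI)
    have "(\<Sum>i\<in>{1..A}. g i) = resonance_const * (2 * real A + 8 * sqrt (real A) * (\<Sum>i=1..A. 1 / sqrt (real i)))"
      by (simp add: g_def sum_distrib_left[symmetric] sum.distrib sum_distrib_left)
    also have "\<dots> \<le> resonance_const * (2 * real A + 8 * sqrt (real A) * (2 * sqrt (real A)))"
      using resonance_const_pos by (intro mult_left_mono add_left_mono sum_inverse_sqrt_le) auto
    also have "\<dots> = 18 * resonance_const * real A" by (simp add: algebra_simps)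
    finally show "3 * resonance_const * real A + 2 * (\<Sum>i\<in>{1..A}. g i) \<le> 39 * resonance_const * real A" by simp
  qed
  finally show ?thesis by (simp add: S_def)
qed

section \<open>The kernel of the squared evolution\<close>

definition dispersion :: "real \<times> int \<times> int \<Rightarrow> real" where
  "dispersion = (\<lambda>(\<xi>, k1, k2). \<xi>\<^sup>2 + (of_int k1)\<^sup>2 - (of_int k2)\<^sup>2)"

lemma dispersion_measurable [measurable]: "dispersion \<in> borel_measurable freq"
  unfolding dispersion_def split_beta' by measurable

text \<open>Centre-of-mass coordinates \<open>\<xi> = v/2 + d\<close>, \<open>\<eta> = v/2 - d\<close>, for which \<open>\<xi>\<^sup>2 + \<eta>\<^sup>2 = v\<^sup>2/2 + 2 d\<^sup>2\<close>.\<close>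

lemma frequency_pair_integral:
  assumes R: "R > 0"
  shows "(\<integral>\<^sup>+\<xi>. \<integral>\<^sup>+\<eta>. ennreal (exp (- (R * (s - (\<xi> + \<eta>)))\<^sup>2 / 2) * exp (- (\<tau> - (\<xi>\<^sup>2 + \<eta>\<^sup>2))\<^sup>2 / 2)) \<partial>lborel \<partial>lborel)
     = (\<integral>\<^sup>+v. ennreal (exp (- (R * (v - s))\<^sup>2 / 2)) * resonance (\<tau> - v\<^sup>2 / 2) \<partial>lborel)"
proof -
  define F where "F \<xi> v = ennreal (exp (- (R * (v - s))\<^sup>2 / 2) * exp (- (\<tau> - (\<xi>\<^sup>2 + (v - \<xi>)\<^sup>2))\<^sup>2 / 2))" for \<xi> v
  have "(\<integral>\<^sup>+\<eta>. ennreal (exp (- (R * (s - (\<xi> + \<eta>)))\<^sup>2 / 2) * exp (- (\<tau> - (\<xi>\<^sup>2 + \<eta>\<^sup>2))\<^sup>2 / 2)) \<partial>lborel) = (\<integral>\<^sup>+v. F \<xi> v \<partial>lborel)" for \<xi>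
  proof -
    have "(\<integral>\<^sup>+\<eta>. ennreal (exp (- (R * (s - (\<xi> + \<eta>)))\<^sup>2 / 2) * exp (- (\<tau> - (\<xi>\<^sup>2 + \<eta>\<^sup>2))\<^sup>2 / 2)) \<partial>lborel)
      = ennreal \<bar>1\<bar> * (\<integral>\<^sup>+v. ennreal (exp (- (R * (s - (\<xi> + (- \<xi> + 1 * v))))\<^sup>2 / 2) * exp (- (\<tau> - (\<xi>\<^sup>2 + (- \<xi> + 1 * v)\<^sup>2))\<^sup>2 / 2)) \<partial>lborel)"
      by (rule nn_integral_real_affine) simp_all
    also have "\<dots> = (\<integral>\<^sup>+v. F \<xi> v \<partial>lborel)"
      by (simp add: F_def power_mult_distrib power2_commute[of s])
    finally show ?thesis .
  qed
  then have "(\<integral>\<^sup>+\<xi>. \<integral>\<^sup>+\<eta>. ennreal (exp (- (R * (s - (\<xi> + \<eta>)))\<^sup>2 / 2) * exp (- (\<tau> - (\<xi>\<^sup>2 + \<eta>\<^sup>2))\<^sup>2 / 2)) \<partial>lborel \<partial>lborel)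
     = (\<integral>\<^sup>+\<xi>. \<integral>\<^sup>+v. F \<xi> v \<partial>lborel \<partial>lborel)" by simp
  also have "\<dots> = (\<integral>\<^sup>+v. \<integral>\<^sup>+\<xi>. F \<xi> v \<partial>lborel \<partial>lborel)"
    by (rule lborel_pair.Fubini'[symmetric]) (simp add: F_def)
  also have "\<dots> = (\<integral>\<^sup>+v. ennreal (exp (- (R * (v - s))\<^sup>2 / 2)) * resonance (\<tau> - v\<^sup>2 / 2) \<partial>lborel)"
  proof (rule nn_integral_cong)
    fix v
    have "(\<integral>\<^sup>+\<xi>. F \<xi> v \<partial>lborel) = ennreal \<bar>1\<bar> * (\<integral>\<^sup>+d. F (v / 2 + 1 * d) v \<partial>lborel)"
      by (rule nn_integral_real_affine) (simp_all add: F_def)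
    also have "\<dots> = (\<integral>\<^sup>+d. ennreal (exp (- (R * (v - s))\<^sup>2 / 2)) * ennreal (exp (- (2 * d\<^sup>2 - (\<tau> - v\<^sup>2 / 2))\<^sup>2 / 2)) \<partial>lborel)"
    proof -
      have "(\<tau> - ((v / 2 + d)\<^sup>2 + (v - (v / 2 + d))\<^sup>2))\<^sup>2 = (2 * d\<^sup>2 - (\<tau> - v\<^sup>2 / 2))\<^sup>2" for d
      proof -
        have "\<tau> - ((v / 2 + d)\<^sup>2 + (v - (v / 2 + d))\<^sup>2) = - (2 * d\<^sup>2 - (\<tau> - v\<^sup>2 / 2))"
          by (simp add: power2_eq_square field_simps)
        then show ?thesis by (simp only: power2_minus)
      qed
      then show ?thesis by (simp add: F_def ennreal_mult)
    qed
    also have "\<dots> = ennreal (exp (- (R * (v - s))\<^sup>2 / 2)) * resonance (\<tau> - v\<^sup>2 / 2)"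
      unfolding resonance_def by (rule nn_integral_cmult) simp
    finally show "(\<integral>\<^sup>+\<xi>. F \<xi> v \<partial>lborel) = ennreal (exp (- (R * (v - s))\<^sup>2 / 2)) * resonance (\<tau> - v\<^sup>2 / 2)" .
  qed
  finally show ?thesis .
qed

lemma resonance_measurable [measurable]: "resonance \<in> borel_measurable borel"
proof -
  have "(\<lambda>\<sigma>. \<integral>\<^sup>+d. ennreal (exp (- (2 * d\<^sup>2 - \<sigma>)\<^sup>2 / 2)) \<partial>lborel) \<in> borel_measurable borel"
    by measurable
  then show ?thesis by (simp add: resonance_def[abs_def])
qed

definition lattice_form :: "int \<times> int \<Rightarrow> real" where "lattice_form k = (of_int (fst k))\<^sup>2 - (of_int (snd k))\<^sup>2"

definition lattice_box :: "nat \<Rightarrow> (int \<times> int) set" where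
  "lattice_box n = {- int n..int n} \<times> {- int n..int n}"

lemma finite_lattice_box [simp]: "finite (lattice_box n)" by (simp add: lattice_box_def)

text \<open>Let \<open>\<mu>\<^sub>i = 2 m\<^sub>i - \<kappa>\<^sub>i\<close>. Completing the square turns the total energy into
  \<open>(\<mu>\<^sub>1\<^sup>2 - \<mu>\<^sub>2\<^sup>2) / 2\<close> plus a constant, and \<open>\<mu>\<^sub>1\<^sup>2 - \<mu>\<^sub>2\<^sup>2 = a b\<close> in the null coordinates \<open>a = \<mu>\<^sub>1 - \<mu>\<^sub>2\<close> and \<open>b = \<mu>\<^sub>1 + \<mu>\<^sub>2\<close>,
  which are integers of modulus at most \<open>8 n\<close>.\<close>

lemma lattice_sum:
  assumes n: "n \<ge> 1" and \<kappa>: "\<kappa> \<in> lattice_box (2 * n)"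
  shows "(\<Sum>m\<in>lattice_box n. resonance (\<tau> - (lattice_form m + lattice_form (\<kappa> - m)))) \<le> ennreal (312 * resonance_const * real n)"
proof -
  obtain \<kappa>1 \<kappa>2 where k: "\<kappa> = (\<kappa>1, \<kappa>2)" by fastforce
  \<comment> \<open>The null coordinates of the relative frequency; since the map is injective,
     the sum over \<open>m\<close> is at most the sum over all pairs \<open>(a, b)\<close>.\<close>
  define ab where "ab m = ((2 * fst m - \<kappa>1) - (2 * snd m - \<kappa>2), (2 * fst m - \<kappa>1) + (2 * snd m - \<kappa>2))" for m :: "int \<times> int"
  define \<tau>' where "\<tau>' = \<tau> - ((of_int \<kappa>1)\<^sup>2 - (of_int \<kappa>2)\<^sup>2) / 2"
  have inj: "inj_on ab (lattice_box n)"
    by (rule inj_onI) (auto simp: ab_def prod_eq_iff)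
  have img: "ab ` lattice_box n \<subseteq> {- int (8 * n)..int (8 * n)} \<times> {- int (8 * n)..int (8 * n)}"
    using \<kappa> by (auto simp: ab_def k lattice_box_def)
  have eq: "\<tau> - (lattice_form m + lattice_form (\<kappa> - m)) = \<tau>' - of_int (fst (ab m)) * of_int (snd (ab m)) / 2" for m
    by (simp add: lattice_form_def ab_def \<tau>'_def k power2_eq_square field_simps)
  have "(\<Sum>m\<in>lattice_box n. resonance (\<tau> - (lattice_form m + lattice_form (\<kappa> - m))))
     = (\<Sum>p\<in>ab ` lattice_box n. resonance (\<tau>' - of_int (fst p) * of_int (snd p) / 2))"
    unfolding eq using inj by (simp add: sum.reindex)
  also have "\<dots> \<le> (\<Sum>p\<in>{- int (8 * n)..int (8 * n)} \<times> {- int (8 * n)..int (8 * n)}. resonance (\<tau>' - of_int (fst p) * of_int (snd p) / 2))"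
    by (intro sum_mono2 img) auto
  also have "\<dots> = (\<Sum>a\<in>{- int (8 * n)..int (8 * n)}. \<Sum>b\<in>{- int (8 * n)..int (8 * n)}. resonance (\<tau>' - of_int a * of_int b / 2))"
    by (simp add: sum.cartesian_product split_beta')
  also have "\<dots> \<le> ennreal (39 * resonance_const * real (8 * n))"
    using n by (intro resonance_double_sum) auto
  finally show ?thesis by (simp add: mult_ac)
qed

lemma nn_integral_freq_swap:
  assumes [measurable]: "F \<in> borel_measurable freq"
  shows "(\<integral>\<^sup>+\<zeta>. F \<zeta> \<partial>freq) = (\<integral>\<^sup>+k. (\<integral>\<^sup>+\<xi>. F (\<xi>, k) \<partial>lborel) \<partial>count_space UNIV)"
proof -
  interpret pair_sigma_finite lborel "count_space (UNIV :: (int \<times> int) set)"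
    by (intro pair_sigma_finite.intro sigma_finite_lborel sigma_finite_lattice)
  show ?thesis using nn_integral_snd[of F] assms unfolding freq_eq by simp
qed

text \<open>Conservation of the lattice frequency leaves one free lattice point \<open>m\<close>; the integral over the total
  frequency \<open>v\<close> is cut to length \<open>1/R\<close> by the spatial kernel, and for each \<open>v\<close> the sum over \<open>m\<close> is the
  resonance sum.\<close>

lemma pair_kernel_mass:
  assumes R: "R > 0" and n: "n \<ge> 1" and \<kappa>: "\<kappa> \<in> lattice_box (2 * n)"
  shows "(\<integral>\<^sup>+p. \<integral>\<^sup>+q. ennreal (if snd p \<in> lattice_box n \<and> snd q = \<kappa> - snd p then
      exp (- (R * (s - (fst p + fst q)))\<^sup>2 / 2) * exp (- (\<tau> - (dispersion p + dispersion q))\<^sup>2 / 2) else 0) \<partial>freq \<partial>freq)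
    \<le> ennreal (sqrt (2 * pi) / R) * ennreal (312 * resonance_const * real n)"
proof -
  define F where "F p q = ennreal (if snd p \<in> lattice_box n \<and> snd q = \<kappa> - snd p then
      exp (- (R * (s - (fst p + fst q)))\<^sup>2 / 2) * exp (- (\<tau> - (dispersion p + dispersion q))\<^sup>2 / 2) else 0)" for p q
  have Fm: "(\<lambda>x. F (fst x) (snd x)) \<in> borel_measurable (freq \<Otimes>\<^sub>M freq)"
    unfolding F_def by measurable
  have Fm': "F p \<in> borel_measurable freq" for p
    unfolding F_def by measurable
  interpret freq: sigma_finite_measure freq by (rule sigma_finite_freq)
  have disp: "dispersion (\<xi>, m) = \<xi>\<^sup>2 + lattice_form m" for \<xi> m
    by (simp add: dispersion_def lattice_form_def split_beta')
  have "(\<integral>\<^sup>+p. \<integral>\<^sup>+q. F p q \<partial>freq \<partial>freq) = (\<integral>\<^sup>+m. \<integral>\<^sup>+\<xi>. \<integral>\<^sup>+q. F (\<xi>, m) q \<partial>freq \<partial>lborel \<partial>count_space UNIV)"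
    by (rule nn_integral_freq_swap) (use freq.borel_measurable_nn_integral_fst[OF Fm] in simp)
  also have "\<dots> = (\<integral>\<^sup>+m. (\<integral>\<^sup>+\<xi>. \<integral>\<^sup>+\<eta>. F (\<xi>, m) (\<eta>, \<kappa> - m) \<partial>lborel \<partial>lborel) \<partial>count_space UNIV)"
  proof (intro nn_integral_cong)
    fix m \<xi>
    show "(\<integral>\<^sup>+q. F (\<xi>, m) q \<partial>freq) = (\<integral>\<^sup>+\<eta>. F (\<xi>, m) (\<eta>, \<kappa> - m) \<partial>lborel)"
      by (subst nn_integral_freq_swap[OF Fm']) (rule nn_integral_count_space_delta, simp add: F_def)
  qed
  also have "\<dots> = (\<Sum>m\<in>lattice_box n. \<integral>\<^sup>+\<xi>. \<integral>\<^sup>+\<eta>. F (\<xi>, m) (\<eta>, \<kappa> - m) \<partial>lborel \<partial>lborel)"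
    by (subst nn_integral_count_space'[of "lattice_box n"]) (auto simp: F_def)
  also have "\<dots> = (\<Sum>m\<in>lattice_box n. \<integral>\<^sup>+v. ennreal (exp (- (R * (v - s))\<^sup>2 / 2)) * resonance (\<tau> - v\<^sup>2 / 2 - (lattice_form m + lattice_form (\<kappa> - m))) \<partial>lborel)"
  proof (rule sum.cong[OF refl])
    fix m assume m: "m \<in> lattice_box n"
    have "(\<integral>\<^sup>+\<xi>. \<integral>\<^sup>+\<eta>. F (\<xi>, m) (\<eta>, \<kappa> - m) \<partial>lborel \<partial>lborel)
       = (\<integral>\<^sup>+\<xi>. \<integral>\<^sup>+\<eta>. ennreal (exp (- (R * (s - (\<xi> + \<eta>)))\<^sup>2 / 2) * exp (- ((\<tau> - (lattice_form m + lattice_form (\<kappa> - m))) - (\<xi>\<^sup>2 + \<eta>\<^sup>2))\<^sup>2 / 2)) \<partial>lborel \<partial>lborel)"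
      using m by (intro nn_integral_cong) (simp add: F_def disp algebra_simps)
    also have "\<dots> = (\<integral>\<^sup>+v. ennreal (exp (- (R * (v - s))\<^sup>2 / 2)) * resonance (\<tau> - (lattice_form m + lattice_form (\<kappa> - m)) - v\<^sup>2 / 2) \<partial>lborel)"
      by (rule frequency_pair_integral[OF R])
    finally show "(\<integral>\<^sup>+\<xi>. \<integral>\<^sup>+\<eta>. F (\<xi>, m) (\<eta>, \<kappa> - m) \<partial>lborel \<partial>lborel)
      = (\<integral>\<^sup>+v. ennreal (exp (- (R * (v - s))\<^sup>2 / 2)) * resonance (\<tau> - v\<^sup>2 / 2 - (lattice_form m + lattice_form (\<kappa> - m))) \<partial>lborel)"
      by (simp add: algebra_simps)
  qed
  also have "\<dots> = (\<integral>\<^sup>+v. (\<Sum>m\<in>lattice_box n. ennreal (exp (- (R * (v - s))\<^sup>2 / 2)) * resonance (\<tau> - v\<^sup>2 / 2 - (lattice_form m + lattice_form (\<kappa> - m)))) \<partial>lborel)"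
    by (rule nn_integral_sum[symmetric]) measurable
  also have "\<dots> \<le> (\<integral>\<^sup>+v. ennreal (exp (- (R * (v - s))\<^sup>2 / 2)) * ennreal (312 * resonance_const * real n) \<partial>lborel)"
    unfolding sum_distrib_left[symmetric] by (intro nn_integral_mono mult_left_mono lattice_sum n \<kappa>) auto
  also have "\<dots> = ennreal (sqrt (2 * pi) / R) * ennreal (312 * resonance_const * real n)"
    using nn_integral_gaussian[OF R, of s] by (subst nn_integral_multc) auto
  finally show ?thesis unfolding F_def .
qed

section \<open>The \<open>L\<^sup>4\<close> estimate\<close>

text \<open>Up to the normalising constant, \<open>e\<^sup>i\<^sup>t\<^sup>L\<close> applied to the function with Fourier transform \<open>G\<close>.\<close>

definition wave :: "(real \<times> int \<times> int \<Rightarrow> complex) \<Rightarrow> real \<Rightarrow> real \<times> real \<times> real \<Rightarrow> complex" where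
  "wave G t z = (\<integral>\<zeta>. G \<zeta> * cis (- t * dispersion \<zeta>) * plane_wave z \<zeta> \<partial>freq)"

lemma wave_measurable [measurable]:
  assumes [measurable]: "G \<in> borel_measurable freq"
  shows "(\<lambda>x. wave G (fst x) (snd x)) \<in> borel_measurable (borel \<Otimes>\<^sub>M phys)"
proof -
  interpret freq: sigma_finite_measure freq by (rule sigma_finite_freq)
  show ?thesis unfolding wave_def by (intro freq.borel_measurable_lebesgue_integral) measurable
qed

text \<open>The Gaussian integrals over the time, over \<open>x\<close> and over the total frequency and the two integrals over
  the torus contribute \<open>(2 \<pi>)\<^sup>3 sqrt (2 \<pi>)\<close>; the last factor is the constant of \<open>lattice_sum\<close>.\<close>

definition quartic_const :: real where "quartic_const = (2 * pi)^3 * sqrt (2 * pi) * (312 * resonance_const)"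

lemma quartic_const_pos: "quartic_const > 0" using resonance_const_pos by (simp add: quartic_const_def)

lemma lattice_box_measurable [measurable]: "Measurable.pred freq (\<lambda>\<zeta>. snd \<zeta> \<in> lattice_box n)"
  unfolding freq_eq by measurable

text \<open>The square of the evolution is \<open>T a\<close> for the tensor product \<open>a = G \<otimes> G\<close> and products of two plane waves,
  so Schur's test bounds its \<open>L\<^sup>2\<close> norm by the row mass of the kernel. The damped integral
  over \<open>x\<close> contributes a factor \<open>R\<close> to the kernel and the integration over the total frequency a factor
  \<open>1/R\<close>, so the bound does not depend on the damping.\<close>

lemma L4_estimate_gauss_phys:
  assumes R: "R > 0" and n: "n \<ge> 1" and G: "integrable freq G"
    and supp: "\<And>\<zeta>. snd \<zeta> \<notin> lattice_box n \<Longrightarrow> G \<zeta> = 0"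
  shows "(\<integral>\<^sup>+x. ennreal ((norm (wave G (fst x) (snd x)))^4) \<partial>(gauss 1 \<Otimes>\<^sub>M gauss_phys R))
     \<le> ennreal (quartic_const * real n) * (L2sq freq G)\<^sup>2"
proof -
  have Gm[measurable]: "G \<in> borel_measurable freq" by (rule borel_measurable_integrable[OF G])
  interpret freq: sigma_finite_measure freq by (rule sigma_finite_freq)
  interpret FF: pair_sigma_finite freq freq ..
  have FF: "sigma_finite_measure (freq \<Otimes>\<^sub>M freq)" by (rule FF.P.sigma_finite_measure_axioms)
  have W: "finite_measure (gauss 1 \<Otimes>\<^sub>M gauss_phys R)"
    using R by (intro finite_measure_pair_measure gauss_finite gauss_phys_finite) auto
  define e where "e x pq = (if snd (fst pq) \<in> lattice_box n \<and> snd (snd pq) \<in> lattice_box n then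
     cis (- fst x * (dispersion (fst pq) + dispersion (snd pq))) * (plane_wave (snd x) (fst pq) * plane_wave (snd x) (snd pq)) else 0)"
    for x and pq :: "(real \<times> int \<times> int) \<times> (real \<times> int \<times> int)"
  define a where "a pq = G (fst pq) * G (snd pq)" for pq
  have ai: "integrable (freq \<Otimes>\<^sub>M freq) a"
    unfolding a_def by (rule integrable_pair_mult(1)[OF sigma_finite_freq sigma_finite_freq G G])
  have ea: "(\<integral>pq. a pq * e x pq \<partial>(freq \<Otimes>\<^sub>M freq)) = (wave G (fst x) (snd x))\<^sup>2" if x: "snd x \<in> space phys" for x
  proof -
    define f where "f \<zeta> = G \<zeta> * cis (- fst x * dispersion \<zeta>) * plane_wave (snd x) \<zeta>" for \<zeta>
    have pm: "plane_wave (snd x) \<in> borel_measurable freq"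
      by (rule plane_wave_measurable[OF measurable_const[OF x] measurable_ident_sets[OF refl]])
    have fi: "integrable freq f"
      using G
    proof (rule Bochner_Integration.integrable_bound)
      show "f \<in> borel_measurable freq" unfolding f_def using pm by measurable
    qed (simp add: f_def norm_mult)
    have "a pq * e x pq = f (fst pq) * f (snd pq)" for pq
    proof -
      have "cis (- fst x * (dispersion (fst pq) + dispersion (snd pq))) = cis (- fst x * dispersion (fst pq)) * cis (- fst x * dispersion (snd pq))"
        by (simp add: cis_mult algebra_simps)
      then show ?thesis
        using supp[of "fst pq"] supp[of "snd pq"] by (auto simp: a_def e_def f_def mult_ac)
    qed
    then show ?thesis
      using integrable_pair_mult(2)[OF sigma_finite_freq sigma_finite_freq fi fi]
      by (simp add: wave_def f_def power2_eq_square)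
  qed
  have e1: "norm (e x pq) \<le> 1" for x pq by (simp add: e_def norm_mult)
  have em: "(\<lambda>(x, pq). e x pq) \<in> borel_measurable ((gauss 1 \<Otimes>\<^sub>M gauss_phys R) \<Otimes>\<^sub>M (freq \<Otimes>\<^sub>M freq))"
    unfolding e_def split_beta' by measurable
  define c where "c = sqrt (2 * pi) * (R * sqrt (2 * pi)) * (2 * pi)\<^sup>2"
  have c0: "c \<ge> 0" using R by (simp add: c_def)
  have kernel: "norm (\<integral>x. e x (p, q) * cnj (e x (p', q')) \<partial>(gauss 1 \<Otimes>\<^sub>M gauss_phys R)) \<le>
      c * (if snd p' \<in> lattice_box n \<and> snd q' = (snd p + snd q) - snd p' then
      exp (- (R * ((fst p + fst q) - (fst p' + fst q')))\<^sup>2 / 2) * exp (- ((dispersion p + dispersion q) - (dispersion p' + dispersion q'))\<^sup>2 / 2) else 0)"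
    (is "_ \<le> ?rhs") for p q p' q'
  proof (cases "snd p \<in> lattice_box n \<and> snd q \<in> lattice_box n \<and> snd p' \<in> lattice_box n \<and> snd q' \<in> lattice_box n")
    case True
    obtain \<xi> k1 k2 \<eta> l1 l2 \<xi>' k1' k2' \<eta>' l1' l2' where pq: "p = (\<xi>, k1, k2)" "q = (\<eta>, l1, l2)" "p' = (\<xi>', k1', k2')" "q' = (\<eta>', l1', l2')"
      by (metis prod_cases3)
    define D where "D = (dispersion p + dispersion q) - (dispersion p' + dispersion q')"
    define S where "S = (\<xi> + \<eta>) - (\<xi>' + \<eta>')"
    define m1 where "m1 = k1 + l1 - (k1' + l1')"
    define m2 where "m2 = k2 + l2 - (k2' + l2')"
    have "e x (p, q) * cnj (e x (p', q')) = cis (fst x * - D) *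
        (\<lambda>(x, y1, y2). cis (x * S + (y1 * of_int m1 + y2 * of_int m2))) (snd x)" for x
      using True
      by (simp add: e_def pq plane_wave_def D_def S_def m1_def m2_def cis_mult cis_cnj split_beta' algebra_simps)
    then have "(\<integral>x. e x (p, q) * cnj (e x (p', q')) \<partial>(gauss 1 \<Otimes>\<^sub>M gauss_phys R))
      = (\<integral>x. cis (fst x * - D) * (\<lambda>(x, y1, y2). cis (x * S + (y1 * of_int m1 + y2 * of_int m2))) (snd x) \<partial>(gauss 1 \<Otimes>\<^sub>M gauss_phys R))"
      by simp
    also have "\<dots> = (\<integral>t. cis (t * - D) \<partial>gauss 1) * (\<integral>(x, y1, y2). cis (x * S + (y1 * of_int m1 + y2 * of_int m2)) \<partial>gauss_phys R)"
    proof (rule integral_pair_mult)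
      show "(\<lambda>(x, y1, y2). cis (x * S + (y1 * of_int m1 + y2 * of_int m2))) \<in> borel_measurable (gauss_phys R)"
        unfolding split_beta' by measurable
    qed (use R in \<open>auto intro!: gauss_finite gauss_phys_finite split: prod.splits\<close>)
    also have "\<dots> = complex_of_real (sqrt (2 * pi) * exp (- D\<^sup>2 / 2) * (R * sqrt (2 * pi) * exp (- (R * S)\<^sup>2 / 2) *
        ((if m1 = 0 then 2 * pi else 0) * (if m2 = 0 then 2 * pi else 0))))"
      using integral_gauss_cis[of 1 "- D"] gauss_phys_character[OF R, of S m1 m2] by simp
    finally have I: "norm (\<integral>x. e x (p, q) * cnj (e x (p', q')) \<partial>(gauss 1 \<Otimes>\<^sub>M gauss_phys R))
      = sqrt (2 * pi) * exp (- D\<^sup>2 / 2) * (R * sqrt (2 * pi) * exp (- (R * S)\<^sup>2 / 2) *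
        ((if m1 = 0 then 2 * pi else 0) * (if m2 = 0 then 2 * pi else 0)))"
      using R by (simp only: norm_of_real) (auto simp: abs_mult)
    have S: "S = (fst p + fst q) - (fst p' + fst q')" by (simp add: S_def pq)
    have "snd q' = (snd p + snd q) - snd p' \<longleftrightarrow> m1 = 0 \<and> m2 = 0"
      by (auto simp: pq m1_def m2_def)
    moreover define w where "w = sqrt (2 * pi)"
    ultimately show ?thesis unfolding I S[symmetric] D_def[symmetric] c_def w_def[symmetric] using True
      by (auto simp: power2_eq_square mult_ac)
  next
    case False
    then have "e x (p, q) * cnj (e x (p', q')) = 0" for x by (auto simp: e_def)
    then show ?thesis using c0 by (simp only: integral_zero norm_zero) simp
  qed
  have B: "(\<integral>\<^sup>+pq'. ennreal (norm (\<integral>x. e x pq * cnj (e x pq') \<partial>(gauss 1 \<Otimes>\<^sub>M gauss_phys R))) \<partial>(freq \<Otimes>\<^sub>M freq)) \<le> ennreal (quartic_const * real n)"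
    for pq
  proof (cases "snd (fst pq) \<in> lattice_box n \<and> snd (snd pq) \<in> lattice_box n")
    case True
    obtain p q where pq: "pq = (p, q)" by (cases pq)
    have \<kappa>: "snd p + snd q \<in> lattice_box (2 * n)"
      using True by (auto simp: pq lattice_box_def mem_Times_iff)
    define F where "F p' q' = (if snd p' \<in> lattice_box n \<and> snd q' = (snd p + snd q) - snd p' then
      exp (- (R * ((fst p + fst q) - (fst p' + fst q')))\<^sup>2 / 2) * exp (- ((dispersion p + dispersion q) - (dispersion p' + dispersion q'))\<^sup>2 / 2) else 0)"
      for p' q' :: "real \<times> int \<times> int"
      have Fm: "(\<lambda>x. ennreal (F (fst x) (snd x))) \<in> borel_measurable (freq \<Otimes>\<^sub>M freq)" unfolding F_def by measurable
    have "(\<integral>\<^sup>+pq'. ennreal (norm (\<integral>x. e x pq * cnj (e x pq') \<partial>(gauss 1 \<Otimes>\<^sub>M gauss_phys R))) \<partial>(freq \<Otimes>\<^sub>M freq))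
      \<le> (\<integral>\<^sup>+pq'. ennreal c * ennreal (F (fst pq') (snd pq')) \<partial>(freq \<Otimes>\<^sub>M freq))"
    proof (intro nn_integral_mono)
      fix pq' :: "(real \<times> int \<times> int) \<times> (real \<times> int \<times> int)"
      have "norm (\<integral>x. e x pq * cnj (e x pq') \<partial>(gauss 1 \<Otimes>\<^sub>M gauss_phys R)) \<le> c * F (fst pq') (snd pq')"
        using kernel[of p q "fst pq'" "snd pq'"] by (simp add: pq F_def)
      then have "ennreal (norm (\<integral>x. e x pq * cnj (e x pq') \<partial>(gauss 1 \<Otimes>\<^sub>M gauss_phys R))) \<le> ennreal (c * F (fst pq') (snd pq'))"
        by (rule ennreal_leI)
      then show "ennreal (norm (\<integral>x. e x pq * cnj (e x pq') \<partial>(gauss 1 \<Otimes>\<^sub>M gauss_phys R))) \<le> ennreal c * ennreal (F (fst pq') (snd pq'))"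
        using c0 by (simp add: ennreal_mult F_def)
    qed
    also have "\<dots> = ennreal c * (\<integral>\<^sup>+p'. \<integral>\<^sup>+q'. ennreal (F p' q') \<partial>freq \<partial>freq)"
      using freq.nn_integral_fst[OF Fm] Fm by (simp add: nn_integral_cmult)
    also have "\<dots> \<le> ennreal c * (ennreal (sqrt (2 * pi) / R) * ennreal (312 * resonance_const * real n))"
      unfolding F_def by (intro mult_left_mono pair_kernel_mass R n \<kappa>) auto
    also have "\<dots> = ennreal (quartic_const * real n)"
      using c0 R resonance_const_pos by (simp add: ennreal_mult[symmetric] c_def quartic_const_def power2_eq_square power3_eq_cube mult_ac)
    finally show ?thesis .
  next
    case False
    then have "e x pq = 0" for x by (auto simp: e_def)
    then show ?thesis by simp
  qed
  have "(\<integral>\<^sup>+x. ennreal ((norm (wave G (fst x) (snd x)))^4) \<partial>(gauss 1 \<Otimes>\<^sub>M gauss_phys R))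
    = L2sq (gauss 1 \<Otimes>\<^sub>M gauss_phys R) (\<lambda>x. \<integral>pq. a pq * e x pq \<partial>(freq \<Otimes>\<^sub>M freq))"
    unfolding L2sq_def
  proof (intro nn_integral_cong)
    fix x assume "x \<in> space (gauss 1 \<Otimes>\<^sub>M gauss_phys R)"
    then have "snd x \<in> space phys"
      by (simp only: space_pair_measure sets_eq_imp_space_eq[OF sets_gauss_phys[of R]] mem_Times_iff)
    then show "ennreal ((norm (wave G (fst x) (snd x)))^4) = ennreal ((norm (\<integral>pq. a pq * e x pq \<partial>(freq \<Otimes>\<^sub>M freq)))\<^sup>2)"
      by (simp add: ea norm_power power_mult[symmetric])
  qed
  also have "\<dots> \<le> ennreal (quartic_const * real n) * L2sq (freq \<Otimes>\<^sub>M freq) a"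
    by (rule TTstar_Schur_bound[OF FF W em e1 ai B])
  also have "L2sq (freq \<Otimes>\<^sub>M freq) a = (L2sq freq G)\<^sup>2"
  proof -
    have "L2sq (freq \<Otimes>\<^sub>M freq) a = (\<integral>\<^sup>+p. \<integral>\<^sup>+q. ennreal ((norm (G p))\<^sup>2) * ennreal ((norm (G q))\<^sup>2) \<partial>freq \<partial>freq)"
      unfolding L2sq_def a_def
      by (subst freq.nn_integral_fst[symmetric]) (simp_all add: norm_mult power_mult_distrib ennreal_mult)
    then show ?thesis by (simp add: L2sq_def nn_integral_cmult nn_integral_multc power2_eq_square)
  qed
  finally show ?thesis .
qed

theorem L4_estimate:
  assumes n: "n \<ge> 1" and G: "integrable freq G"
    and supp: "\<And>\<zeta>. snd \<zeta> \<notin> lattice_box n \<Longrightarrow> G \<zeta> = 0"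
  shows "(\<integral>\<^sup>+t. \<integral>\<^sup>+z. ennreal ((norm (wave G t z))^4) \<partial>phys \<partial>gauss 1) \<le> ennreal (quartic_const * real n) * (L2sq freq G)\<^sup>2"
proof -
  have Gm[measurable]: "G \<in> borel_measurable freq" by (rule borel_measurable_integrable[OF G])
  define g where "g t z = ennreal ((norm (wave G t z))^4)" for t z
  have gm: "(\<lambda>x. g (fst x) (snd x)) \<in> borel_measurable (borel \<Otimes>\<^sub>M phys)" unfolding g_def by measurable
  have gm': "(\<lambda>x. g (fst x) (snd x)) \<in> borel_measurable (gauss 1 \<Otimes>\<^sub>M gauss_phys R)" for R
    using gm by (simp cong: measurable_cong_sets add: measurable_cong_sets[OF sets_pair_measure_cong[OF sets_gauss sets_gauss_phys] refl])
  have gt: "g t \<in> borel_measurable phys" for t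
    using measurable_Pair2[OF gm, of t] by simp
  have SUP: "(\<integral>\<^sup>+z. g t z \<partial>phys) = (SUP m. \<integral>\<^sup>+z. g t z \<partial>gauss_phys (real (Suc m)))"
    and inc: "incseq (\<lambda>m. \<integral>\<^sup>+z. g t z \<partial>gauss_phys (real (Suc m)))" for t
    using gauss_exhaustion[OF sigma_finite_torus2, of "g t"] gt[of t] unfolding phys_def gauss_phys_def by auto
  have bf: "sigma_finite_measure (gauss_phys (real (Suc m)))" for m
    by (intro finite_measure.axioms(1) gauss_phys_finite) simp
  have "(\<integral>\<^sup>+t. \<integral>\<^sup>+z. g t z \<partial>phys \<partial>gauss 1) = (SUP m. \<integral>\<^sup>+t. \<integral>\<^sup>+z. g t z \<partial>gauss_phys (real (Suc m)) \<partial>gauss 1)"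
    unfolding SUP
  proof (rule nn_integral_monotone_convergence_SUP)
    show "incseq (\<lambda>m t. \<integral>\<^sup>+z. g t z \<partial>gauss_phys (real (Suc m)))"
      using inc by (auto simp: incseq_def le_fun_def simp del: of_nat_Suc)
    show "(\<lambda>t. \<integral>\<^sup>+z. g t z \<partial>gauss_phys (real (Suc m))) \<in> borel_measurable (gauss 1)" for m
      using sigma_finite_measure.borel_measurable_nn_integral_fst[OF bf gm'] by simp
  qed
  also have "\<dots> \<le> ennreal (quartic_const * real n) * (L2sq freq G)\<^sup>2"
  proof (rule SUP_least)
    fix m
    have "(\<integral>\<^sup>+t. \<integral>\<^sup>+z. g t z \<partial>gauss_phys (real (Suc m)) \<partial>gauss 1)
       = (\<integral>\<^sup>+x. ennreal ((norm (wave G (fst x) (snd x)))^4) \<partial>(gauss 1 \<Otimes>\<^sub>M gauss_phys (real (Suc m))))"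
      using sigma_finite_measure.nn_integral_fst[OF bf gm'] by (simp add: g_def)
    also have "\<dots> \<le> ennreal (quartic_const * real n) * (L2sq freq G)\<^sup>2"
      by (rule L4_estimate_gauss_phys[OF _ n G supp]) auto
    finally show "(\<integral>\<^sup>+t. \<integral>\<^sup>+z. g t z \<partial>gauss_phys (real (Suc m)) \<partial>gauss 1) \<le> ennreal (quartic_const * real n) * (L2sq freq G)\<^sup>2" .
  qed
  finally show ?thesis unfolding g_def .
qed

section \<open>The upper bound\<close>

lemma propagator_symbol_eq: "propagator_symbol t \<zeta> = cis (- t * dispersion \<zeta>)"
  by (simp add: propagator_symbol_def dispersion_def split_beta')

lemma fourier_inverse_propagator:
  "fourier_inverse (\<lambda>\<zeta>. propagator_symbol t \<zeta> * G \<zeta>) z = complex_of_real fourier_const * wave G t z"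
  unfolding fourier_inverse_def wave_def propagator_symbol_eq
  by (simp only: mult.commute[of "cis _"])

lemma fourier_inverse_cong_AE:
  assumes [measurable]: "F \<in> borel_measurable freq" "G \<in> borel_measurable freq"
    and eq: "AE \<zeta> in freq. F \<zeta> = G \<zeta>" and z: "z \<in> space phys"
  shows "fourier_inverse F z = fourier_inverse G z"
proof -
  have [measurable]: "plane_wave z \<in> borel_measurable freq"
    by (rule plane_wave_measurable[OF measurable_const[OF z] measurable_ident_sets[OF refl]])
  have "(\<integral>\<zeta>. F \<zeta> * plane_wave z \<zeta> \<partial>freq) = (\<integral>\<zeta>. G \<zeta> * plane_wave z \<zeta> \<partial>freq)"
    by (rule integral_cong_AE) (use eq in auto)
  then show ?thesis by (simp add: fourier_inverse_def)
qed

text \<open>The pointwise form of the interpolation of \<open>L\<^sup>1\<^sup>0\<^sup>/\<^sup>3\<close> between \<open>L\<^sup>2\<close> and \<open>L\<^sup>4\<close>; optimising in \<open>s\<close> after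
  integration replaces Hoelder's inequality.\<close>

lemma interpolate_powr:
  fixes v s :: real
  assumes "v \<ge> 0" "s > 0"
  shows "v powr (10 / 3) \<le> s\<^sup>2 * v\<^sup>2 + (1 / s) * v^4"
proof (cases "v = 0")
  case False
  define w where "w = v powr (1 / 3)"
  have w: "w > 0" using False by (simp add: w_def)
  have p: "w ^ n = v powr (real n / 3)" for n
    unfolding w_def using False assms by (simp add: powr_powr flip: powr_realpow)
  have v3: "v = w ^ 3" using p[of 3] False assms by simp
  have "w^10 \<le> s\<^sup>2 * w^6 + (1 / s) * w^12"
  proof (cases "w\<^sup>2 \<le> s")
    case True
    then have "(w\<^sup>2)\<^sup>2 * w^6 \<le> s\<^sup>2 * w^6" using w by (intro mult_right_mono power_mono) auto
    moreover have "(w\<^sup>2)\<^sup>2 * w^6 = w^10" by (simp flip: power_mult power_add)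
    moreover have "(1 / s) * w^12 \<ge> 0" using w assms by simp
    ultimately show ?thesis by linarith
  next
    case False
    then have "s * w^10 \<le> w\<^sup>2 * w^10" using w by (intro mult_right_mono) auto
    also have "\<dots> = w^12" by (simp flip: power_add)
    finally have "w^10 \<le> (1 / s) * w^12" using assms by (simp add: field_simps)
    moreover have "s\<^sup>2 * w^6 \<ge> 0" using w by simp
    ultimately show ?thesis by linarith
  qed
  moreover have "v\<^sup>2 = w^6" "v^4 = w^12" unfolding v3 by (simp_all flip: power_mult)
  ultimately show ?thesis using p[of 10] by simp
qed simp

lemma cutoff_norm_le: "admissible_cutoff chi \<Longrightarrow> norm (cutoff_symbol chi N \<zeta>) \<le> 1"
  by (auto simp: cutoff_symbol_def admissible_cutoff_def split: prod.splits)

lemma cutoff_support: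
  fixes N :: nat
  assumes chi: "admissible_cutoff chi" and N: "N \<ge> 1" and \<zeta>: "\<zeta> \<notin> freq_box (real (2 * N))"
  shows "cutoff_symbol chi (real N) \<zeta> = 0"
proof -
  obtain \<xi> k1 k2 where z: "\<zeta> = (\<xi>, k1, k2)" by (metis prod_cases3)
  let ?r = "sqrt (\<xi>\<^sup>2 + ((of_int k1)\<^sup>2 + (of_int k2)\<^sup>2))"
  have le: "\<bar>\<xi>\<bar> \<le> ?r" "\<bar>of_int k1\<bar> \<le> ?r" "\<bar>of_int k2\<bar> \<le> ?r"
    by (auto intro!: real_le_rsqrt)
  have "2 * real N < ?r" using \<zeta> le by (auto simp: z freq_box_def)
  then have "2 < ?r / real N" using N by (simp add: field_simps)
  then have "chi (?r / real N) = 0" using chi unfolding admissible_cutoff_def by auto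
  then show ?thesis by (simp add: cutoff_symbol_def z)
qed

lemma cutoff_eq_1:
  assumes chi: "admissible_cutoff chi" and N: "N > 0"
    and le: "\<xi>\<^sup>2 + ((of_int k1)\<^sup>2 + (of_int k2)\<^sup>2) \<le> N\<^sup>2"
  shows "cutoff_symbol chi N (\<xi>, k1, k2) = 1"
proof -
  have "sqrt (\<xi>\<^sup>2 + ((of_int k1)\<^sup>2 + (of_int k2)\<^sup>2)) \<le> N"
    using le N by (intro real_le_lsqrt) auto
  then have "sqrt (\<xi>\<^sup>2 + ((of_int k1)\<^sup>2 + (of_int k2)\<^sup>2)) / N \<in> {- 1..1}"
    using N by (auto intro: order_trans[of _ 0])
  then show ?thesis using chi unfolding admissible_cutoff_def by (simp add: cutoff_symbol_def)
qed

text \<open>The energy is at most 4, hence its square at most 16, and lattice frequencies range up to \<open>2 N\<close>;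
  this is the origin of 4 and of \<open>32 = 2 * 16\<close>.\<close>

definition strichartz_const :: real where "strichartz_const = 4 + fourier_const^4 * exp (1/2) * quartic_const * 32"

lemma strichartz_const_pos: "strichartz_const > 0" using quartic_const_pos by (simp add: strichartz_const_def add_pos_nonneg)

lemma nn_integral_unit_interval_le_gauss:
  assumes "f \<in> borel_measurable borel"
  shows "(\<integral>\<^sup>+t. f t \<partial>restrict_space lborel {0..1}) \<le> ennreal (exp (1/2)) * (\<integral>\<^sup>+t. f t \<partial>gauss 1)"
proof -
  have [measurable]: "f \<in> borel_measurable borel" by fact
  have "(\<integral>\<^sup>+t. f t \<partial>restrict_space lborel {0..1}) = (\<integral>\<^sup>+t. f t * indicator {0..1} t \<partial>lborel)"
    by (rule nn_integral_restrict_space) simp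
  also have "\<dots> \<le> (\<integral>\<^sup>+t. ennreal (exp (1/2)) * (ennreal (exp (- (t / 1)\<^sup>2 / 2)) * f t) \<partial>lborel)"
  proof (intro nn_integral_mono)
    fix t :: real
    show "f t * indicator {0..1} t \<le> ennreal (exp (1/2)) * (ennreal (exp (- (t / 1)\<^sup>2 / 2)) * f t)"
    proof (cases "t \<in> {0..1}")
      case True
      then have "t\<^sup>2 \<le> 1" by (simp add: power_le_one)
      then have "1 \<le> exp (1/2 + (- (t / 1)\<^sup>2 / 2))" by simp
      then have "1 \<le> ennreal (exp (1/2 + (- (t / 1)\<^sup>2 / 2)))" by (metis ennreal_1 ennreal_leI)
      also have "\<dots> = ennreal (exp (1/2)) * ennreal (exp (- (t / 1)\<^sup>2 / 2))"
        by (simp only: exp_add ennreal_mult exp_ge_zero)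
      finally have "1 * f t \<le> ennreal (exp (1/2)) * ennreal (exp (- (t / 1)\<^sup>2 / 2)) * f t"
        by (rule mult_right_mono) simp
      then show ?thesis using True by (simp add: mult.assoc)
    qed simp
  qed
  also have "\<dots> = ennreal (exp (1/2)) * (\<integral>\<^sup>+t. f t \<partial>gauss 1)"
    unfolding gauss_def by (subst nn_integral_cmult, simp, subst nn_integral_density) auto
  finally show ?thesis .
qed

text \<open>Conservation of energy bounds the quadratic part and the \<open>L\<^sup>4\<close> estimate the quartic part; the weight
  \<open>exp (- t\<^sup>2 / 2)\<close> in the latter is at least \<open>exp (- 1 / 2)\<close> on the unit interval.\<close>

lemma wave_energy_bound:
  assumes n: "n \<ge> 1" and s: "s > 0" and G: "integrable freq G" and G2: "L2sq freq G \<le> 4"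
    and supp: "\<And>\<zeta>. snd \<zeta> \<notin> lattice_box n \<Longrightarrow> G \<zeta> = 0"
  shows "(\<integral>\<^sup>+t. \<integral>\<^sup>+z. ennreal (norm (complex_of_real fourier_const * wave G t z) powr (10 / 3)) \<partial>phys \<partial>restrict_space lborel {0..1})
    \<le> ennreal (4 * s\<^sup>2 + (1 / s) * (fourier_const^4 * exp (1/2) * quartic_const * 16 * real n))"
proof -
  have Gm[measurable]: "G \<in> borel_measurable freq" by (rule borel_measurable_integrable[OF G])
  interpret P: sigma_finite_measure phys by (rule sigma_finite_phys)
  let ?v = "\<lambda>t z. complex_of_real fourier_const * wave G t z"
  have wm: "(\<lambda>x. wave G (fst x) (snd x)) \<in> borel_measurable (borel \<Otimes>\<^sub>M phys)" by measurable
  have wt[measurable]: "wave G t \<in> borel_measurable phys" for t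
    using measurable_Pair2[OF wm, of t] by simp
  have energy: "L2sq phys (?v t) \<le> 4" for t
  proof -
    have gi: "integrable freq (\<lambda>\<zeta>. propagator_symbol t \<zeta> * G \<zeta>)"
    proof (rule Bochner_Integration.integrable_bound[OF G])
      show "(\<lambda>\<zeta>. propagator_symbol t \<zeta> * G \<zeta>) \<in> borel_measurable freq"
        unfolding propagator_symbol_eq by measurable
    qed (simp add: propagator_symbol_eq norm_mult)
    have "L2sq phys (?v t) = L2sq phys (fourier_inverse (\<lambda>\<zeta>. propagator_symbol t \<zeta> * G \<zeta>))"
      unfolding L2sq_def fourier_inverse_propagator ..
    also have "\<dots> \<le> L2sq freq (\<lambda>\<zeta>. propagator_symbol t \<zeta> * G \<zeta>)" by (rule L2sq_fourier_inverse_le[OF gi])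
    also have "\<dots> = L2sq freq G" by (simp add: L2sq_def propagator_symbol_eq norm_mult)
    finally show ?thesis using G2 by (rule order_trans)
  qed
  define q where "q t = (\<integral>\<^sup>+z. ennreal ((norm (wave G t z))^4) \<partial>phys)" for t
  have qm[measurable]: "q \<in> borel_measurable borel"
    unfolding q_def using wm by (intro P.borel_measurable_nn_integral) (simp add: split_beta')
  have "(\<integral>\<^sup>+z. ennreal (norm (?v t z) powr (10 / 3)) \<partial>phys) \<le> ennreal (4 * s\<^sup>2) + ennreal (1 / s * fourier_const^4) * q t" for t
  proof -
    have "(\<integral>\<^sup>+z. ennreal (norm (?v t z) powr (10 / 3)) \<partial>phys)
      \<le> (\<integral>\<^sup>+z. ennreal (s\<^sup>2) * ennreal ((norm (?v t z))\<^sup>2) + ennreal (1 / s * fourier_const^4) * ennreal ((norm (wave G t z))^4) \<partial>phys)"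
    proof (intro nn_integral_mono)
      fix z
      have "norm (?v t z) powr (10 / 3) \<le> s\<^sup>2 * (norm (?v t z))\<^sup>2 + (1 / s) * (norm (?v t z))^4"
        using s by (intro interpolate_powr) auto
      also have "(1 / s) * (norm (?v t z))^4 = (1 / s * fourier_const^4) * (norm (wave G t z))^4"
        using fourier_const_pos by (simp add: norm_mult power_mult_distrib)
      finally have "ennreal (norm (?v t z) powr (10 / 3)) \<le> ennreal (s\<^sup>2 * (norm (?v t z))\<^sup>2 + (1 / s * fourier_const^4) * (norm (wave G t z))^4)"
        by (rule ennreal_leI)
      also have "\<dots> = ennreal (s\<^sup>2) * ennreal ((norm (?v t z))\<^sup>2) + ennreal (1 / s * fourier_const^4) * ennreal ((norm (wave G t z))^4)"
        using s by (subst ennreal_plus) (auto simp: ennreal_mult[symmetric])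
      finally show "ennreal (norm (?v t z) powr (10 / 3)) \<le> ennreal (s\<^sup>2) * ennreal ((norm (?v t z))\<^sup>2) + ennreal (1 / s * fourier_const^4) * ennreal ((norm (wave G t z))^4)" .
    qed
    also have "\<dots> = ennreal (s\<^sup>2) * L2sq phys (?v t) + ennreal (1 / s * fourier_const^4) * q t"
      unfolding L2sq_def q_def by (subst nn_integral_add) (auto simp: nn_integral_cmult)
    also have "\<dots> \<le> ennreal (s\<^sup>2) * 4 + ennreal (1 / s * fourier_const^4) * q t"
      by (intro add_right_mono mult_left_mono energy) auto
    also have "ennreal (s\<^sup>2) * 4 = ennreal (4 * s\<^sup>2)"
      by (simp add: ennreal_mult mult.commute)
    finally show ?thesis .
  qed
  then have "(\<integral>\<^sup>+t. \<integral>\<^sup>+z. ennreal (norm (?v t z) powr (10 / 3)) \<partial>phys \<partial>restrict_space lborel {0..1})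
    \<le> (\<integral>\<^sup>+t. ennreal (4 * s\<^sup>2) + ennreal (1 / s * fourier_const^4) * q t \<partial>restrict_space lborel {0..1})"
    by (intro nn_integral_mono)
  also have "\<dots> = ennreal (4 * s\<^sup>2) + ennreal (1 / s * fourier_const^4) * (\<integral>\<^sup>+t. q t \<partial>restrict_space lborel {0..1})"
  proof -
    have [measurable]: "q \<in> borel_measurable (restrict_space lborel {0..1})"
      by (rule measurable_restrict_space1) simp
    show ?thesis
      by (subst nn_integral_add) (auto simp: nn_integral_cmult emeasure_restrict_space space_restrict_space)
  qed
  also have "\<dots> \<le> ennreal (4 * s\<^sup>2) + ennreal (1 / s * fourier_const^4) * (ennreal (exp (1/2)) * (ennreal (quartic_const * real n) * 16))"
  proof (intro add_left_mono mult_left_mono order_trans[OF nn_integral_unit_interval_le_gauss[OF qm]])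
    have "(\<integral>\<^sup>+t. q t \<partial>gauss 1) \<le> ennreal (quartic_const * real n) * (L2sq freq G)\<^sup>2"
      unfolding q_def by (rule L4_estimate[OF n G supp])
    also have "(L2sq freq G)\<^sup>2 \<le> 4\<^sup>2" by (intro power_mono G2) simp
    finally show "(\<integral>\<^sup>+t. q t \<partial>gauss 1) \<le> ennreal (quartic_const * real n) * 16" by (simp add: mult_left_mono)
  qed auto
  also have "\<dots> = ennreal (4 * s\<^sup>2 + (1 / s) * (fourier_const^4 * exp (1/2) * quartic_const * 16 * real n))"
  proof -
    have "(16 :: ennreal) = ennreal 16" by simp
    then have "ennreal (1 / s * fourier_const^4) * (ennreal (exp (1/2)) * (ennreal (quartic_const * real n) * 16))
      = ennreal (1 / s * fourier_const^4 * (exp (1/2) * (quartic_const * real n * 16)))"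
      using s quartic_const_pos by (simp only: ennreal_mult) (subst ennreal_mult; simp add: ennreal_mult)
    then show ?thesis using s quartic_const_pos by (subst ennreal_plus) (auto simp: mult_ac)
  qed
  finally show ?thesis .
qed

lemma powr_norm_measurable: "(\<lambda>c::complex. ennreal (norm c powr p)) \<in> borel_measurable borel"
  by measurable

lemma Lp_norm_leI:
  assumes p: "p > 0" and "(\<integral>\<^sup>+z. ennreal (norm (f z) powr p) \<partial>M) \<le> ennreal c" "c \<ge> 0"
  shows "Lp_norm p M f \<le> ennreal (c powr (1 / p))"
proof -
  let ?I = "\<integral>\<^sup>+z. ennreal (norm (f z) powr p) \<partial>M"
  have "?I < \<infinity>" using assms by (auto intro: le_less_trans)
  moreover have "enn2real ?I \<le> c" using assms enn2real_leI by blast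
  ultimately show ?thesis unfolding Lp_norm_def Let_def
    using p by (auto intro!: ennreal_leI powr_mono2)
qed

lemma Lp_norm_geI:
  assumes p: "p > 0" and "ennreal c \<le> (\<integral>\<^sup>+z. ennreal (norm (f z) powr p) \<partial>M)" "c \<ge> 0"
  shows "ennreal (c powr (1 / p)) \<le> Lp_norm p M f"
proof -
  let ?I = "\<integral>\<^sup>+z. ennreal (norm (f z) powr p) \<partial>M"
  show ?thesis
  proof (cases "?I = \<infinity>")
    case False
    then obtain r where r: "?I = ennreal r" "r \<ge> 0" by (cases ?I) auto
    then have "c \<le> r" using assms(2,3) by simp
    then show ?thesis unfolding Lp_norm_def Let_def r using p assms r by (auto intro!: ennreal_leI powr_mono2)
  qed (simp add: Lp_norm_def)
qed

text \<open>Every admissible \<open>u\<close> agrees, for each time, almost everywhere with the explicit evolution of the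
  localised spectrum \<open>G\<close>, whose lattice frequencies are at most \<open>2 N\<close> in modulus; joint measurability of \<open>u\<close> then
  gives equality of the space-time integrals.\<close>

theorem evolution_upper_bound:
  fixes N :: nat
  assumes chi: "admissible_cutoff chi" and N: "N \<ge> 1"
    and f: "Lp_norm 2 phys f \<le> 1" and ev: "is_evolution chi (real N) f u"
  shows "Lp_norm (10 / 3) spacetime u \<le> ennreal (strichartz_const powr (3 / 10) * real N powr (1 / 5))"
proof -
  from ev obtain h where um: "u \<in> borel_measurable spacetime"
    and h: "is_multiplier_image (cutoff_symbol chi (real N)) f h"
    and ut: "\<And>t. t \<in> {0..1} \<Longrightarrow> is_multiplier_image (propagator_symbol t) h (\<lambda>z. u (t, z))"
    unfolding is_evolution_def by blast
  from h obtain F where F: "has_fourier f F" "has_fourier h (\<lambda>\<zeta>. cutoff_symbol chi (real N) \<zeta> * F \<zeta>)"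
    unfolding is_multiplier_image_def by blast
  define G where "G \<zeta> = cutoff_symbol chi (real N) \<zeta> * F \<zeta>" for \<zeta>
  have hG: "has_fourier h G" using F(2) by (simp add: G_def[abs_def])
  have Gm[measurable]: "G \<in> borel_measurable freq" using hG unfolding has_fourier_def in_L2_iff by blast
  have "L2sq freq G \<le> L2sq freq F"
    by (rule L2sq_mono) (use cutoff_norm_le[OF chi] in \<open>auto simp: G_def norm_mult intro!: mult_left_le_one_le\<close>)
  also have "\<dots> \<le> 4 * L2sq phys f" by (rule has_fourier_norm_le[OF F(1)])
  also have "\<dots> \<le> 4 * 1" using f unfolding Lp_norm_2_le_1_iff by (intro mult_left_mono) auto
  finally have G4: "L2sq freq G \<le> 4" by simp
  have box: "G \<zeta> = 0" if "\<zeta> \<notin> freq_box (real (2 * N))" for \<zeta>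
    using cutoff_support[OF chi N that] by (simp add: G_def)
  have supp: "G \<zeta> = 0" if "snd \<zeta> \<notin> lattice_box (2 * N)" for \<zeta>
  proof (rule box)
    show "\<zeta> \<notin> freq_box (real (2 * N))"
      using that by (auto simp: freq_box_def lattice_box_def)
  qed
  have Gi: "integrable freq G"
  proof -
    have "integrable freq (\<lambda>\<zeta>. G \<zeta> * indicator (freq_box (real (2 * N))) \<zeta>)"
    proof (rule integrable_L2_mult)
      show "L2sq freq G < \<infinity>" using G4 by (rule le_less_trans) simp
      have "L2sq freq (\<lambda>\<zeta>. indicator (freq_box (real (2 * N))) \<zeta>) = (\<integral>\<^sup>+\<zeta>. indicator (freq_box (real (2 * N))) \<zeta> \<partial>freq)"
        unfolding L2sq_def by (intro nn_integral_cong) (auto simp: indicator_def)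
      also have "\<dots> = emeasure freq (freq_box (real (2 * N)))" by simp
      also have "\<dots> < \<infinity>" by (rule emeasure_freq_box)
      finally show "L2sq freq (\<lambda>\<zeta>. indicator (freq_box (real (2 * N))) \<zeta>) < \<infinity>" .
    qed measurable
    moreover have "G \<zeta> * indicator (freq_box (real (2 * N))) \<zeta> = G \<zeta>" for \<zeta>
      using box[of \<zeta>] by (auto simp: indicator_def)
    ultimately show ?thesis by (simp only:)
  qed
  have pm[measurable]: "propagator_symbol t \<in> borel_measurable freq" for t
    unfolding propagator_symbol_eq[abs_def] by measurable
  have rep: "AE z in phys. u (t, z) = complex_of_real fourier_const * wave G t z" if t: "t \<in> {0..1}" for t
  proof -
    from ut[OF t] obtain H where H: "has_fourier h H" "has_fourier (\<lambda>z. u (t, z)) (\<lambda>\<zeta>. propagator_symbol t \<zeta> * H \<zeta>)"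
      unfolding is_multiplier_image_def by blast
    have Hm: "(\<lambda>\<zeta>. propagator_symbol t \<zeta> * H \<zeta>) \<in> borel_measurable freq"
      using H(2) unfolding has_fourier_def in_L2_iff by blast
    have pGm: "(\<lambda>\<zeta>. propagator_symbol t \<zeta> * G \<zeta>) \<in> borel_measurable freq" by measurable
    have ae: "AE \<zeta> in freq. propagator_symbol t \<zeta> * H \<zeta> = propagator_symbol t \<zeta> * G \<zeta>"
      using has_fourier_unique[OF H(1) hG] by eventually_elim simp
    have pGi: "integrable freq (\<lambda>\<zeta>. propagator_symbol t \<zeta> * G \<zeta>)"
      by (rule Bochner_Integration.integrable_bound[OF Gi pGm]) (simp add: propagator_symbol_eq norm_mult)
    have "integrable freq (\<lambda>\<zeta>. propagator_symbol t \<zeta> * H \<zeta>)"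
      using integrable_cong_AE[OF Hm pGm ae] pGi by simp
    then have "AE z in phys. u (t, z) = fourier_inverse (\<lambda>\<zeta>. propagator_symbol t \<zeta> * H \<zeta>) z"
      by (rule has_fourier_imp_fourier_inverse[OF H(2)])
    moreover have "AE z in phys. fourier_inverse (\<lambda>\<zeta>. propagator_symbol t \<zeta> * H \<zeta>) z = complex_of_real fourier_const * wave G t z"
      unfolding fourier_inverse_propagator[symmetric] by (intro AE_I2 fourier_inverse_cong_AE[OF Hm pGm ae])
    ultimately show ?thesis by eventually_elim simp
  qed
  interpret P: sigma_finite_measure phys by (rule sigma_finite_phys)
  \<comment> \<open>This \<open>s\<close> balances \<open>s\<^sup>2\<close> against \<open>N / s\<close>.\<close>
  define s where "s = real N powr (1 / 3)"
  have s: "s > 0" using N by (simp add: s_def)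
  have "(\<integral>\<^sup>+x. ennreal (norm (u x) powr (10 / 3)) \<partial>spacetime)
    = (\<integral>\<^sup>+t. \<integral>\<^sup>+z. ennreal (norm (u (t, z)) powr (10 / 3)) \<partial>phys \<partial>restrict_space lborel {0..1})"
    using measurable_compose[OF um powr_norm_measurable] unfolding spacetime_def by (intro P.nn_integral_fst[symmetric])
  also have "\<dots> = (\<integral>\<^sup>+t. \<integral>\<^sup>+z. ennreal (norm (complex_of_real fourier_const * wave G t z) powr (10 / 3)) \<partial>phys \<partial>restrict_space lborel {0..1})"
  proof (rule nn_integral_cong)
    fix t :: real assume "t \<in> space (restrict_space lborel {0..1})"
    then have t: "t \<in> {0..1}" by (simp add: space_restrict_space)
    show "(\<integral>\<^sup>+z. ennreal (norm (u (t, z)) powr (10 / 3)) \<partial>phys)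
      = (\<integral>\<^sup>+z. ennreal (norm (complex_of_real fourier_const * wave G t z) powr (10 / 3)) \<partial>phys)"
      by (rule nn_integral_cong_AE) (use rep[OF t] in eventually_elim, simp)
  qed
  also have "\<dots> \<le> ennreal (4 * s\<^sup>2 + (1 / s) * (fourier_const^4 * exp (1/2) * quartic_const * 16 * real (2 * N)))"
    by (rule wave_energy_bound[OF _ s Gi G4 supp]) (use N in auto)
  also have "4 * s\<^sup>2 + (1 / s) * (fourier_const^4 * exp (1/2) * quartic_const * 16 * real (2 * N)) = strichartz_const * real N powr (2 / 3)"
  proof -
    have 1: "s\<^sup>2 = real N powr (2 / 3)" unfolding s_def power2_eq_square by (subst powr_add[symmetric]) simp
    have "real N = real N powr (1 / 3) * real N powr (2 / 3)"
      using N by (subst powr_add[symmetric]) simp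
    then have 2: "(1 / s) * real N = real N powr (2 / 3)"
      using s unfolding s_def by (simp add: field_simps)
    have "4 * s\<^sup>2 + (1 / s) * (fourier_const^4 * exp (1/2) * quartic_const * 16 * real (2 * N))
       = 4 * s\<^sup>2 + fourier_const^4 * exp (1/2) * quartic_const * 32 * ((1 / s) * real N)"
      by simp
    then show ?thesis unfolding 1 2 by (simp add: strichartz_const_def distrib_right)
  qed
  finally have I: "(\<integral>\<^sup>+x. ennreal (norm (u x) powr (10 / 3)) \<partial>spacetime) \<le> ennreal (strichartz_const * real N powr (2 / 3))" .
  have "Lp_norm (10 / 3) spacetime u \<le> ennreal ((strichartz_const * real N powr (2 / 3)) powr (1 / (10 / 3)))"
    by (rule Lp_norm_leI[OF _ I]) (use strichartz_const_pos in auto)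
  also have "(strichartz_const * real N powr (2 / 3)) powr (1 / (10 / 3)) = strichartz_const powr (3 / 10) * real N powr (1 / 5)"
    using strichartz_const_pos by (simp add: powr_mult powr_powr)
  finally show ?thesis .
qed

section \<open>The lower bound: concentration on a null line\<close>

text \<open>A continuous bump: continuity is what Plancherel's identity above asks for, and the support
  \<open>|\<xi>| \<le> 1/2\<close> keeps all phases in \<open>wave_focus_lower\<close> at most 1 in modulus.\<close>

definition tent :: "real \<Rightarrow> real" where "tent \<xi> = max 0 (1/2 - \<bar>\<xi>\<bar>)"

lemma tent_measurable [measurable]: "tent \<in> borel_measurable borel"
  unfolding tent_def by measurable

lemma tent_bounds: "0 \<le> tent \<xi>" "tent \<xi> \<le> 1/2" "tent \<xi> \<noteq> 0 \<Longrightarrow> \<bar>\<xi>\<bar> \<le> 1/2"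
  by (auto simp: tent_def max_def split: if_splits)

lemma tent_mass: "ennreal (1/8) \<le> (\<integral>\<^sup>+\<xi>. ennreal (tent \<xi>) \<partial>lborel)"
proof -
  have "ennreal (1/8) = (\<integral>\<^sup>+\<xi>. ennreal (1/4) * indicator {-1/4..1/4::real} \<xi> \<partial>lborel)"
  proof -
    have "(\<integral>\<^sup>+\<xi>. ennreal (1/4) * indicator {-1/4..1/4::real} \<xi> \<partial>lborel) = ennreal (1/4) * ennreal (1/4 - -1/4)"
      by (subst nn_integral_cmult_indicator, simp, subst emeasure_lborel_Icc, simp, rule refl)
    also have "\<dots> = ennreal (1/8)" by (subst ennreal_mult[symmetric]) auto
    finally show ?thesis ..
  qed
  also have "\<dots> \<le> (\<integral>\<^sup>+\<xi>. ennreal (tent \<xi>) \<partial>lborel)"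
    by (intro nn_integral_mono) (auto simp: indicator_def tent_def abs_le_iff intro!: ennreal_leI)
  finally show ?thesis .
qed

lemma tent_square_mass: "(\<integral>\<^sup>+\<xi>. ennreal ((tent \<xi>)\<^sup>2) \<partial>lborel) \<le> 1"
proof -
  have "(\<integral>\<^sup>+\<xi>. ennreal ((tent \<xi>)\<^sup>2) \<partial>lborel) \<le> (\<integral>\<^sup>+\<xi>. indicator {-1/2..1/2::real} \<xi> \<partial>lborel)"
  proof (intro nn_integral_mono)
    fix \<xi>
    have "(tent \<xi>)\<^sup>2 \<le> 1" using tent_bounds[of \<xi>] by (simp add: power_le_one)
    then show "ennreal ((tent \<xi>)\<^sup>2) \<le> indicator {-1/2..1/2::real} \<xi>"
      using tent_bounds(3)[of \<xi>] by (cases "tent \<xi> = 0") (auto simp: indicator_def abs_le_iff ennreal_leI[of _ 1, simplified])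
  qed
  also have "\<dots> = 1" by simp
  finally show ?thesis .
qed

definition null_line :: "nat \<Rightarrow> (int \<times> int) set" where
  "null_line K = (\<lambda>k. (int k, - int k)) ` {..<K}"

lemma finite_null_line [simp]: "finite (null_line K)" by (simp add: null_line_def)

lemma card_null_line: "card (null_line K) = K"
  unfolding null_line_def by (subst card_image) (auto simp: inj_on_def)

text \<open>Of \<open>L\<^sup>2\<close> norm of order 1, spread evenly over \<open>K\<close> points of the null line \<open>k\<^sub>2 = - k\<^sub>1\<close>.\<close>

definition null_profile :: "nat \<Rightarrow> real \<times> int \<times> int \<Rightarrow> real" where
  "null_profile K \<zeta> = (if snd \<zeta> \<in> null_line K then tent (fst \<zeta>) / sqrt (real K) else 0)"

lemma null_profile_measurable [measurable]: "null_profile K \<in> borel_measurable freq"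
  unfolding null_profile_def by measurable

lemma null_profile_nonneg: "null_profile K \<zeta> \<ge> 0"
  using tent_bounds by (simp add: null_profile_def)

lemma null_profile_le_1: "K \<ge> 1 \<Longrightarrow> null_profile K \<zeta> \<le> 1"
proof -
  assume "K \<ge> 1"
  then have "1 \<le> sqrt (real K)" by simp
  moreover have "tent (fst \<zeta>) \<le> 1" using tent_bounds(2)[of "fst \<zeta>"] by simp
  ultimately have "tent (fst \<zeta>) \<le> sqrt (real K)" by linarith
  then have "tent (fst \<zeta>) / sqrt (real K) \<le> 1" by (simp add: divide_le_eq)
  then show ?thesis by (simp add: null_profile_def)
qed

lemma null_profile_support:
  assumes "null_profile K \<zeta> \<noteq> 0"
  obtains k where "\<bar>fst \<zeta>\<bar> \<le> 1/2" "snd \<zeta> = (int k, - int k)" "k < K"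
  using assms tent_bounds(3)[of "fst \<zeta>"]
  by (auto simp: null_profile_def null_line_def split: if_splits)

lemma null_profile_integrable:
  assumes K: "K \<ge> 1"
  shows "integrable freq (\<lambda>\<zeta>. complex_of_real (null_profile K \<zeta>))"
proof (rule integrable_on_freq_box[where b=1 and n="real K"])
  show "norm (complex_of_real (null_profile K \<zeta>)) \<le> 1" for \<zeta>
    using null_profile_nonneg[of K \<zeta>] null_profile_le_1[OF K, of \<zeta>] by simp
  fix \<zeta> assume z: "\<zeta> \<notin> freq_box (real K)"
  show "complex_of_real (null_profile K \<zeta>) = 0"
  proof (rule ccontr)
    assume "complex_of_real (null_profile K \<zeta>) \<noteq> 0"
    then have "null_profile K \<zeta> \<noteq> 0" by simp
    then obtain k where "\<bar>fst \<zeta>\<bar> \<le> 1/2" "snd \<zeta> = (int k, - int k)" "k < K" by (rule null_profile_support)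
    then have "\<zeta> \<in> freq_box (real K)" using K by (cases \<zeta>) (auto simp: freq_box_def)
    with z show False by simp
  qed
qed measurable

lemma null_profile_nn_integral:
  assumes [measurable]: "f \<in> borel_measurable borel" and f0: "f 0 = 0"
  shows "(\<integral>\<^sup>+\<zeta>. f (null_profile K \<zeta>) \<partial>freq) = of_nat K * (\<integral>\<^sup>+\<xi>. f (tent \<xi> / sqrt (real K)) \<partial>lborel)"
proof -
  have "(\<integral>\<^sup>+\<zeta>. f (null_profile K \<zeta>) \<partial>freq) = (\<integral>\<^sup>+k. (\<integral>\<^sup>+\<xi>. f (null_profile K (\<xi>, k)) \<partial>lborel) \<partial>count_space UNIV)"
    by (rule nn_integral_freq_swap) measurable
  also have "\<dots> = (\<Sum>k\<in>null_line K. \<integral>\<^sup>+\<xi>. f (null_profile K (\<xi>, k)) \<partial>lborel)"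
    by (rule nn_integral_count_space') (auto simp: null_profile_def f0)
  also have "\<dots> = (\<Sum>k\<in>null_line K. \<integral>\<^sup>+\<xi>. f (tent \<xi> / sqrt (real K)) \<partial>lborel)"
    by (intro sum.cong refl nn_integral_cong) (simp add: null_profile_def)
  finally show ?thesis by (simp add: card_null_line)
qed

lemma null_profile_L2:
  assumes K: "K \<ge> 1"
  shows "L2sq freq (\<lambda>\<zeta>. complex_of_real (null_profile K \<zeta>)) \<le> 1"
proof -
  have "L2sq freq (\<lambda>\<zeta>. complex_of_real (null_profile K \<zeta>)) = (\<integral>\<^sup>+\<zeta>. (\<lambda>x. ennreal (x\<^sup>2)) (null_profile K \<zeta>) \<partial>freq)"
    unfolding L2sq_def by simp
  also have "\<dots> = of_nat K * (\<integral>\<^sup>+\<xi>. ennreal ((tent \<xi> / sqrt (real K))\<^sup>2) \<partial>lborel)"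
    by (rule null_profile_nn_integral) auto
  also have "(\<integral>\<^sup>+\<xi>. ennreal ((tent \<xi> / sqrt (real K))\<^sup>2) \<partial>lborel) = ennreal (1 / real K) * (\<integral>\<^sup>+\<xi>. ennreal ((tent \<xi>)\<^sup>2) \<partial>lborel)"
    by (subst nn_integral_cmult[symmetric]) (auto simp: power_divide ennreal_mult[symmetric])
  also have "of_nat K * (ennreal (1 / real K) * (\<integral>\<^sup>+\<xi>. ennreal ((tent \<xi>)\<^sup>2) \<partial>lborel)) = (\<integral>\<^sup>+\<xi>. ennreal ((tent \<xi>)\<^sup>2) \<partial>lborel)"
  proof -
    have "of_nat K * ennreal (1 / real K) = 1"
      using K by (simp add: ennreal_of_nat_eq_real_of_nat ennreal_mult[symmetric])
    then show ?thesis by (simp add: mult.assoc[symmetric])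
  qed
  finally show ?thesis using tent_square_mass by simp
qed

lemma null_profile_mass:
  assumes K: "K \<ge> 1"
  shows "sqrt (real K) / 8 \<le> (\<integral>\<zeta>. null_profile K \<zeta> \<partial>freq)"
proof -
  have i: "integrable freq (null_profile K)"
    using null_profile_integrable[OF K] by (simp add: complex_of_real_integrable_eq)
  have "ennreal (sqrt (real K) / 8) = of_nat K * (ennreal (1 / sqrt (real K)) * ennreal (1/8))"
  proof -
    have "real K * (1 / sqrt (real K) * (1/8)) = sqrt (real K) / 8"
      using K by (simp add: field_simps)
    then show ?thesis by (simp add: ennreal_of_nat_eq_real_of_nat ennreal_mult[symmetric])
  qed
  also have "\<dots> \<le> of_nat K * (ennreal (1 / sqrt (real K)) * (\<integral>\<^sup>+\<xi>. ennreal (tent \<xi>) \<partial>lborel))"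
    by (intro mult_left_mono tent_mass) auto
  also have "\<dots> = of_nat K * (\<integral>\<^sup>+\<xi>. ennreal (tent \<xi> / sqrt (real K)) \<partial>lborel)"
    using tent_bounds(1) by (subst nn_integral_cmult[symmetric]) (auto simp: ennreal_mult[symmetric])
  also have "\<dots> = (\<integral>\<^sup>+\<zeta>. ennreal (null_profile K \<zeta>) \<partial>freq)"
    by (rule null_profile_nn_integral[symmetric]) auto
  also have "\<dots> = ennreal (\<integral>\<zeta>. null_profile K \<zeta> \<partial>freq)"
    by (rule nn_integral_eq_integral[OF i]) (simp add: null_profile_nonneg)
  finally show ?thesis
    using null_profile_nonneg by (subst (asm) ennreal_le_iff) (auto intro!: integral_nonneg_AE)
qed

lemma cos_ge_half: "\<bar>\<theta>\<bar> \<le> 1 \<Longrightarrow> cos \<theta> \<ge> 1/2" for \<theta> :: real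
proof -
  assume "\<bar>\<theta>\<bar> \<le> 1"
  then have "cos (pi / 3) \<le> cos \<bar>\<theta>\<bar>"
    using pi_gt3 by (intro cos_monotone_0_pi_le) auto
  then show ?thesis by (simp add: cos_60)
qed

text \<open>The strip \<open>0 \<le> y\<^sub>1 - y\<^sub>2 \<le> 1/(2K)\<close>, on which the \<open>K\<close> characters of the null line have almost equal phases.
  Taking \<open>y\<^sub>1\<close> in \<open>[1,2]\<close> keeps it inside the fundamental domain.\<close>

definition focus :: "nat \<Rightarrow> (real \<times> real) set" where
  "focus K = {(y1, y2). 1 \<le> y1 \<and> y1 \<le> 2 \<and> y1 - 1 / (2 * real K) \<le> y2 \<and> y2 \<le> y1}"

lemma focus_measure:
  assumes K: "K \<ge> 1"
  shows "focus K \<in> sets (torus \<Otimes>\<^sub>M torus)"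
    and "emeasure (torus \<Otimes>\<^sub>M torus) (focus K) = ennreal (1 / (2 * real K))"
proof -
  interpret T: finite_measure torus by (rule torus_finite)
  have t: "(\<lambda>x. x) \<in> borel_measurable torus" by (rule torus_le_borel) simp
  have f[measurable]: "fst \<in> borel_measurable (torus \<Otimes>\<^sub>M torus)" "snd \<in> borel_measurable (torus \<Otimes>\<^sub>M torus)"
    using measurable_compose[OF measurable_fst t] measurable_compose[OF measurable_snd t] by auto
  have K1: "1 / (2 * real K) \<le> 1/2" using K by (simp add: field_simps)
  have "{y \<in> space (torus \<Otimes>\<^sub>M torus). 1 \<le> fst y \<and> fst y \<le> 2 \<and> fst y - 1 / (2 * real K) \<le> snd y \<and> snd y \<le> fst y} \<in> sets (torus \<Otimes>\<^sub>M torus)"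
    by measurable
  also have "{y \<in> space (torus \<Otimes>\<^sub>M torus). 1 \<le> fst y \<and> fst y \<le> 2 \<and> fst y - 1 / (2 * real K) \<le> snd y \<and> snd y \<le> fst y} = focus K"
    using pi_gt3 K1 by (auto simp: focus_def space_pair_measure)
  finally show S: "focus K \<in> sets (torus \<Otimes>\<^sub>M torus)" .
  have em: "emeasure torus {a..b} = ennreal (b - a)" if "0 \<le> a" "a \<le> b" "b < 2 * pi" for a b
    unfolding torus_def using that by (subst emeasure_restrict_space) auto
  have "emeasure (torus \<Otimes>\<^sub>M torus) (focus K) = (\<integral>\<^sup>+y. emeasure torus (Pair y -` focus K) \<partial>torus)"
    by (rule T.emeasure_pair_measure_alt[OF S])
  also have "\<dots> = (\<integral>\<^sup>+y. ennreal (1 / (2 * real K)) * indicator {1..2} y \<partial>torus)"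
  proof (rule nn_integral_cong)
    fix y :: real
    show "emeasure torus (Pair y -` focus K) = ennreal (1 / (2 * real K)) * indicator {1..2} y"
    proof (cases "y \<in> {1..2}")
      case True
      then have "Pair y -` focus K = {y - 1 / (2 * real K)..y}" by (auto simp: focus_def)
      then show ?thesis using True K1 pi_gt3 by (simp add: em)
    next
      case False
      then have "Pair y -` focus K = {}" by (auto simp: focus_def)
      then show ?thesis using False by simp
    qed
  qed
  also have "\<dots> = ennreal (1 / (2 * real K)) * emeasure torus {1..2}"
    using pi_gt3 by (intro nn_integral_cmult_indicator) (auto simp: torus_def sets_restrict_space_iff)
  also have "emeasure torus {1..2} = 1" using pi_gt3 by (subst em) auto
  finally show "emeasure (torus \<Otimes>\<^sub>M torus) (focus K) = ennreal (1 / (2 * real K))" by simp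
qed

text \<open>On the null line the phase is \<open>x \<xi> - t \<xi>\<^sup>2 + k (y\<^sub>1 - y\<^sub>2)\<close>, and its three terms are at most \<open>1/4\<close>, \<open>1/4\<close> and
  \<open>1/2\<close> in modulus. So no cancellation occurs: the real part is at least half of the total mass of the
  spectrum.\<close>

lemma wave_focus_lower:
  assumes K: "K \<ge> 1" and t: "t \<in> {0..1}" and x: "\<bar>x\<bar> \<le> 1/2" and y: "(y1, y2) \<in> focus K"
  shows "sqrt (real K) / 16 \<le> norm (wave (\<lambda>\<zeta>. complex_of_real (null_profile K \<zeta>)) t (x, y1, y2))"
proof -
  let ?G = "\<lambda>\<zeta>. complex_of_real (null_profile K \<zeta>)"
  have z: "(x, y1, y2) \<in> space phys"
  proof -
    have "1 / (2 * real K) \<le> 1/2" using K by (simp add: field_simps)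
    then have "0 \<le> y1" "y1 < 2 * pi" "0 \<le> y2" "y2 < 2 * pi"
      using y pi_gt3 unfolding focus_def by (simp; linarith)+
    then show ?thesis by (simp add: space_phys)
  qed
  let ?h = "\<lambda>\<zeta>. ?G \<zeta> * cis (- t * dispersion \<zeta>) * plane_wave (x, y1, y2) \<zeta>"
  have i: "integrable freq ?h"
  proof (rule Bochner_Integration.integrable_bound[OF null_profile_integrable[OF K]])
    have [measurable]: "plane_wave (x, y1, y2) \<in> borel_measurable freq"
      by (rule plane_wave_measurable[OF measurable_const[OF z] measurable_ident_sets[OF refl]])
    show "?h \<in> borel_measurable freq" by measurable
  qed (simp add: norm_mult)
  have pw: "1/2 * null_profile K \<zeta> \<le> Re (?h \<zeta>)" for \<zeta>
  proof (cases "null_profile K \<zeta> = 0")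
    case False
    then obtain k where k: "\<bar>fst \<zeta>\<bar> \<le> 1/2" "snd \<zeta> = (int k, - int k)" "k < K" by (rule null_profile_support)
    define \<xi> where "\<xi> = fst \<zeta>"
    have \<zeta>: "\<zeta> = (\<xi>, int k, - int k)" using k(2) by (simp add: \<xi>_def prod_eq_iff)
    define \<theta> where "\<theta> = - t * \<xi>\<^sup>2 + (x * \<xi> + real k * (y1 - y2))"
    have h: "?h \<zeta> = complex_of_real (null_profile K \<zeta>) * cis \<theta>"
      by (simp add: \<zeta> dispersion_def plane_wave_def cis_mult \<theta>_def algebra_simps)
    have "\<bar>\<xi>\<bar>\<^sup>2 \<le> (1/2)\<^sup>2" using k(1) by (intro power_mono) (auto simp: \<xi>_def)
    then have "\<xi>\<^sup>2 \<le> 1/4" by (simp add: power2_eq_square)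
    then have 1: "0 \<le> t * \<xi>\<^sup>2" "t * \<xi>\<^sup>2 \<le> 1/4" using t mult_mono[of t 1 "\<xi>\<^sup>2" "1/4"] by auto
    have 2: "\<bar>x * \<xi>\<bar> \<le> 1/4" using mult_mono[OF x k(1)] by (simp add: abs_mult \<xi>_def)
    have 3: "0 \<le> real k * (y1 - y2)" "real k * (y1 - y2) \<le> 1/2"
    proof -
      have d: "0 \<le> y1 - y2" "y1 - y2 \<le> 1 / (2 * real K)" using y by (auto simp: focus_def)
      then show "0 \<le> real k * (y1 - y2)" by simp
      have "real k * (y1 - y2) \<le> real K * (1 / (2 * real K))" using d k(3) by (intro mult_mono) auto
      also have "\<dots> = 1/2" using K by simp
      finally show "real k * (y1 - y2) \<le> 1/2" .
    qed
    have "\<bar>\<theta>\<bar> \<le> 1" using 1 2 3 unfolding \<theta>_def by linarith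
    then have "1/2 * null_profile K \<zeta> \<le> cos \<theta> * null_profile K \<zeta>"
      by (intro mult_right_mono cos_ge_half null_profile_nonneg)
    then show ?thesis unfolding h by (simp add: mult.commute)
  qed simp
  have "sqrt (real K) / 16 \<le> 1/2 * (\<integral>\<zeta>. null_profile K \<zeta> \<partial>freq)"
    using null_profile_mass[OF K] by simp
  also have "\<dots> = (\<integral>\<zeta>. 1/2 * null_profile K \<zeta> \<partial>freq)" by simp
  also have "\<dots> \<le> (\<integral>\<zeta>. Re (?h \<zeta>) \<partial>freq)"
  proof (rule integral_mono[OF _ integrable_Re[OF i] pw])
    show "integrable freq (\<lambda>\<zeta>. 1/2 * null_profile K \<zeta>)"
      using null_profile_integrable[OF K] by (simp add: complex_of_real_integrable_eq)
  qed
  also have "\<dots> = Re (wave ?G t (x, y1, y2))"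
    unfolding wave_def by (rule Bochner_Integration.integral_Re[OF i])
  also have "\<dots> \<le> norm (wave ?G t (x, y1, y2))" by (rule complex_Re_le_cmod)
  finally show ?thesis .
qed

text \<open>The spectrum lies where the cutoff equals 1, because \<open>1/4 + 2 K\<^sup>2 \<le> (2 K)\<^sup>2\<close>; hence the datum is its own
  localisation and the evolution is explicit.\<close>

theorem evolution_lower_bound:
  fixes N K :: nat
  assumes chi: "admissible_cutoff chi" and K: "K \<ge> 1" and N: "N = 2 * K"
  obtains f u where "in_Lp 2 phys f" "Lp_norm 2 phys f \<le> 1" "is_evolution chi (real N) f u"
    "ennreal (fourier_const / (16 * sqrt 2) * real N powr (1 / 5)) \<le> Lp_norm (10 / 3) spacetime u"
proof -
  define G where "G \<zeta> = complex_of_real (null_profile K \<zeta>)" for \<zeta>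
  have Gi: "integrable freq G" unfolding G_def[abs_def] by (rule null_profile_integrable[OF K])
  have Gm[measurable]: "G \<in> borel_measurable freq" by (rule borel_measurable_integrable[OF Gi])
  have G1: "L2sq freq G \<le> 1" unfolding G_def[abs_def] by (rule null_profile_L2[OF K])
  have Gn: "norm (G \<zeta>) \<le> 1" for \<zeta>
    using null_profile_nonneg[of K \<zeta>] null_profile_le_1[OF K, of \<zeta>] by (simp add: G_def)
  have has: "has_fourier (fourier_inverse (\<lambda>\<zeta>. propagator_symbol t \<zeta> * G \<zeta>)) (\<lambda>\<zeta>. propagator_symbol t \<zeta> * G \<zeta>)" for t
  proof -
    have m: "(\<lambda>\<zeta>. propagator_symbol t \<zeta> * G \<zeta>) \<in> borel_measurable freq"
      unfolding propagator_symbol_eq by measurable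
    have i: "integrable freq (\<lambda>\<zeta>. propagator_symbol t \<zeta> * G \<zeta>)"
      by (rule Bochner_Integration.integrable_bound[OF Gi m]) (simp add: propagator_symbol_eq norm_mult)
    have "L2sq freq (\<lambda>\<zeta>. propagator_symbol t \<zeta> * G \<zeta>) = L2sq freq G"
      by (simp add: L2sq_def propagator_symbol_eq norm_mult)
    then have fin: "L2sq freq (\<lambda>\<zeta>. propagator_symbol t \<zeta> * G \<zeta>) < \<infinity>" using G1 by (simp add: le_less_trans)
    have "L2sq phys (fourier_inverse (\<lambda>\<zeta>. propagator_symbol t \<zeta> * G \<zeta>)) = L2sq freq (\<lambda>\<zeta>. propagator_symbol t \<zeta> * G \<zeta>)"
    proof (rule plancherel_continuous[OF i])
      show "norm (propagator_symbol t \<zeta> * G \<zeta>) \<le> 1" for \<zeta>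
        using Gn[of \<zeta>] by (simp add: propagator_symbol_eq norm_mult)
      show "continuous_on UNIV (\<lambda>\<xi>. propagator_symbol t (\<xi>, k) * G (\<xi>, k))" for k
      proof -
        have "continuous_on UNIV (\<lambda>\<xi>. null_profile K (\<xi>, k))"
          unfolding null_profile_def tent_def by (cases "k \<in> null_line K") (use K in \<open>auto intro!: continuous_intros\<close>)
        then show ?thesis
          unfolding propagator_symbol_eq G_def dispersion_def split_beta' by (intro continuous_intros) auto
      qed
    qed
    from has_fourier_fourier_inverse[OF i fin this] show ?thesis .
  qed
  define f where "f = fourier_inverse G"
  have p0: "(\<lambda>\<zeta>. propagator_symbol 0 \<zeta> * G \<zeta>) = G" by (simp add: propagator_symbol_eq)
  have hf: "has_fourier f G" using has[of 0] unfolding p0 f_def .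
  have f2: "L2sq phys f \<le> 1" unfolding f_def using L2sq_fourier_inverse_le[OF Gi] G1 by (rule order_trans)
  have fm: "f \<in> borel_measurable phys" unfolding f_def by measurable
  define u where "u x = complex_of_real fourier_const * wave G (fst x) (snd x)" for x
  have um: "u \<in> borel_measurable spacetime"
  proof -
    have "(\<lambda>x. (fst x, snd x)) \<in> measurable spacetime (borel \<Otimes>\<^sub>M phys)"
    proof (rule measurable_Pair)
      have "(\<lambda>t. t) \<in> borel_measurable (restrict_space lborel {0..1::real})"
        by (rule measurable_restrict_space1) simp
      then show "fst \<in> borel_measurable spacetime"
        unfolding spacetime_def by (rule measurable_compose[OF measurable_fst])
      show "snd \<in> measurable spacetime phys" unfolding spacetime_def by (rule measurable_snd)
    qed
    moreover have "(\<lambda>x. complex_of_real fourier_const * wave G (fst x) (snd x)) \<in> borel_measurable (borel \<Otimes>\<^sub>M phys)"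
      by measurable
    ultimately show ?thesis
      unfolding u_def using measurable_compose by fastforce
  qed
  have cut: "cutoff_symbol chi (real N) \<zeta> * G \<zeta> = G \<zeta>" for \<zeta>
  proof (cases "null_profile K \<zeta> = 0")
    case False
    then obtain k where k: "\<bar>fst \<zeta>\<bar> \<le> 1/2" "snd \<zeta> = (int k, - int k)" "k < K" by (rule null_profile_support)
    have "\<bar>fst \<zeta>\<bar>\<^sup>2 \<le> 1\<^sup>2" using k(1) by (intro power_mono) auto
    then have a: "(fst \<zeta>)\<^sup>2 \<le> 1" by simp
    have b: "(real k)\<^sup>2 \<le> (real K)\<^sup>2" using k(3) by (intro power_mono) auto
    have c: "1 \<le> (real K)\<^sup>2" using K by simp
    have "(fst \<zeta>)\<^sup>2 + ((real k)\<^sup>2 + (real k)\<^sup>2) \<le> 4 * (real K)\<^sup>2" using a b c by linarith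
    then have "(fst \<zeta>)\<^sup>2 + ((of_int (int k))\<^sup>2 + (of_int (- int k))\<^sup>2) \<le> (real N)\<^sup>2"
      by (simp add: N power_mult_distrib)
    then have "cutoff_symbol chi (real N) (fst \<zeta>, int k, - int k) = 1"
      using K N by (intro cutoff_eq_1[OF chi]) auto
    then show ?thesis using k(2) by (metis mult_1 prod.collapse)
  qed (simp add: G_def)
  have ut: "(\<lambda>z. u (t, z)) = fourier_inverse (\<lambda>\<zeta>. propagator_symbol t \<zeta> * G \<zeta>)" for t
    by (simp add: u_def fun_eq_iff fourier_inverse_propagator)
  have ev: "is_evolution chi (real N) f u"
    unfolding is_evolution_def is_multiplier_image_def
  proof (intro conjI um exI[of _ f] exI[of _ G] ballI hf)
    show "has_fourier f (\<lambda>\<zeta>. cutoff_symbol chi (real N) \<zeta> * G \<zeta>)" unfolding cut by (rule hf)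
    show "has_fourier (\<lambda>z. u (t, z)) (\<lambda>\<zeta>. propagator_symbol t \<zeta> * G \<zeta>)" for t unfolding ut by (rule has)
  qed
  define v where "v = fourier_const * sqrt (real K) / 16"
  have v: "v \<ge> 0" using fourier_const_pos by (simp add: v_def)
  interpret P: sigma_finite_measure phys by (rule sigma_finite_phys)
  interpret T: sigma_finite_measure "torus \<Otimes>\<^sub>M torus" by (rule sigma_finite_torus2)
  have slice: "ennreal (v powr (10 / 3) * (1 / (2 * real K))) \<le> (\<integral>\<^sup>+z. ennreal (norm (u (t, z)) powr (10 / 3)) \<partial>phys)"
    if t: "t \<in> {0..1}" for t
  proof -
    have S: "{- 1/2..1/2::real} \<times> focus K \<in> sets phys"
      unfolding phys_def using focus_measure(1)[OF K] by (intro pair_measureI) auto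
    have "emeasure phys ({- 1/2..1/2} \<times> focus K) = emeasure lborel {- 1/2..1/2::real} * emeasure (torus \<Otimes>\<^sub>M torus) (focus K)"
      unfolding phys_def using focus_measure(1)[OF K] by (intro T.emeasure_pair_measure_Times) auto
    then have E: "emeasure phys ({- 1/2..1/2} \<times> focus K) = ennreal (1 / (2 * real K))"
      by (simp add: focus_measure(2)[OF K])
    have "ennreal (v powr (10 / 3) * (1 / (2 * real K))) = ennreal (v powr (10 / 3)) * emeasure phys ({- 1/2..1/2} \<times> focus K)"
      unfolding E by (rule ennreal_mult) auto
    also have "\<dots> = (\<integral>\<^sup>+z. ennreal (v powr (10 / 3)) * indicator ({- 1/2..1/2} \<times> focus K) z \<partial>phys)"
      by (rule nn_integral_cmult_indicator[symmetric, OF S])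
    also have "\<dots> \<le> (\<integral>\<^sup>+z. ennreal (norm (u (t, z)) powr (10 / 3)) \<partial>phys)"
    proof (intro nn_integral_mono)
      fix z :: "real \<times> real \<times> real"
      show "ennreal (v powr (10 / 3)) * indicator ({- 1/2..1/2} \<times> focus K) z \<le> ennreal (norm (u (t, z)) powr (10 / 3))"
      proof (cases "z \<in> {- 1/2..1/2} \<times> focus K")
        case True
        then obtain x y1 y2 where z: "z = (x, y1, y2)" "\<bar>x\<bar> \<le> 1/2" "(y1, y2) \<in> focus K"
          by (cases z) (auto simp: abs_le_iff)
        have "sqrt (real K) / 16 \<le> norm (wave G t z)"
          unfolding G_def z(1) by (rule wave_focus_lower[OF K t z(2,3)])
        then have "v \<le> norm (u (t, z))"
          using mult_left_mono[of "sqrt (real K) / 16" "norm (wave G t z)" fourier_const] fourier_const_pos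
          by (simp add: v_def u_def norm_mult)
        then have "v powr (10 / 3) \<le> norm (u (t, z)) powr (10 / 3)" using v by (intro powr_mono2) auto
        then show ?thesis using True by (simp add: ennreal_leI)
      qed simp
    qed
    finally show ?thesis .
  qed
  have "ennreal (v powr (10 / 3) * (1 / (2 * real K))) = (\<integral>\<^sup>+t. ennreal (v powr (10 / 3) * (1 / (2 * real K))) \<partial>restrict_space lborel {0..1::real})"
    by (simp add: emeasure_restrict_space space_restrict_space)
  also have "\<dots> \<le> (\<integral>\<^sup>+t. \<integral>\<^sup>+z. ennreal (norm (u (t, z)) powr (10 / 3)) \<partial>phys \<partial>restrict_space lborel {0..1})"
    by (intro nn_integral_mono slice) (simp add: space_restrict_space)
  also have "\<dots> = (\<integral>\<^sup>+x. ennreal (norm (u x) powr (10 / 3)) \<partial>spacetime)"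
    using measurable_compose[OF um powr_norm_measurable] unfolding spacetime_def by (intro P.nn_integral_fst)
  finally have I: "ennreal (v powr (10 / 3) * (1 / (2 * real K))) \<le> (\<integral>\<^sup>+x. ennreal (norm (u x) powr (10 / 3)) \<partial>spacetime)" .
  have "ennreal ((v powr (10 / 3) * (1 / (2 * real K))) powr (1 / (10 / 3))) \<le> Lp_norm (10 / 3) spacetime u"
    by (rule Lp_norm_geI[OF _ I]) auto
  also have "(v powr (10 / 3) * (1 / (2 * real K))) powr (1 / (10 / 3)) = fourier_const / (16 * sqrt 2) * real N powr (1 / 5)"
  proof -
    have N0: "real N > 0" using K N by simp
    have vN: "v = fourier_const / (16 * sqrt 2) * real N powr (1 / 2)"
      using N0 by (simp add: v_def N powr_half_sqrt real_sqrt_mult)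
    have "(v powr (10 / 3) * (1 / (2 * real K))) powr (1 / (10 / 3)) = v * (1 / real N) powr (3 / 10)"
      using v unfolding N of_nat_mult of_nat_numeral by (subst powr_mult) (simp_all add: powr_powr)
    also have "\<dots> = v * real N powr (- 3 / 10)"
      using N0 by (simp add: powr_minus_divide powr_divide)
    also have "\<dots> = fourier_const / (16 * sqrt 2) * real N powr (1 / 5)"
      unfolding vN by (simp add: powr_add[symmetric])
    finally show ?thesis .
  qed
  finally have "ennreal (fourier_const / (16 * sqrt 2) * real N powr (1 / 5)) \<le> Lp_norm (10 / 3) spacetime u" .
  moreover have "in_Lp 2 phys f" unfolding in_L2_iff using fm f2 by (simp add: le_less_trans)
  moreover have "Lp_norm 2 phys f \<le> 1" using f2 by (simp add: Lp_norm_2_le_1_iff)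
  ultimately show thesis using that ev by blast
qed

theorem theorem1p1:
  fixes chi :: "real \<Rightarrow> real"
  assumes "admissible_cutoff chi"
  shows "\<exists>c C :: real. 0 < c \<and> c \<le> C \<and>
    (\<forall>N::nat. N \<ge> 2 \<and> (\<exists>j. N = 2 ^ j) \<longrightarrow>
      ennreal (c * real N powr (1 / 5))
        \<le> operator_norm 2 phys (10 / 3) spacetime (is_evolution chi (real N)) \<and>
      operator_norm 2 phys (10 / 3) spacetime (is_evolution chi (real N))
        \<le> ennreal (C * real N powr (1 / 5)))"
proof -
  define c where "c = fourier_const / (16 * sqrt 2)"
  define C where "C = max c (strichartz_const powr (3 / 10))"
  have "0 < c" using fourier_const_pos by (simp add: c_def)
  moreover have "c \<le> C" by (simp add: C_def)
  moreover have "ennreal (c * real N powr (1 / 5))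
        \<le> operator_norm 2 phys (10 / 3) spacetime (is_evolution chi (real N)) \<and>
      operator_norm 2 phys (10 / 3) spacetime (is_evolution chi (real N))
        \<le> ennreal (C * real N powr (1 / 5))" if N: "N \<ge> 2 \<and> (\<exists>j. N = 2 ^ j)" for N :: nat
  proof
    from N obtain j where j: "N = 2 ^ j" "N \<ge> 2" by blast
    then have "j \<noteq> 0" by (cases j) auto
    then obtain i where "j = Suc i" by (cases j) auto
    then have K: "N = 2 * 2 ^ i" "(2::nat) ^ i \<ge> 1" using j by auto
    from evolution_lower_bound[OF assms K(2,1)] obtain f u where fu: "in_Lp 2 phys f" "Lp_norm 2 phys f \<le> 1" "is_evolution chi (real N) f u"
      "ennreal (c * real N powr (1 / 5)) \<le> Lp_norm (10 / 3) spacetime u" unfolding c_def by blast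
    then have "Lp_norm (10 / 3) spacetime u \<le> operator_norm 2 phys (10 / 3) spacetime (is_evolution chi (real N))"
      unfolding operator_norm_def by (intro Sup_upper) blast
    with fu(4) show "ennreal (c * real N powr (1 / 5)) \<le> operator_norm 2 phys (10 / 3) spacetime (is_evolution chi (real N))"
      by (rule order_trans)
    show "operator_norm 2 phys (10 / 3) spacetime (is_evolution chi (real N)) \<le> ennreal (C * real N powr (1 / 5))"
      unfolding operator_norm_def
    proof (rule Sup_least)
      fix X assume "X \<in> {Lp_norm (10 / 3) spacetime u | f u. in_Lp 2 phys f \<and> Lp_norm 2 phys f \<le> 1 \<and> is_evolution chi (real N) f u}"
      then obtain f u where X: "X = Lp_norm (10 / 3) spacetime u" "Lp_norm 2 phys f \<le> 1" "is_evolution chi (real N) f u" by blast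
      have "X \<le> ennreal (strichartz_const powr (3 / 10) * real N powr (1 / 5))"
        unfolding X(1) by (rule evolution_upper_bound[OF assms _ X(2,3)]) (use j in simp)
      also have "\<dots> \<le> ennreal (C * real N powr (1 / 5))"
        by (intro ennreal_leI mult_right_mono) (auto simp: C_def)
      finally show "X \<le> ennreal (C * real N powr (1 / 5))" .
    qed
  qed
  ultimately show ?thesis by blast
qed

end
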